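(* Let $\omega=B(0,1)\subset\mathbb R^2$, let $\hat\nu$ satisfy (N1), (N2), (N3) of the context, let $U_0\in\mathbb R^2\setminus\{0\}$, and let $H\in\mathcal H(\mathbb R^2)$ be the unique solution of the operator equation $QH=0$. Then there exist an element $\tilde H$ of the class $H\in\mathcal H(\mathbb R^2)$ and a number $\tau>0$ such that $$\tilde H(y)=\mathcal O(|y|^{-\tau})\quad\text{as }|y|\to\infty .$$
   Context: $\nu_0>0$ is a constant and $\hat\nu:[0,\infty)\to[0,\infty)$. (N1) $\hat\nu$ is $C^1$ and there is $\underline\nu>0$ with $\underline\nu\le\hat\nu(s)\le\nu_0$ and $\underline\nu\le(\hat\nu(s)s)'\le\nu_0$ for all $s\ge0$. (N2) $\hat\nu\in C^3([0,\infty))$; there is $\tilde c>0$ with $|\hat\nu'(s)|/s\le\tilde c$ for all $s\ge0$ (at $s=0$ in the sense of limits); and there are nonnegative constants $\tilde c_4,\tilde c_5,\tilde c',\tilde c''$ with $|(\hat\nu(s)s)''|\le\tilde c_4$, $|(\hat\nu(s)s)'''|\le\tilde c_5$, $|\hat\nu'(s)|\le\tilde c'$, $|\hat\nu''(s)|\le\tilde c''$ for all $s\ge0$. (N3) $\delta_{\hat\nu}:=\inf_{s>0}\hat\nu'(s)s/\hat\nu(s)$ satisfies $\delta_{\hat\nu}>\max\{-\tfrac13,\,-\tfrac{(1+k_1)^2}{(1+k_1)^2+2}\}$ with $k_1=(\underline\nu-\nu_0)/\nu_0$. $T(W)=\hat\nu(|W|)W$ for $W\in\mathbb R^2$, and $\tilde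 T(x,W)=\chi_{\mathbb R^2\setminus\omega}(x)T(W)+\chi_\omega(x)\nu_0W$. With $w(x)=\frac1{(1+|x|^2)^{1/2}\log(2+|x|)}$, let $\mathcal H^w(\mathbb R^2)=\{u\in\mathcal D'(\mathbb R^2): wu\in L^2,\nabla u\in L^2\}$ with its natural Hilbert norm, and $\mathcal H(\mathbb R^2)=\mathcal H^w(\mathbb R^2)/\mathbb R$ (quotient by constants, quotient norm). Gradients of classes are well defined. The operator $Q:\mathcal H(\mathbb R^2)\to\mathcal H(\mathbb R^2)^*$ is $$\langle Q\eta_1,\eta_2\rangle=\int_{\mathbb R^2}[\tilde T(x,U_0+\nabla\eta_1)-\tilde T(x,U_0)]\cdot\nabla\eta_2+\int_\omega(\nu_0-\hat\nu(|U_0|))U_0\cdot\nabla\eta_2 .$$ *)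

theory Defs
  imports "HOL-Analysis.Analysis" "HOL-Library.Landau_Symbols"
begin

text \<open>Derivative on the half line: one-sided at 0, the usual one elsewhere.\<close>

definition hderiv :: "(real \<Rightarrow> real) \<Rightarrow> real \<Rightarrow> real" where
  "hderiv f s = vector_derivative f (at s within {0..})"

primrec Ck_halfline :: "nat \<Rightarrow> (real \<Rightarrow> real) \<Rightarrow> bool" where
  "Ck_halfline 0 f \<longleftrightarrow> continuous_on {0..} f"
| "Ck_halfline (Suc n) f \<longleftrightarrow> f differentiable_on {0..} \<and> Ck_halfline n (hderiv f)"

text \<open>
  \<open>\<nu>\<^sub>l\<close> is the lower bound in the ellipticity condition; it is a parameter because \<open>N3\<close>
  refers to the same constant.
\<close>

definition N1 :: "real \<Rightarrow> real \<Rightarrow> (real \<Rightarrow> real) \<Rightarrow> bool" where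
  "N1 \<nu>\<^sub>0 \<nu>\<^sub>l \<nu> \<longleftrightarrow>
     Ck_halfline 1 \<nu> \<and> \<nu>\<^sub>l > 0 \<and>
     (\<forall>s\<ge>0. \<nu>\<^sub>l \<le> \<nu> s \<and> \<nu> s \<le> \<nu>\<^sub>0) \<and>
     (\<forall>s\<ge>0. \<nu>\<^sub>l \<le> hderiv (\<lambda>s. \<nu> s * s) s \<and> hderiv (\<lambda>s. \<nu> s * s) s \<le> \<nu>\<^sub>0)"

text \<open>
  The bound on the quotient at \<open>s = 0\<close> is understood in the sense of limits.
\<close>

definition N2 :: "(real \<Rightarrow> real) \<Rightarrow> bool" where
  "N2 \<nu> \<longleftrightarrow>
     Ck_halfline 3 \<nu> \<and>
     (\<exists>c>0. (\<forall>s>0. \<bar>hderiv \<nu> s\<bar> / s \<le> c) \<and>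
            (\<exists>l\<le>c. ((\<lambda>s. \<bar>hderiv \<nu> s\<bar> / s) \<longlongrightarrow> l) (at_right 0))) \<and>
     (\<exists>c4\<ge>0. \<forall>s\<ge>0. \<bar>(hderiv ^^ 2) (\<lambda>s. \<nu> s * s) s\<bar> \<le> c4) \<and>
     (\<exists>c5\<ge>0. \<forall>s\<ge>0. \<bar>(hderiv ^^ 3) (\<lambda>s. \<nu> s * s) s\<bar> \<le> c5) \<and>
     (\<exists>c'\<ge>0. \<forall>s\<ge>0. \<bar>hderiv \<nu> s\<bar> \<le> c') \<and>
     (\<exists>c''\<ge>0. \<forall>s\<ge>0. \<bar>(hderiv ^^ 2) \<nu> s\<bar> \<le> c'')"

text \<open>The set is bounded below under \<open>N1\<close>, so this infimum is the genuine one.\<close>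

definition delta :: "(real \<Rightarrow> real) \<Rightarrow> real" where
  "delta \<nu> = (INF s\<in>{0<..}. hderiv \<nu> s * s / \<nu> s)"

definition N3 :: "real \<Rightarrow> real \<Rightarrow> (real \<Rightarrow> real) \<Rightarrow> bool" where
  "N3 \<nu>\<^sub>0 \<nu>\<^sub>l \<nu> \<longleftrightarrow>
     (let k = (\<nu>\<^sub>l - \<nu>\<^sub>0) / \<nu>\<^sub>0
      in delta \<nu> > max (- (1 / 3)) (- ((1 + k)\<^sup>2 / ((1 + k)\<^sup>2 + 2))))"

definition T :: "(real \<Rightarrow> real) \<Rightarrow> real^2 \<Rightarrow> real^2" where
  "T \<nu> W = \<nu> (norm W) *\<^sub>R W"

definition T_tilde :: "(real^2) set \<Rightarrow> real \<Rightarrow> (real \<Rightarrow> real) \<Rightarrow> real^2 \<Rightarrow> real^2 \<Rightarrow> real^2" where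
  "T_tilde \<omega> \<nu>\<^sub>0 \<nu> x W =
     indicator (- \<omega>) x *\<^sub>R T \<nu> W + indicator \<omega> x *\<^sub>R (\<nu>\<^sub>0 *\<^sub>R W)"

definition pderiv2 :: "2 \<Rightarrow> (real^2 \<Rightarrow> real) \<Rightarrow> real^2 \<Rightarrow> real" where
  "pderiv2 i \<phi> x = frechet_derivative \<phi> (at x) (axis i 1)"

primrec Ck_plane :: "nat \<Rightarrow> (real^2 \<Rightarrow> real) \<Rightarrow> bool" where
  "Ck_plane 0 \<phi> \<longleftrightarrow> continuous_on UNIV \<phi>"
| "Ck_plane (Suc n) \<phi> \<longleftrightarrow> \<phi> differentiable_on UNIV \<and> (\<forall>i. Ck_plane n (pderiv2 i \<phi>))"

definition test_function :: "(real^2 \<Rightarrow> real) \<Rightarrow> bool" where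
  "test_function \<phi> \<longleftrightarrow> (\<forall>n. Ck_plane n \<phi>) \<and> compact (closure {x. \<phi> x \<noteq> 0})"

definition L2_weak_gradient :: "(real^2 \<Rightarrow> real) \<Rightarrow> (real^2 \<Rightarrow> real^2) \<Rightarrow> bool" where
  "L2_weak_gradient u g \<longleftrightarrow>
     g \<in> borel_measurable lborel \<and> integrable lborel (\<lambda>x. (norm (g x))\<^sup>2) \<and>
     (\<forall>\<phi> i. test_function \<phi> \<longrightarrow>
        (LINT x|lborel. u x * pderiv2 i \<phi> x) = - (LINT x|lborel. g x $ i * \<phi> x))"

definition weight :: "real^2 \<Rightarrow> real" where
  "weight x = 1 / (sqrt (1 + (norm x)\<^sup>2) * ln (2 + norm x))"

text \<open>
  The weight is continuous and positive, hence locally bounded away from zero: a distribution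
  whose product with it is in \<open>L\<^sup>2\<close> is a locally square integrable function. The space
  therefore consists of functions; equality almost everywhere is absorbed into the relation below.
\<close>

definition Hw :: "(real^2 \<Rightarrow> real) set" where
  "Hw = {u. u \<in> borel_measurable lborel \<and>
            integrable lborel (\<lambda>x. (weight x * u x)\<^sup>2) \<and> (\<exists>g. L2_weak_gradient u g)}"

definition mod_constants :: "((real^2 \<Rightarrow> real) \<times> (real^2 \<Rightarrow> real)) set" where
  "mod_constants = {(u, v). u \<in> Hw \<and> v \<in> Hw \<and> (\<exists>c. AE x in lborel. u x = v x + c)}"

definition H_space :: "(real^2 \<Rightarrow> real) set set" where
  "H_space = Hw // mod_constants"

text \<open>
  The weak gradient is determined almost everywhere by the class, so neither choice
  (of the representative and of the version of its gradient) affects the integrals below.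
\<close>

definition grad_class :: "(real^2 \<Rightarrow> real) set \<Rightarrow> real^2 \<Rightarrow> real^2" where
  "grad_class \<eta> = (SOME g. \<exists>u\<in>\<eta>. L2_weak_gradient u g)"

text \<open>
  Both integrands are integrable under \<open>N1\<close> when the classes lie in \<open>H_space\<close>, because
  \<open>T \<nu>\<close> is then Lipschitz continuous and \<open>\<omega>\<close> has finite measure. The equation asserting
  that the image of a class vanishes in the dual space says that the pairing with every
  class in \<open>H_space\<close> is zero.
\<close>

definition Q :: "(real^2) set \<Rightarrow> real \<Rightarrow> (real \<Rightarrow> real) \<Rightarrow> real^2 \<Rightarrow>
    (real^2 \<Rightarrow> real) set \<Rightarrow> (real^2 \<Rightarrow> real) set \<Rightarrow> real" where
  "Q \<omega> \<nu>\<^sub>0 \<nu> U\<^sub>0 \<eta>\<^sub>1 \<eta>\<^sub>2 =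
     (LINT x|lborel. (T_tilde \<omega> \<nu>\<^sub>0 \<nu> x (U\<^sub>0 + grad_class \<eta>\<^sub>1 x) - T_tilde \<omega> \<nu>\<^sub>0 \<nu> x U\<^sub>0)
                       \<bullet> grad_class \<eta>\<^sub>2 x) +
     (LINT x:\<omega>|lborel. ((\<nu>\<^sub>0 - \<nu> (norm U\<^sub>0)) *\<^sub>R U\<^sub>0) \<bullet> grad_class \<eta>\<^sub>2 x)"

end

theory Submission
  imports Defs
begin

text \<open>
  Write \<open>g\<close> for the gradient of the class \<open>H\<close>. On the complement of the unit disc the equation says that
  the flux \<open>T (U\<^sub>0 + g) - T U\<^sub>0\<close> is divergence free. The ellipticity bounds on \<open>\<nu> s\<close> and on the
  derivative of \<open>\<nu> s * s\<close> make \<open>T\<close> Lipschitz continuous and strongly monotone (\<open>T_Lipschitz\<close>,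
  \<open>T_monotone\<close>), so the flux is comparable to \<open>g\<close> in size and in direction. Hence \<open>H\<close> behaves like a solution of a linear elliptic equation
  with bounded measurable coefficients, and in the plane such solutions are controlled by their
  energy alone, in the way found by Morrey and Widman.

  Testing the equation with \<open>\<theta> (u - c)\<close> for a cutoff \<open>\<theta>\<close> bounds the energy where \<open>\<theta> = 1\<close> by
  the squares of \<open>g\<close> and of \<open>(u - c) / R\<close> on the annulus where \<open>\<theta>\<close> varies, and a Poincare
  inequality on the annulus (\<open>poincare_annulus\<close>) turns this into the energy of a slightly larger
  annulus (\<open>caccioppoli\<close>). Filling the hole, that is, adding a multiple of the left-hand side to both
  sides, gives a factor \<open>theta < 1\<close> for each dilation by 8. It applies to squares
  that shrink towards a point away from the disc (\<open>interior_decay\<close>) and, with \<open>\<theta>\<close> equal to 1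
  near infinity, to complements of growing squares (\<open>exterior_decay\<close>). The energy outside the square of
  half-width \<open>8 ^ j / 2\<close> is therefore of order \<open>theta ^ j\<close>.

  Energy controls values through mollification. If two kernels have the same mass, their difference
  is the divergence of an explicit compactly supported field, so the difference of the two averages
  of \<open>u\<close> is an integral of \<open>g\<close> against this field and is controlled by the energy of a set that contains
  the field's support (\<open>mollifier_difference\<close>). With product kernels the field is supported in an
  L-shaped region joining the two squares. Letting the scale tend to zero gives the Poincare
  inequality and, together with the interior decay, a pointwise bound for the distance of \<open>u\<close> from its
  average at a scale comparable to \<open>norm x\<close>. Moving the centre within and between annuli at this
  scale costs a multiple of \<open>sqrt theta ^ j\<close> in the annulus of index \<open>j\<close>. These costs form a geometric
  series, so the averages converge to a constant \<open>c\<close>, and \<open>u - c\<close> is of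
  order \<open>sqrt theta ^ j\<close>, a negative power of \<open>norm x\<close> (\<open>decay_AE\<close>, \<open>power_decay_AE\<close>).
  Finally \<open>u - c\<close> belongs to the weighted space because the weight is square integrable on the plane
  (\<open>weight_square_integrable\<close>), and it may be changed on the exceptional null set.
\<close>

section \<open>Smooth functions of one variable\<close>

primrec Ck_line :: "nat \<Rightarrow> (real \<Rightarrow> real) \<Rightarrow> bool" where
  "Ck_line 0 f \<longleftrightarrow> continuous_on UNIV f"
| "Ck_line (Suc n) f \<longleftrightarrow>
     (\<exists>f'. (\<forall>t. (f has_real_derivative f' t) (at t)) \<and> Ck_line n f')"

lemma Ck_line_SucI:
  "Ck_line n f' \<Longrightarrow> (\<And>t. (f has_real_derivative f' t) (at t)) \<Longrightarrow> Ck_line (Suc n) f"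
  by auto

definition smooth_line :: "(real \<Rightarrow> real) \<Rightarrow> bool" where
  "smooth_line f \<longleftrightarrow> (\<forall>n. Ck_line n f)"

lemma Ck_line_Suc_lower: "Ck_line (Suc n) f \<Longrightarrow> Ck_line n f"
proof (induction n arbitrary: f)
  case 0
  then obtain f' where f: "\<forall>t. (f has_real_derivative f' t) (at t)" "Ck_line 0 f'"
    by auto
  have "isCont f t" for t by (rule DERIV_isCont[OF f(1)[rule_format]])
  then show ?case by (simp add: continuous_at_imp_continuous_on)
next
  case (Suc n)
  from Suc.prems obtain f' where f: "\<forall>t. (f has_real_derivative f' t) (at t)" "Ck_line (Suc n) f'"
    by auto
  show ?case by (rule Ck_line_SucI[OF Suc.IH[OF f(2)] f(1)[rule_format]])
qed

lemma Ck_line_const: "Ck_line n (\<lambda>t. c)"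
proof (induction n arbitrary: c)
  case (Suc n)
  show ?case using Suc[of 0] by (auto intro!: exI[of _ "\<lambda>t. 0"])
qed auto

lemma Ck_line_add: "Ck_line n f \<Longrightarrow> Ck_line n g \<Longrightarrow> Ck_line n (\<lambda>t. f t + g t)"
proof (induction n arbitrary: f g)
  case 0
  then show ?case by (auto intro: continuous_intros)
next
  case (Suc n)
  from Suc.prems(1) obtain f' where f: "\<forall>t. (f has_real_derivative f' t) (at t)" "Ck_line n f'"
    by auto
  from Suc.prems(2) obtain g' where g: "\<forall>t. (g has_real_derivative g' t) (at t)" "Ck_line n g'"
    by auto
  show ?case by (rule Ck_line_SucI[OF Suc.IH[OF f(2) g(2)] DERIV_add[OF f(1)[rule_format] g(1)[rule_format]]])
qed

lemma Ck_line_mult: "Ck_line n f \<Longrightarrow> Ck_line n g \<Longrightarrow> Ck_line n (\<lambda>t. f t * g t)"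
proof (induction n arbitrary: f g)
  case 0
  then show ?case by (auto intro: continuous_intros)
next
  case (Suc n)
  from Suc.prems obtain f' g' where fg: "\<forall>t. (f has_real_derivative f' t) (at t)" "Ck_line n f'"
    "\<forall>t. (g has_real_derivative g' t) (at t)" "Ck_line n g'" by auto
  have "Ck_line n (\<lambda>t. f' t * g t + g' t * f t)"
    by (rule Ck_line_add[OF Suc.IH[OF fg(2) Ck_line_Suc_lower[OF Suc.prems(2)]]
          Suc.IH[OF fg(4) Ck_line_Suc_lower[OF Suc.prems(1)]]])
  moreover have "\<And>t. ((\<lambda>t. f t * g t) has_real_derivative f' t * g t + g' t * f t) (at t)"
    by (rule DERIV_mult[OF fg(1)[rule_format] fg(3)[rule_format]])
  ultimately show ?case
    by (rule Ck_line_SucI)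
qed

lemma Ck_line_inverse:
  assumes "Ck_line n f" "\<And>t. f t \<noteq> 0"
  shows "Ck_line n (\<lambda>t. inverse (f t))"
  using assms
proof (induction n arbitrary: f)
  case 0
  then show ?case by (auto intro: continuous_on_inverse)
next
  case (Suc n)
  from Suc.prems obtain f' where f: "\<forall>t. (f has_real_derivative f' t) (at t)" "Ck_line n f'"
    by auto
  have i: "Ck_line n (\<lambda>t. inverse (f t))"
    using Suc.IH[OF Ck_line_Suc_lower[OF Suc.prems(1)] Suc.prems(2)] .
  have "Ck_line n (\<lambda>t. (- 1) * (inverse (f t) * f' t * inverse (f t)))"
    by (rule Ck_line_mult[OF Ck_line_const Ck_line_mult[OF Ck_line_mult[OF i f(2)] i]])
  moreover have "\<And>t. ((\<lambda>t. inverse (f t)) has_real_derivative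
      (- 1) * (inverse (f t) * f' t * inverse (f t))) (at t)"
    using DERIV_inverse'[OF f(1)[rule_format] Suc.prems(2)] by simp
  ultimately show ?case
    by (rule Ck_line_SucI)
qed

lemma Ck_line_affine: "Ck_line n f \<Longrightarrow> Ck_line n (\<lambda>t. f (a * t + b))"
proof (induction n arbitrary: f)
  case 0
  then show ?case by (auto intro!: continuous_on_compose2[of UNIV f] continuous_intros)
next
  case (Suc n)
  from Suc.prems obtain f' where f: "\<forall>t. (f has_real_derivative f' t) (at t)" "Ck_line n f'"
    by auto
  have "Ck_line n (\<lambda>t. f' (a * t + b) * a)"
    by (rule Ck_line_mult[OF Suc.IH[OF f(2)] Ck_line_const])
  moreover have "((\<lambda>t. f (a * t + b)) has_real_derivative f' (a * t + b) * a) (at t)" for t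
  proof (rule DERIV_chain2[where f = f and g = "\<lambda>t. a * t + b"])
    show "(f has_real_derivative f' (a * t + b)) (at (a * t + b))" using f(1) by blast
    show "((\<lambda>t. a * t + b) has_real_derivative a) (at t)"
      by (auto intro!: derivative_eq_intros)
  qed
  ultimately show ?case
    by (rule Ck_line_SucI)
qed

lemma smooth_line_const: "smooth_line (\<lambda>t. c)"
  and smooth_line_add: "smooth_line f \<Longrightarrow> smooth_line g \<Longrightarrow> smooth_line (\<lambda>t. f t + g t)"
  and smooth_line_mult: "smooth_line f \<Longrightarrow> smooth_line g \<Longrightarrow> smooth_line (\<lambda>t. f t * g t)"
  and smooth_line_affine: "smooth_line f \<Longrightarrow> smooth_line (\<lambda>t. f (a * t + b))"
  by (simp_all add: smooth_line_def Ck_line_const Ck_line_add Ck_line_mult Ck_line_affine)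

lemma smooth_line_divide:
  "smooth_line f \<Longrightarrow> smooth_line g \<Longrightarrow> (\<And>t. g t \<noteq> 0) \<Longrightarrow> smooth_line (\<lambda>t. f t / g t)"
  by (simp add: smooth_line_def Ck_line_mult Ck_line_inverse divide_inverse)

lemma smooth_line_diff:
  assumes "smooth_line f" "smooth_line g" shows "smooth_line (\<lambda>t. f t - g t)"
  using smooth_line_add[OF assms(1) smooth_line_mult[OF smooth_line_const[of "-1"] assms(2)]]
  by simp

lemma smooth_line_has_derivative:
  assumes "smooth_line f" shows "(f has_real_derivative deriv f t) (at t)"
proof -
  obtain f' where "\<forall>t. (f has_real_derivative f' t) (at t)"
    using assms unfolding smooth_line_def by (metis Ck_line.simps(2))
  then show ?thesis by (metis DERIV_imp_deriv)
qed

lemma smooth_line_deriv: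
  assumes "smooth_line f" shows "smooth_line (deriv f)"
  unfolding smooth_line_def
proof
  fix n
  obtain f' where f: "\<forall>t. (f has_real_derivative f' t) (at t)" "Ck_line n f'"
    using assms unfolding smooth_line_def by (metis Ck_line.simps(2))
  then have "deriv f = f'" by (auto intro: DERIV_imp_deriv)
  with f show "Ck_line n (deriv f)" by simp
qed

lemma smooth_line_continuous: "smooth_line f \<Longrightarrow> continuous_on A f"
  unfolding smooth_line_def by (metis Ck_line.simps(1) continuous_on_subset subset_UNIV)

lemma smooth_line_measurable: "smooth_line f \<Longrightarrow> f \<in> borel_measurable borel"
  by (intro borel_measurable_continuous_onI smooth_line_continuous)

text \<open>
  The functions \<open>exp (- 1 / t) / t ^ m\<close>, extended by zero to \<open>t \<le> 0\<close>, form a family whose linear span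
  is closed under differentiation; the exponent \<open>m\<close> is carried along for this reason.
\<close>

definition flat :: "nat \<Rightarrow> real \<Rightarrow> real" where
  "flat m t = (if t > 0 then exp (- (1 / t)) / t ^ m else 0)"

lemma flat_tendsto_0: "((\<lambda>t. flat m t) \<longlongrightarrow> 0) (at 0)"
proof -
  have "((\<lambda>t. (inverse t) ^ m / exp (inverse t)) \<longlongrightarrow> (0::real)) (at_right 0)"
    by (rule filterlim_compose[OF tendsto_power_div_exp_0 filterlim_inverse_at_top_right])
  then have "((\<lambda>t. flat m t) \<longlongrightarrow> 0) (at_right 0)"
    by (rule Lim_transform_eventually)
      (auto simp: flat_def eventually_at_filter exp_minus divide_inverse power_inverse mult.commute)
  moreover have "((\<lambda>t. flat m t) \<longlongrightarrow> 0) (at_left 0)"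
    by (rule Lim_transform_eventually[OF tendsto_const])
      (auto simp: flat_def eventually_at_filter)
  ultimately show ?thesis by (simp add: filterlim_split_at)
qed

lemma flat_has_derivative:
  "(flat m has_real_derivative flat (m + 2) t - m * flat (m + 1) t) (at t)"
proof -
  consider "t > 0" | "t < 0" | "t = 0" by linarith
  then show ?thesis
  proof cases
    case 1
    have e: "((\<lambda>t. exp (- (1 / t))) has_real_derivative exp (- (1 / t)) * (1 / t\<^sup>2)) (at t)"
      using 1 by (auto intro!: derivative_eq_intros simp: power2_eq_square)
    have p: "((\<lambda>t. inverse t ^ m) has_real_derivative
        real m * (inverse t ^ (m - 1) * (- (inverse t ^ 2)))) (at t)"
      using 1 by (auto intro!: derivative_eq_intros simp: power2_eq_square)
    have "((\<lambda>t. exp (- (1 / t)) * inverse t ^ m) has_real_derivative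
        exp (- (1 / t)) * (1 / t\<^sup>2) * inverse t ^ m +
        real m * (inverse t ^ (m - 1) * (- (inverse t ^ 2))) * exp (- (1 / t))) (at t)"
      by (rule DERIV_mult[OF e p])
    also have "exp (- (1 / t)) * (1 / t\<^sup>2) * inverse t ^ m +
        real m * (inverse t ^ (m - 1) * (- (inverse t ^ 2))) * exp (- (1 / t)) =
        flat (m + 2) t - m * flat (m + 1) t"
      using 1 by (cases m) (simp_all add: flat_def power2_eq_square divide_inverse power_inverse algebra_simps)
    also have "(\<lambda>t::real. exp (- (1 / t)) * inverse t ^ m) = (\<lambda>t. exp (- (1 / t)) / t ^ m)"
      by (simp add: divide_inverse power_inverse)
    finally have "((\<lambda>t. exp (- (1 / t)) / t ^ m) has_real_derivative
        flat (m + 2) t - m * flat (m + 1) t) (at t)" .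
    then show ?thesis
      by (rule has_field_derivative_transform_within_open[of _ _ _ "{0<..}"])
        (use 1 in \<open>auto simp: flat_def\<close>)
  next
    case 2
    have "((\<lambda>t. 0) has_real_derivative flat (m + 2) t - m * flat (m + 1) t) (at t)"
      using 2 by (auto simp: flat_def)
    then show ?thesis
      by (rule has_field_derivative_transform_within_open[of _ _ _ "{..<0}"])
        (use 2 in \<open>auto simp: flat_def\<close>)
  next
    case 3
    have "flat (Suc m) h = (flat m (0 + h) - flat m 0) / h" for h
      by (simp add: flat_def)
    then show ?thesis using flat_tendsto_0[of "Suc m"] 3
      unfolding DERIV_def by (simp add: flat_def)
  qed
qed

lemma smooth_flat: "smooth_line (flat m)"
proof -
  have "Ck_line n (flat m)" for n
  proof (induction n arbitrary: m)
    case 0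
    have "isCont (flat m) t" for t using DERIV_isCont[OF flat_has_derivative] .
    then show ?case by (simp add: continuous_at_imp_continuous_on)
  next
    case (Suc n)
    have "Ck_line n (\<lambda>t. flat (m + 2) t + (- real m) * flat (m + 1) t)"
      by (intro Ck_line_add Ck_line_mult Ck_line_const Suc)
    then show ?case using flat_has_derivative[of m]
      by (auto intro!: exI[of _ "\<lambda>t. flat (m + 2) t - m * flat (m + 1) t"])
  qed
  then show ?thesis by (simp add: smooth_line_def)
qed

lemma flat_nonneg: "0 \<le> flat m t" by (simp add: flat_def)
lemma flat_le_1: "flat 0 t \<le> 1" by (simp add: flat_def)

text \<open>
  A smooth transition from 0 to 1 on \<open>[-1, 1]\<close>. It supplies both the mollifiers (through its derivative
  \<open>bump\<close>) and the cutoff functions. The denominator vanishes nowhere because one of \<open>1 + t\<close> and \<open>1 - t\<close> is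
  positive.
\<close>

definition step :: "real \<Rightarrow> real" where
  "step t = flat 0 (1 + t) / (flat 0 (1 + t) + flat 0 (1 - t))"

lemma step_denominator_pos: "flat 0 (1 + t) + flat 0 (1 - t) > 0"
  by (auto simp: flat_def intro: add_pos_pos)

lemma smooth_flat_affine: "smooth_line (\<lambda>t. flat m (1 + t))" "smooth_line (\<lambda>t. flat m (1 - t))"
  using smooth_line_affine[OF smooth_flat[of m], of 1 1]
    smooth_line_affine[OF smooth_flat[of m], of "-1" 1]
  by (simp_all add: add.commute)

lemma smooth_step: "smooth_line step"
  unfolding step_def[abs_def]
  by (intro smooth_line_divide smooth_line_add smooth_flat_affine)
    (metis step_denominator_pos less_irrefl)

lemma step_eq_0: "t \<le> - 1 \<Longrightarrow> step t = 0" and step_eq_1: "1 \<le> t \<Longrightarrow> step t = 1"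
  by (auto simp: step_def flat_def)

lemma step_nonneg: "0 \<le> step t"
  using step_denominator_pos[of t] flat_nonneg by (simp add: step_def)
lemma step_le_1: "step t \<le> 1"
  using step_denominator_pos[of t] flat_nonneg[of 0 "1 - t"] by (simp add: step_def)

definition bump :: "real \<Rightarrow> real" where "bump = deriv step"

lemma step_has_derivative: "(step has_real_derivative bump t) (at t)"
  unfolding bump_def by (rule smooth_line_has_derivative[OF smooth_step])

lemma smooth_bump: "smooth_line bump"
  unfolding bump_def by (rule smooth_line_deriv[OF smooth_step])

text \<open>
  For \<open>\<bar>t\<bar> \<ge> 1\<close> the transition function attains its minimum 0 or its maximum 1 at \<open>t\<close>; this covers the
  end points \<open>1\<close> and \<open>-1\<close> without a one-sided limit.
\<close>

lemma bump_eq_0: assumes "1 \<le> \<bar>t\<bar>" shows "bump t = 0"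
proof (cases "t \<ge> 1")
  case True
  show ?thesis by (rule DERIV_local_max[OF step_has_derivative[of t], of 1])
      (use True step_eq_1 step_le_1 in auto)
next
  case False
  show ?thesis by (rule DERIV_local_min[OF step_has_derivative[of t], of 1])
      (use False assms step_eq_0 step_nonneg in auto)
qed

lemma bump_nonneg: "0 \<le> bump t"
proof -
  have "(flat 0 has_real_derivative flat 2 (1 + t)) (at (1 + t))"
    "(flat 0 has_real_derivative flat 2 (1 - t)) (at (1 - t))"
    using flat_has_derivative[of 0 "1 + t"] flat_has_derivative[of 0 "1 - t"] by (auto simp: numeral_2_eq_2)
  note d = this
  have i: "((\<lambda>t. 1 + t) has_real_derivative 1) (at t)"
    "((\<lambda>t. 1 - t) has_real_derivative -1) (at t)"
    by (auto intro!: derivative_eq_intros)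
  have 1: "((\<lambda>t. flat 0 (1 + t)) has_real_derivative flat 2 (1 + t)) (at t)"
    using DERIV_chain2[where f = "flat 0" and g = "\<lambda>t. 1 + t" and x = t, OF d(1) i(1)] by simp
  have 2: "((\<lambda>t. flat 0 (1 - t)) has_real_derivative - flat 2 (1 - t)) (at t)"
    using DERIV_chain2[where f = "flat 0" and g = "\<lambda>t. 1 - t" and x = t, OF d(2) i(2)] by simp
  let ?d = "flat 0 (1 + t) + flat 0 (1 - t)"
  have "(step has_real_derivative (flat 2 (1 + t) * ?d - flat 0 (1 + t) *
      (flat 2 (1 + t) + - flat 2 (1 - t))) / (?d * ?d)) (at t)"
    unfolding step_def[abs_def]
    by (rule DERIV_divide[OF 1 DERIV_add[OF 1 2]]) (use step_denominator_pos[of t] in auto)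
  then have "bump t = (flat 2 (1 + t) * ?d - flat 0 (1 + t) *
      (flat 2 (1 + t) + - flat 2 (1 - t))) / (?d * ?d)"
    using step_has_derivative DERIV_unique by blast
  also have "\<dots> = (flat 2 (1 + t) * flat 0 (1 - t) + flat 0 (1 + t) * flat 2 (1 - t)) / (?d * ?d)"
    by (simp add: power_inverse algebra_simps)
  also have "\<dots> \<ge> 0" by (intro divide_nonneg_nonneg add_nonneg_nonneg mult_nonneg_nonneg flat_nonneg)
  finally show ?thesis .
qed

lemma bump_bounded: "\<exists>C>0. \<forall>t. bump t \<le> C"
proof -
  have "compact (bump ` {-1..1})"
    by (intro compact_continuous_image smooth_line_continuous smooth_bump) auto
  then obtain C where C: "\<And>t. t \<in> {-1..1} \<Longrightarrow> \<bar>bump t\<bar> \<le> C"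
    by (metis compact_imp_bounded bounded_iff imageI real_norm_def)
  have "bump t \<le> max 1 C" for t
  proof (cases "\<bar>t\<bar> \<le> 1")
    case True
    then have "t \<in> {-1..1}" by auto
    from C[OF this] show ?thesis by linarith
  qed (use bump_eq_0[of t] in auto)
  then show ?thesis by (intro exI[of _ "max 1 C"]) auto
qed

definition bump_max :: real where "bump_max = (SOME C. C > 0 \<and> (\<forall>t. bump t \<le> C))"

lemma bump_max: "bump_max > 0" "bump t \<le> bump_max"
  using someI_ex[OF bump_bounded[simplified]] unfolding bump_max_def by blast+

section \<open>Squares, tensor products and the fundamental lemma\<close>

text \<open>
  Squares replace discs throughout, since the kernels and cutoffs are products of functions of one
  variable.
\<close>

definition sq :: "real^2 \<Rightarrow> real \<Rightarrow> (real^2) set" where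
  "sq z r = {y. \<forall>i. \<bar>y $ i - z $ i\<bar> \<le> r}"

lemma mem_sq: "y \<in> sq z r \<longleftrightarrow> \<bar>y $ 1 - z $ 1\<bar> \<le> r \<and> \<bar>y $ 2 - z $ 2\<bar> \<le> r"
  by (simp add: sq_def forall_2)

lemma sq_eq_cbox: "sq z r = cbox (\<chi> i. z $ i - r) (\<chi> i. z $ i + r)"
  by (auto simp: sq_def mem_box_cart abs_le_iff) (smt (verit, best))+

lemma sq_borel [measurable, simp]: "sq z r \<in> sets borel"
  by (simp add: sq_eq_cbox)

lemma emeasure_sq: "0 \<le> r \<Longrightarrow> emeasure lborel (sq z r) = ennreal ((2 * r)\<^sup>2)"
proof -
  assume r: "0 \<le> r"
  then have "cbox (\<chi> i. z $ i - r) (\<chi> i. z $ i + r) \<noteq> {}"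
    by (auto simp: interval_eq_empty_cart not_less)
  then have "measure lborel (cbox (\<chi> i. z $ i - r) (\<chi> i. z $ i + r)) = (2 * r)\<^sup>2"
    by (subst content_cbox_cart) (auto simp: UNIV_2 power2_eq_square)
  then show ?thesis
    using emeasure_lborel_cbox_finite[of "\<chi> i. z $ i - r" "\<chi> i. z $ i + r"]
    by (simp add: sq_eq_cbox emeasure_eq_ennreal_measure)
qed

lemma emeasure_sq_finite: "emeasure lborel (sq z r) < \<infinity>"
  by (simp add: sq_eq_cbox emeasure_lborel_cbox_eq)

lemma measure_sq: "0 \<le> r \<Longrightarrow> measure lborel (sq z r) = (2 * r)\<^sup>2"
  by (simp add: measure_def emeasure_sq)

lemma norm_le_two_sq: "y \<in> sq 0 r \<Longrightarrow> norm y \<le> 2 * r"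
  using norm_le_l1_cart[of y] by (simp add: mem_sq sum_2)

lemma mem_sq_norm: "norm y \<le> r \<Longrightarrow> y \<in> sq 0 r"
  using component_le_norm_cart[of y 1] component_le_norm_cart[of y 2] by (simp add: mem_sq)

text \<open>
  Tensor products of functions of one variable. They are closed under partial derivatives, which
  reduces smoothness in the plane to smoothness on the line.
\<close>

definition tens :: "(real \<Rightarrow> real) \<Rightarrow> (real \<Rightarrow> real) \<Rightarrow> real^2 \<Rightarrow> real" where
  "tens \<alpha> \<beta> y = \<alpha> (y $ 1) * \<beta> (y $ 2)"

lemma pderiv2_eq:
  assumes "(\<phi> has_derivative D) (at x)" shows "pderiv2 i \<phi> x = D (axis i 1)"
  unfolding pderiv2_def using frechet_derivative_at[OF assms] by simp

lemma tens_has_derivative: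
  assumes "smooth_line \<alpha>" "smooth_line \<beta>"
  shows "(tens \<alpha> \<beta> has_derivative
    (\<lambda>h. \<alpha> (x $ 1) * (deriv \<beta> (x $ 2) * h $ 2) + deriv \<alpha> (x $ 1) * h $ 1 * \<beta> (x $ 2))) (at x)"
proof -
  have c: "((\<lambda>y::real^2. y $ i) has_derivative (\<lambda>h. h $ i)) (at x)" for i
    by (intro bounded_linear_imp_has_derivative bounded_linear_vec_nth)
  have d: "(f has_derivative (\<lambda>h. deriv f t * h)) (at t)" if "smooth_line f" for f t
    using smooth_line_has_derivative[OF that, of t] by (simp add: has_field_derivative_def)
  show ?thesis
    unfolding tens_def[abs_def]
    by (rule has_derivative_mult[OF has_derivative_compose[OF c d[OF assms(1)]]
          has_derivative_compose[OF c d[OF assms(2)]]])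
qed

lemma pderiv2_tens:
  assumes "smooth_line \<alpha>" "smooth_line \<beta>"
  shows "pderiv2 1 (tens \<alpha> \<beta>) = tens (deriv \<alpha>) \<beta>" "pderiv2 2 (tens \<alpha> \<beta>) = tens \<alpha> (deriv \<beta>)"
  using pderiv2_eq[OF tens_has_derivative[OF assms]]
  by (auto simp: fun_eq_iff tens_def axis_def)

lemma Ck_plane_tens: "smooth_line \<alpha> \<Longrightarrow> smooth_line \<beta> \<Longrightarrow> Ck_plane n (tens \<alpha> \<beta>)"
proof (induction n arbitrary: \<alpha> \<beta>)
  case 0
  have "continuous_on UNIV (\<lambda>y::real^2. f (y $ i))" if "smooth_line f" for f i
    by (rule continuous_on_compose2[OF smooth_line_continuous[OF that, of UNIV]])
      (auto intro: continuous_intros)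
  with 0 show ?case by (auto simp: tens_def[abs_def] intro!: continuous_on_mult)
next
  case (Suc n)
  have "tens \<alpha> \<beta> differentiable_on UNIV"
    using tens_has_derivative[OF Suc.prems]
    by (auto simp: differentiable_on_def differentiable_def)
  then show ?case
    using Suc by (simp add: forall_2 pderiv2_tens smooth_line_deriv)
qed

lemma Ck_plane_Suc_lower: "Ck_plane (Suc n) \<phi> \<Longrightarrow> Ck_plane n \<phi>"
proof (induction n arbitrary: \<phi>)
  case 0
  then show ?case by (auto intro: differentiable_imp_continuous_on)
next
  case (Suc n)
  then have "\<phi> differentiable_on UNIV" "\<forall>i. Ck_plane (Suc n) (pderiv2 i \<phi>)" by simp_all
  with Suc.IH show ?case by simp
qed

lemma Ck_plane_add: "Ck_plane n f \<Longrightarrow> Ck_plane n g \<Longrightarrow> Ck_plane n (\<lambda>x. f x + g x)"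
proof (induction n arbitrary: f g)
  case 0
  then show ?case by (auto intro: continuous_on_add)
next
  case (Suc n)
  then have d: "f differentiable (at x)" "g differentiable (at x)" for x
    by (auto simp: differentiable_on_def)
  have "pderiv2 i (\<lambda>x. f x + g x) = (\<lambda>x. pderiv2 i f x + pderiv2 i g x)" for i
  proof
    fix x
    have "((\<lambda>x. f x + g x) has_derivative
        (\<lambda>h. frechet_derivative f (at x) h + frechet_derivative g (at x) h)) (at x)"
      using d by (intro has_derivative_add) (auto simp: frechet_derivative_works)
    from pderiv2_eq[OF this]
    show "pderiv2 i (\<lambda>x. f x + g x) x = pderiv2 i f x + pderiv2 i g x" by (simp add: pderiv2_def)
  qed
  with Suc show ?case by (auto intro: derivative_intros)
qed

lemma pderiv2_mult:
  assumes "f differentiable (at x)" "g differentiable (at x)"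
  shows "pderiv2 i (\<lambda>x. f x * g x) x = f x * pderiv2 i g x + pderiv2 i f x * g x"
proof -
  have "((\<lambda>x. f x * g x) has_derivative
      (\<lambda>h. f x * frechet_derivative g (at x) h + frechet_derivative f (at x) h * g x)) (at x)"
    using assms by (intro has_derivative_mult) (auto simp: frechet_derivative_works)
  from pderiv2_eq[OF this] show ?thesis by (simp add: pderiv2_def)
qed

lemma Ck_plane_mult: "Ck_plane n f \<Longrightarrow> Ck_plane n g \<Longrightarrow> Ck_plane n (\<lambda>x. f x * g x)"
proof (induction n arbitrary: f g)
  case 0
  then show ?case by (auto intro: continuous_on_mult)
next
  case (Suc n)
  then have d: "f differentiable (at x)" "g differentiable (at x)" for x
    by (auto simp: differentiable_on_def)
  have p: "pderiv2 i (\<lambda>x. f x * g x) = (\<lambda>x. f x * pderiv2 i g x + pderiv2 i f x * g x)" for i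
    using pderiv2_mult[OF d] by auto
  have "Ck_plane n (\<lambda>x. f x * pderiv2 i g x + pderiv2 i f x * g x)" for i
    using Suc.prems Ck_plane_Suc_lower[OF Suc.prems(1)] Ck_plane_Suc_lower[OF Suc.prems(2)]
    by (intro Ck_plane_add Suc.IH) auto
  with p Suc.prems show ?case by (auto intro: derivative_intros)
qed

text \<open>
  The multipliers that make locally integrable functions integrable; test functions, their
  derivatives and indicators of squares are of this kind.
\<close>

definition bdd_supp :: "(real^2 \<Rightarrow> real) \<Rightarrow> bool" where
  "bdd_supp \<phi> \<longleftrightarrow> \<phi> \<in> borel_measurable borel \<and>
     (\<exists>B r. \<forall>x. \<bar>\<phi> x\<bar> \<le> B \<and> (x \<notin> sq 0 r \<longrightarrow> \<phi> x = 0))"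

lemma test_function_differentiable: "test_function \<phi> \<Longrightarrow> \<phi> differentiable (at x)"
  unfolding test_function_def by (metis Ck_plane.simps(2) UNIV_I differentiable_on_def)

lemma test_function_continuous: "test_function \<phi> \<Longrightarrow> continuous_on A \<phi>"
  unfolding test_function_def by (metis Ck_plane.simps(1) continuous_on_subset subset_UNIV)

lemma test_function_supp:
  assumes "test_function \<phi>"
  obtains r where "\<And>x. x \<notin> sq 0 r \<Longrightarrow> \<phi> x = 0"
proof -
  have "bounded (closure {x. \<phi> x \<noteq> 0})"
    using assms by (simp add: test_function_def compact_imp_bounded)
  then obtain r where "\<And>x. x \<in> closure {x. \<phi> x \<noteq> 0} \<Longrightarrow> norm x \<le> r"
    by (auto simp: bounded_iff)
  then have "\<phi> x = 0" if "x \<notin> sq 0 r" for x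
    using that mem_sq_norm[of x r] closure_subset[of "{x. \<phi> x \<noteq> 0}"] by blast
  with that show thesis by blast
qed

lemma bdd_suppI:
  assumes "continuous_on UNIV \<phi>" "\<And>x. x \<notin> sq 0 r \<Longrightarrow> \<phi> x = 0"
  shows "bdd_supp \<phi>"
proof -
  have "compact (\<phi> ` sq 0 r)"
    by (intro compact_continuous_image continuous_on_subset[OF assms(1)])
      (auto simp: sq_eq_cbox)
  then obtain B where B: "\<And>x. x \<in> sq 0 r \<Longrightarrow> \<bar>\<phi> x\<bar> \<le> B"
    by (metis compact_imp_bounded bounded_iff imageI real_norm_def)
  have "\<bar>\<phi> x\<bar> \<le> max B 0" for x
    using B[of x] assms(2)[of x] by (cases "x \<in> sq 0 r") auto
  with assms show ?thesis unfolding bdd_supp_def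
    by (metis borel_measurable_continuous_onI)
qed

lemma test_function_bdd_supp: "test_function \<phi> \<Longrightarrow> bdd_supp \<phi>"
  by (metis bdd_suppI test_function_continuous test_function_supp)

lemma test_function_pderiv2:
  assumes "test_function \<phi>" shows "test_function (pderiv2 i \<phi>)"
  unfolding test_function_def
proof
  show "\<forall>n. Ck_plane n (pderiv2 i \<phi>)" using assms unfolding test_function_def
    by (metis Ck_plane.simps(2))
  have "pderiv2 i \<phi> x = 0" if "x \<notin> closure {x. \<phi> x \<noteq> 0}" for x
  proof -
    have "((\<lambda>x. 0) has_derivative (\<lambda>h. 0)) (at x)" by simp
    then have "(\<phi> has_derivative (\<lambda>h. 0)) (at x)"
      by (rule has_derivative_transform_within_open[of _ _ _ UNIV "- closure {x. \<phi> x \<noteq> 0}"])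
        (use that closure_subset[of "{x. \<phi> x \<noteq> 0}"] in auto)
    from pderiv2_eq[OF this] show ?thesis by simp
  qed
  then have "{x. pderiv2 i \<phi> x \<noteq> 0} \<subseteq> closure {x. \<phi> x \<noteq> 0}" by blast
  then have "closure {x. pderiv2 i \<phi> x \<noteq> 0} \<subseteq> closure {x. \<phi> x \<noteq> 0}"
    by (simp add: closure_minimal)
  then show "compact (closure {x. pderiv2 i \<phi> x \<noteq> 0})"
    using assms unfolding test_function_def
    by (meson bounded_closure bounded_subset closed_closure compact_eq_bounded_closed)
qed

lemma test_functionI:
  assumes "\<And>n. Ck_plane n \<phi>" "\<And>x. x \<notin> sq z r \<Longrightarrow> \<phi> x = 0"
  shows "test_function \<phi>"
proof -
  have "bounded {x. \<phi> x \<noteq> 0}"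
    by (rule bounded_subset[of "sq z r"]) (use assms in \<open>auto simp: sq_eq_cbox bounded_cbox\<close>)
  with assms show ?thesis by (auto simp: test_function_def compact_closure)
qed

lemma test_function_mult:
  assumes "test_function f" "test_function g" shows "test_function (\<lambda>x. f x * g x)"
  by (rule test_function_supp[OF assms(1)], rule test_functionI[of _ 0])
    (use assms in \<open>auto simp: test_function_def intro!: Ck_plane_mult\<close>)

lemma test_function_tens:
  assumes "smooth_line \<alpha>" "smooth_line \<beta>"
    and "\<And>t. t \<notin> {a..b} \<Longrightarrow> \<alpha> t = 0" "\<And>t. t \<notin> {c..d} \<Longrightarrow> \<beta> t = 0"
  shows "test_function (tens \<alpha> \<beta>)"
proof (rule test_functionI)
  let ?r = "\<bar>a\<bar> + \<bar>b\<bar> + \<bar>c\<bar> + \<bar>d\<bar>"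
  show "tens \<alpha> \<beta> x = 0" if "x \<notin> sq 0 ?r" for x
  proof -
    have "x $ 1 \<notin> {a..b} \<or> x $ 2 \<notin> {c..d}" using that by (auto simp: mem_sq)
    with assms(3,4) show ?thesis by (auto simp: tens_def)
  qed
qed (use assms in \<open>simp add: Ck_plane_tens\<close>)

definition loc_int :: "(real^2 \<Rightarrow> real) \<Rightarrow> bool" where
  "loc_int f \<longleftrightarrow> f \<in> borel_measurable borel \<and>
     (\<forall>r. integrable lborel (\<lambda>x. indicator (sq 0 r) x * f x))"

lemma loc_int_mult_integrable:
  assumes "loc_int f" "bdd_supp \<phi>"
  shows "integrable lborel (\<lambda>x. f x * \<phi> x)"
proof -
  from assms(2) obtain B r where B: "\<And>x. \<bar>\<phi> x\<bar> \<le> B" "\<And>x. x \<notin> sq 0 r \<Longrightarrow> \<phi> x = 0"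
    and [measurable]: "\<phi> \<in> borel_measurable borel"
    by (auto simp: bdd_supp_def)
  have [measurable]: "f \<in> borel_measurable borel" using assms(1) by (simp add: loc_int_def)
  show ?thesis
  proof (rule Bochner_Integration.integrable_bound)
    show "integrable lborel (\<lambda>x. B * (indicator (sq 0 r) x * f x))"
      using assms(1) by (auto simp: loc_int_def)
    show "AE x in lborel. norm (f x * \<phi> x) \<le> norm (B * (indicator (sq 0 r) x * f x))"
    proof (rule AE_I2)
      fix x
      have "\<bar>\<phi> x\<bar> \<le> \<bar>B\<bar>" using B(1)[of x] by linarith
      then have "\<bar>f x\<bar> * \<bar>\<phi> x\<bar> \<le> \<bar>f x\<bar> * \<bar>B\<bar>" by (intro mult_left_mono) auto
      then show "norm (f x * \<phi> x) \<le> norm (B * (indicator (sq 0 r) x * f x))"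
        using B(2)[of x] by (cases "x \<in> sq 0 r") (auto simp: abs_mult mult.commute)
    qed
  qed measurable
qed

text \<open>
  The Borel sets over which \<open>f\<close> integrates to zero form a Dynkin system containing the boxes, hence all Borel
  sets, in particular the sets where \<open>f\<close> is positive or negative.
\<close>

lemma AE_zero_if_integral_box_zero:
  fixes f :: "real^2 \<Rightarrow> real"
  assumes f: "integrable lborel f" and z: "\<And>a b. (LINT x|lborel. f x * indicator (box a b) x) = 0"
  shows "AE x in lborel. f x = 0"
proof -
  have [measurable]: "f \<in> borel_measurable borel" using f by auto
  have int: "integrable lborel (\<lambda>x. f x * indicator A x)" if "A \<in> sets borel" for A
    using integrable_mult_indicator[of A lborel f] f that by (simp add: mult.commute)
  have tot: "(LINT x|lborel. f x) = 0"
  proof -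
    have "(\<lambda>n. LINT x|lborel. f x * indicator (box (\<chi> i. - real n) (\<chi> i. real n)) x)
        \<longlonglongrightarrow> (LINT x|lborel. f x)"
    proof (rule integral_dominated_convergence[where w="\<lambda>x. norm (f x)"])
      show "AE x in lborel. (\<lambda>n. f x * indicator (box (\<chi> i. - real n) (\<chi> i. real n)) x)
          \<longlonglongrightarrow> f x"
      proof (rule AE_I2, rule tendsto_eventually)
        fix x :: "real^2"
        obtain N where N: "norm x < real N" using reals_Archimedean2 by blast
        have "x \<in> box (\<chi> i. - real n) (\<chi> i. real n)" if "n \<ge> N" for n
        proof -
          have "\<bar>x $ i\<bar> < real n" for i
            using component_le_norm_cart[of x i] N that by linarith
          then show ?thesis by (auto simp: mem_box_cart abs_less_iff minus_less_iff)
        qed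
        then show "\<forall>\<^sub>F n in sequentially. f x * indicator (box (\<chi> i. - real n) (\<chi> i. real n)) x = f x"
          unfolding eventually_sequentially by (intro exI[of _ N]) auto
      qed
    qed (use f in \<open>auto simp: indicator_def\<close>)
    then show ?thesis by (simp add: z LIMSEQ_const_iff)
  qed
  have zero: "(LINT x|lborel. f x * indicator A x) = 0" if "A \<in> sets borel" for A
  proof -
    have "Int_stable (range (\<lambda>(a, b). box a b) :: (real^2) set set)"
      by (auto simp: Int_stable_def box_Int_box)
    moreover have "range (\<lambda>(a, b). box a b) \<subseteq> Pow (UNIV :: (real^2) set)" by simp
    moreover have "A \<in> sigma_sets UNIV (range (\<lambda>(a, b). box a b))"
      using that by (simp add: borel_eq_box)
    ultimately show ?thesis
    proof (induction rule: sigma_sets_induct_disjoint)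
      case (basic A)
      then show ?case using z by auto
    next
      case empty
      show ?case by simp
    next
      case (compl A)
      then have A: "A \<in> sets borel" by (simp add: borel_eq_box)
      have "(\<lambda>x. f x * indicator (UNIV - A) x) = (\<lambda>x. f x - f x * indicator A x)"
        by (auto simp: fun_eq_iff indicator_def)
      with compl f int[OF A] tot show ?case by simp
    next
      case (union A)
      have A: "A i \<in> sets borel" for i using union(2) by (auto simp: borel_eq_box)
      have "set_integrable lborel (\<Union>i. A i) f"
        using int[of "\<Union>i. A i"] A by (auto simp: set_integrable_def mult.commute)
      from lebesgue_integral_countable_add[OF _ _ this] A union(1,3)
      have "(LINT x:(\<Union>i. A i)|lborel. f x) = (\<Sum>i. LINT x:A i|lborel. f x)"
        by (auto simp: disjoint_family_on_def)
      with union(3) show ?case by (simp add: set_lebesgue_integral_def mult.commute)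
    qed
  qed
  have pos: "AE x in lborel. h x \<le> 0"
    if [measurable]: "h \<in> borel_measurable borel"
      and h: "integrable lborel (\<lambda>x. h x * indicator {x. h x > 0} x)"
        "(LINT x|lborel. h x * indicator {x. h x > 0} x) = 0" for h :: "real^2 \<Rightarrow> real"
  proof -
    have "AE x in lborel. h x * indicator {x. h x > 0} x = 0"
      using h by (subst (asm) integral_nonneg_eq_0_iff_AE) (auto simp: indicator_def)
    then show ?thesis by (rule AE_mp) (auto simp: indicator_def)
  qed
  have "AE x in lborel. f x \<le> 0"
    by (rule pos) (auto intro!: int zero)
  moreover have "AE x in lborel. - f x \<le> 0"
    using int[of "{x. - f x > 0}"] zero[of "{x. - f x > 0}"] by (intro pos) auto
  ultimately show ?thesis by eventually_elim auto
qed

text \<open>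
  Dilations of \<open>flat 0\<close> increase to the indicator of the half line, so products of four of them are test
  functions converging to the indicator of a box.
\<close>

lemma flat_scaled_tendsto: "(\<lambda>n. flat 0 (real n * t)) \<longlonglongrightarrow> indicator {0<..} t"
proof (cases "t > 0")
  case True
  have "(\<lambda>n. exp (- (1 / t) * (1 / real n))) \<longlonglongrightarrow> exp (- (1 / t) * 0)"
    by (intro tendsto_intros lim_1_over_n)
  then have "(\<lambda>n. exp (- (1 / t) * (1 / real n))) \<longlonglongrightarrow> 1" by simp
  moreover have "\<forall>\<^sub>F n in sequentially. exp (- (1 / t) * (1 / real n)) = flat 0 (real n * t)"
    using eventually_gt_at_top[of 0] by eventually_elim (use True in \<open>simp add: flat_def\<close>)
  ultimately show ?thesis using True by (auto intro: Lim_transform_eventually)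
next
  case False
  then have "flat 0 (real n * t) = 0" for n by (auto simp: flat_def zero_less_mult_iff)
  with False show ?thesis by simp
qed

lemma fundamental_lemma:
  assumes f: "loc_int f" and z: "\<And>\<phi>. test_function \<phi> \<Longrightarrow> (LINT x|lborel. f x * \<phi> x) = 0"
  shows "AE x in lborel. f x = 0"
proof -
  have [measurable]: "f \<in> borel_measurable borel" using f by (simp add: loc_int_def)
  have box: "(LINT x|lborel. f x * indicator (box a b) x) = 0" for a b
  proof -
    define h where "h i n t = flat 0 (real n * (t - a $ i)) * flat 0 (real n * (b $ i - t))" for i :: 2 and n t
    have sm: "smooth_line (h i n)" for i n
      using smooth_line_mult[OF smooth_line_affine[OF smooth_flat, of 0 "real n" "- real n * a $ i"]
          smooth_line_affine[OF smooth_flat, of 0 "- real n" "real n * b $ i"]]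
      by (simp add: h_def[abs_def] algebra_simps)
    have out: "h i n t = 0" if "t \<notin> {a $ i..b $ i}" for i n t
      using that by (auto simp: h_def flat_def zero_less_mult_iff)
    have lim: "(\<lambda>n. h i n t) \<longlonglongrightarrow> indicator {a $ i<..<b $ i} t" for i t
    proof -
      have "(\<lambda>n. h i n t) \<longlonglongrightarrow> indicator {0<..} (t - a $ i) * indicator {0<..} (b $ i - t)"
        unfolding h_def by (intro tendsto_mult flat_scaled_tendsto)
      also have "indicator {0<..} (t - a $ i) * indicator {0<..} (b $ i - t) =
          (indicator {a $ i<..<b $ i} t :: real)"
        by (simp add: indicator_def)
      finally show ?thesis .
    qed
    have h01: "0 \<le> h i n t" "h i n t \<le> 1" for i n t
      unfolding h_def by (auto intro!: mult_nonneg_nonneg mult_le_one flat_nonneg flat_le_1)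
    have t: "test_function (tens (h 1 n) (h 2 n))" for n
      by (rule test_function_tens[OF sm sm out out])
    define r where "r = norm a + norm b"
    have "(\<lambda>n. LINT x|lborel. f x * tens (h 1 n) (h 2 n) x) \<longlonglongrightarrow>
        (LINT x|lborel. f x * indicator (box a b) x)"
    proof (rule integral_dominated_convergence[where w="\<lambda>x. norm (indicator (sq 0 r) x * f x)"])
      show "AE x in lborel. (\<lambda>n. f x * tens (h 1 n) (h 2 n) x) \<longlonglongrightarrow> f x * indicator (box a b) x"
      proof (rule AE_I2)
        fix x
        have "indicator (box a b) x =
            indicator {a $ 1<..<b $ 1} (x $ 1) * (indicator {a $ 2<..<b $ 2} (x $ 2) :: real)"
          by (auto simp: indicator_def mem_box_cart forall_2)
        then show "(\<lambda>n. f x * tens (h 1 n) (h 2 n) x) \<longlonglongrightarrow> f x * indicator (box a b) x"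
          unfolding tens_def by (simp only:) (intro tendsto_intros lim)
      qed
      show "integrable lborel (\<lambda>x. norm (indicator (sq 0 r) x * f x))"
        using f by (auto simp: loc_int_def)
      show "AE x in lborel. norm (f x * tens (h 1 n) (h 2 n) x) \<le> norm (indicator (sq 0 r) x * f x)" for n
      proof (rule AE_I2)
        fix x
        have le: "\<bar>tens (h 1 n) (h 2 n) x\<bar> \<le> 1"
          using h01 by (simp add: tens_def abs_mult mult_le_one)
        show "norm (f x * tens (h 1 n) (h 2 n) x) \<le> norm (indicator (sq 0 r) x * f x)"
        proof (cases "x \<in> sq 0 r")
          case True
          then show ?thesis using mult_left_mono[OF le, of "\<bar>f x\<bar>"] by (simp add: abs_mult)
        next
          case False
          have "x $ 1 \<notin> {a $ 1..b $ 1} \<or> x $ 2 \<notin> {a $ 2..b $ 2}"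
            using False component_le_norm_cart[of a] component_le_norm_cart[of b]
            unfolding mem_sq r_def by (smt (verit) atLeastAtMost_iff zero_index norm_ge_zero)
          with out[of "x $ 1" 1 n] out[of "x $ 2" 2 n] show ?thesis by (auto simp: tens_def)
        qed
      qed
      show "(\<lambda>x. f x * tens (h 1 n) (h 2 n) x) \<in> borel_measurable lborel" for n
        using test_function_bdd_supp[OF t[of n]] by (auto simp: bdd_supp_def intro: borel_measurable_times)
    qed simp
    with z[OF t] show ?thesis by (simp add: LIMSEQ_const_iff)
  qed
  have "AE x in lborel. f x * indicator (box (\<chi> i. - real n) (\<chi> i. real n)) x = 0" for n
  proof (rule AE_zero_if_integral_box_zero)
      have "box (\<chi> i. - real n) (\<chi> i. real n) \<subseteq> sq 0 (real n)"
        by (auto simp: mem_box_cart sq_def abs_le_iff less_imp_le) (smt (verit, best))+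
      then have "(\<lambda>x. f x * indicator (box (\<chi> i. - real n) (\<chi> i. real n)) x) =
         (\<lambda>x. indicator (box (\<chi> i. - real n) (\<chi> i. real n)) x *\<^sub>R (indicator (sq 0 (real n)) x * f x))"
        by (auto simp: fun_eq_iff indicator_def)
      then show "integrable lborel (\<lambda>x. f x * indicator (box (\<chi> i. - real n) (\<chi> i. real n)) x)"
        using f by (auto simp: loc_int_def simp del: real_scaleR_def intro!: integrable_mult_indicator)
      have "(\<lambda>x. f x * indicator (box (\<chi> i. - real n) (\<chi> i. real n)) x * indicator (box a b) x) =
          (\<lambda>x. f x * indicator (box (\<chi> i. - real n) (\<chi> i. real n) \<inter> box a b) x)" for a b
        by (auto simp: fun_eq_iff indicator_def)
      then show "(LINT x|lborel. f x * indicator (box (\<chi> i. - real n) (\<chi> i. real n)) x * indicator (box a b) x) = 0" for a b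
        using box by (simp add: box_Int_box)
    qed
  then have "AE x in lborel. \<forall>n. f x * indicator (box (\<chi> i. - real n) (\<chi> i. real n)) x = 0"
    unfolding AE_all_countable by blast
  then show ?thesis
  proof eventually_elim
    case (elim x)
    obtain n where n: "norm x < real n" using reals_Archimedean2 by blast
    have "\<bar>x $ i\<bar> < real n" for i
      using component_le_norm_cart[of x i] n by linarith
    then have "x \<in> box (\<chi> i. - real n) (\<chi> i. real n)"
      by (auto simp: mem_box_cart abs_less_iff minus_less_iff)
    with elim[rule_format, of n] show ?case by simp
  qed
qed

section \<open>Weak gradients\<close>

lemma integral_translation:
  fixes f :: "real^2 \<Rightarrow> real"
  assumes [measurable]: "f \<in> borel_measurable borel"
  shows "(LINT x|lborel. f (x + a)) = (LINT x|lborel. f x)"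
proof -
  have "(LINT x|lborel. f x) = (LINT x|distr lborel borel ((+) a). f x)"
    by (simp add: lborel_distr_plus)
  also have "\<dots> = (LINT x|lborel. f (a + x))" by (rule integral_distr) auto
  finally show ?thesis by (simp add: add.commute)
qed

lemma loc_int_const: "loc_int (\<lambda>x. c)"
  using emeasure_sq_finite by (auto simp: loc_int_def intro!: integrable_mult_left integrable_real_indicator)

lemma bdd_supp_integrable: "bdd_supp \<phi> \<Longrightarrow> integrable lborel \<phi>"
  using loc_int_mult_integrable[OF loc_int_const[of 1]] by simp

lemma differentiable_line_derivative:
  fixes \<phi> :: "real^2 \<Rightarrow> real"
  assumes "\<And>y. \<phi> differentiable (at y)"
  shows "((\<lambda>t. \<phi> (x + t *\<^sub>R axis i 1)) has_real_derivative pderiv2 i \<phi> (x + t *\<^sub>R axis i 1)) (at t)"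
proof -
  let ?D = "frechet_derivative \<phi> (at (x + t *\<^sub>R axis i 1))"
  have D: "(\<phi> has_derivative ?D) (at (x + t *\<^sub>R axis i 1))"
    using assms by (simp add: frechet_derivative_works)
  have "((\<lambda>t. x + t *\<^sub>R axis i 1) has_derivative (\<lambda>h. h *\<^sub>R axis i 1)) (at t)"
    by (auto intro!: derivative_eq_intros)
  from has_derivative_compose[OF this D]
  have "((\<lambda>t. \<phi> (x + t *\<^sub>R axis i 1)) has_derivative (\<lambda>h. ?D (h *\<^sub>R axis i 1))) (at t)" .
  also have "(\<lambda>h. ?D (h *\<^sub>R axis i 1)) = (\<lambda>h. pderiv2 i \<phi> (x + t *\<^sub>R axis i 1) * h)"
    using linear_scale[OF has_derivative_linear[OF D]] by (simp add: pderiv2_def mult.commute)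
  finally show ?thesis by (simp add: has_field_derivative_def)
qed

text \<open>
  Difference quotients have integral zero by translation invariance, and they converge to the partial
  derivative boundedly and with bounded support.
\<close>

lemma integral_pderiv2_test_function:
  assumes "test_function \<phi>" shows "(LINT x|lborel. pderiv2 i \<phi> x) = 0"
proof -
  let ?e = "axis i 1 :: real^2"
  note diff = test_function_differentiable[OF assms]
  have bs: "bdd_supp \<phi>" "bdd_supp (pderiv2 i \<phi>)"
    by (simp_all add: test_function_bdd_supp test_function_pderiv2 assms)
  have [measurable]: "\<phi> \<in> borel_measurable borel" "pderiv2 i \<phi> \<in> borel_measurable borel"
    using bs by (simp_all add: bdd_supp_def)
  obtain B where B: "\<And>x. \<bar>pderiv2 i \<phi> x\<bar> \<le> B" using bs(2) by (auto simp: bdd_supp_def)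
  obtain r where r: "\<And>x. x \<notin> sq 0 r \<Longrightarrow> \<phi> x = 0" using test_function_supp[OF assms] by blast
  define h where "h n = 1 / real (Suc n)" for n
  have h: "0 < h n" "h n \<le> 1" for n by (auto simp: h_def)
  have h0: "h \<longlonglongrightarrow> 0" unfolding h_def by (rule LIMSEQ_Suc) (rule lim_1_over_n)
  define F where "F n x = (\<phi> (x + h n *\<^sub>R ?e) - \<phi> x) / h n" for n x
  have F0: "(LINT x|lborel. F n x) = 0" for n
  proof -
    have i: "integrable lborel \<phi>" by (rule bdd_supp_integrable[OF bs(1)])
    have "integrable (distr lborel borel ((+) (h n *\<^sub>R ?e))) \<phi>" using i by (simp add: lborel_distr_plus)
    then have "integrable lborel (\<lambda>x. \<phi> (x + h n *\<^sub>R ?e))"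
      by (subst (asm) integrable_distr_eq) (auto simp: add.commute)
    with i integral_translation[of \<phi> "h n *\<^sub>R ?e"] show ?thesis by (simp add: F_def)
  qed
  have "(\<lambda>n. LINT x|lborel. F n x) \<longlonglongrightarrow> (LINT x|lborel. pderiv2 i \<phi> x)"
  proof (rule integral_dominated_convergence[where w = "\<lambda>x. B * indicator (sq 0 (r + 1)) x"])
    show "integrable lborel (\<lambda>x. B * indicator (sq 0 (r + 1)) x)"
      using emeasure_sq_finite by (auto intro!: integrable_mult_right integrable_real_indicator)
    show "AE x in lborel. (\<lambda>n. F n x) \<longlonglongrightarrow> pderiv2 i \<phi> x"
    proof (rule AE_I2)
      fix x
      have "((\<lambda>t. (\<phi> (x + t *\<^sub>R ?e) - \<phi> x) / t) \<longlongrightarrow> pderiv2 i \<phi> x) (at 0)"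
        using differentiable_line_derivative[OF diff, of x i 0] by (simp add: DERIV_def)
      moreover have "filterlim h (at 0) sequentially"
        using h0 h by (auto simp: filterlim_at intro!: always_eventually) (metis less_irrefl)
      ultimately show "(\<lambda>n. F n x) \<longlonglongrightarrow> pderiv2 i \<phi> x"
        unfolding F_def by (rule filterlim_compose)
    qed
    show "AE x in lborel. norm (F n x) \<le> B * indicator (sq 0 (r + 1)) x" for n
    proof (rule AE_I2)
      fix x
      show "norm (F n x) \<le> B * indicator (sq 0 (r + 1)) x"
      proof (cases "x \<in> sq 0 (r + 1)")
        case True
        obtain t where "\<phi> (x + h n *\<^sub>R ?e) - \<phi> (x + 0 *\<^sub>R ?e) =
            (h n - 0) * pderiv2 i \<phi> (x + t *\<^sub>R ?e)"
          using MVT2[of 0 "h n" "\<lambda>t. \<phi> (x + t *\<^sub>R ?e)", OF h(1) differentiable_line_derivative[OF diff]]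
          by auto
        then have "F n x = pderiv2 i \<phi> (x + t *\<^sub>R ?e)" using h(1)[of n] by (simp add: F_def)
        with B True show ?thesis by simp
      next
        case False
        have "\<bar>(h n *\<^sub>R ?e) $ j\<bar> \<le> 1" for j using h[of n] by (simp add: axis_def)
        from this[of 1] this[of 2] False have "x + h n *\<^sub>R ?e \<notin> sq 0 r" "x \<notin> sq 0 r"
          unfolding mem_sq vector_add_component zero_index diff_zero by linarith+
        with r False show ?thesis by (simp add: F_def)
      qed
    qed
  qed (auto simp: F_def)
  with F0 show ?thesis by (simp add: LIMSEQ_const_iff)
qed

lemma weight_pos: "weight x > 0"
  unfolding weight_def using ln_gt_zero[of "2 + norm x"]
  by (intro divide_pos_pos mult_pos_pos) (auto simp: add_pos_nonneg)

lemma weight_measurable [measurable]: "weight \<in> borel_measurable borel"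
  unfolding weight_def[abs_def] by measurable

lemma weight_le: "weight x \<le> 1 / ln 2"
proof -
  have l: "ln 2 \<le> ln (2 + norm x)" by (subst ln_le_cancel_iff) (auto simp: add_pos_nonneg)
  then have "1 * ln 2 \<le> sqrt (1 + (norm x)\<^sup>2) * ln (2 + norm x)" by (intro mult_mono) auto
  moreover have "0 < sqrt (1 + (norm x)\<^sup>2) * ln (2 + norm x)"
    by (intro mult_pos_pos ln_gt_zero) (auto simp: add_pos_nonneg)
  ultimately show ?thesis unfolding weight_def by (intro divide_left_mono) auto
qed

lemma weight_lower: "\<exists>w>0. \<forall>x\<in>sq 0 r. w \<le> weight x"
proof (intro exI conjI ballI)
  let ?s = "2 * \<bar>r\<bar>"
  show "0 < 1 / (sqrt (1 + ?s\<^sup>2) * ln (2 + ?s))"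
    by (intro divide_pos_pos mult_pos_pos ln_gt_zero) (auto simp: add_pos_nonneg)
  fix x assume "x \<in> sq 0 r"
  then have n: "norm x \<le> ?s" using norm_le_two_sq[of x r] by linarith
  have "sqrt (1 + (norm x)\<^sup>2) * ln (2 + norm x) \<le> sqrt (1 + ?s\<^sup>2) * ln (2 + ?s)"
    using n by (intro mult_mono real_sqrt_le_mono add_left_mono power_mono ln_mono)
      (auto intro!: ln_ge_zero simp: add_pos_nonneg)
  moreover have "0 < sqrt (1 + (norm x)\<^sup>2) * ln (2 + norm x)"
    by (intro mult_pos_pos ln_gt_zero) (auto simp: add_pos_nonneg)
  ultimately show "1 / (sqrt (1 + ?s\<^sup>2) * ln (2 + ?s)) \<le> weight x"
    unfolding weight_def by (intro divide_left_mono) auto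
qed

lemma Hw_measurable: "u \<in> Hw \<Longrightarrow> u \<in> borel_measurable borel"
  by (simp add: Hw_def)

lemma Hw_local_square_integrable:
  assumes "u \<in> Hw" shows "integrable lborel (\<lambda>x. indicator (sq 0 r) x * (u x)\<^sup>2)"
proof -
  note [measurable] = Hw_measurable[OF assms]
  obtain w where w: "w > 0" "\<And>x. x \<in> sq 0 r \<Longrightarrow> w \<le> weight x" using weight_lower[of r] by blast
  show ?thesis
  proof (rule Bochner_Integration.integrable_bound)
    show "integrable lborel (\<lambda>x. (weight x * u x)\<^sup>2 / w\<^sup>2)" using assms by (simp add: Hw_def)
    show "AE x in lborel. norm (indicator (sq 0 r) x * (u x)\<^sup>2) \<le> norm ((weight x * u x)\<^sup>2 / w\<^sup>2)"
    proof (rule AE_I2)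
      fix x
      show "norm (indicator (sq 0 r) x * (u x)\<^sup>2) \<le> norm ((weight x * u x)\<^sup>2 / w\<^sup>2)"
      proof (cases "x \<in> sq 0 r")
        case True
        have "w\<^sup>2 * (u x)\<^sup>2 \<le> (weight x)\<^sup>2 * (u x)\<^sup>2"
          using w(1) w(2)[OF True] by (intro mult_right_mono power_mono) auto
        with True w(1) show ?thesis by (simp add: power_mult_distrib field_simps)
      qed simp
    qed
  qed measurable
qed

lemma local_square_integrable_imp_loc_int:
  assumes [measurable]: "f \<in> borel_measurable borel"
    and "\<And>r. integrable lborel (\<lambda>x. indicator (sq 0 r) x * (f x)\<^sup>2)"
  shows "loc_int f"
  unfolding loc_int_def
proof (intro conjI allI)
  fix r
  show "integrable lborel (\<lambda>x. indicator (sq 0 r) x * f x)"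
  proof (rule Bochner_Integration.integrable_bound)
    show "integrable lborel (\<lambda>x. indicator (sq 0 r) x + indicator (sq 0 r) x * (f x)\<^sup>2)"
      using assms(2) emeasure_sq_finite by (auto intro!: Bochner_Integration.integrable_add integrable_real_indicator)
    show "AE x in lborel. norm (indicator (sq 0 r) x * f x) \<le>
        norm (indicator (sq 0 r) x + indicator (sq 0 r) x * (f x)\<^sup>2)"
    proof (rule AE_I2)
      fix x
      have "\<bar>f x\<bar> \<le> 1 + (f x)\<^sup>2"
        using sum_power2_ge_zero[of "\<bar>f x\<bar> - 1" 0] by (simp add: power2_eq_square algebra_simps)
      then show "norm (indicator (sq 0 r) x * f x) \<le>
          norm (indicator (sq 0 r) x + indicator (sq 0 r) x * (f x)\<^sup>2)"
        by (simp add: indicator_def)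
    qed
  qed measurable
qed fact

lemma Hw_loc_int: "u \<in> Hw \<Longrightarrow> loc_int u"
  by (intro local_square_integrable_imp_loc_int Hw_measurable Hw_local_square_integrable)

lemma weak_gradient_measurable:
  assumes "L2_weak_gradient u g" shows "g \<in> borel_measurable borel" "(\<lambda>x. g x $ i) \<in> borel_measurable borel"
proof -
  show [measurable]: "g \<in> borel_measurable borel" using assms by (simp add: L2_weak_gradient_def)
  have "(\<lambda>x. g x $ i) = (\<lambda>x. g x \<bullet> axis i 1)" by (simp add: inner_axis fun_eq_iff)
  then show "(\<lambda>x. g x $ i) \<in> borel_measurable borel" by simp
qed

lemma weak_gradient_loc_int:
  assumes "L2_weak_gradient u g" shows "loc_int (\<lambda>x. g x $ i)"
proof (rule local_square_integrable_imp_loc_int)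
  note [measurable] = weak_gradient_measurable[OF assms]
  show "(\<lambda>x. g x $ i) \<in> borel_measurable borel" by simp
  fix r
  show "integrable lborel (\<lambda>x. indicator (sq 0 r) x * (g x $ i)\<^sup>2)"
  proof (rule Bochner_Integration.integrable_bound)
    show "integrable lborel (\<lambda>x. (norm (g x))\<^sup>2)" using assms by (simp add: L2_weak_gradient_def)
    show "AE x in lborel. norm (indicator (sq 0 r) x * (g x $ i)\<^sup>2) \<le> norm ((norm (g x))\<^sup>2)"
      by (auto simp: indicator_def abs_le_square_iff[symmetric] component_le_norm_cart)
  qed measurable
qed

lemma loc_int_diff: "loc_int f \<Longrightarrow> loc_int g \<Longrightarrow> loc_int (\<lambda>x. f x - g x)"
  by (auto simp: loc_int_def right_diff_distrib)

text \<open>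
  Constants have weak gradient zero, so the gradient depends on the class only; this justifies
  \<open>grad_class\<close> (see \<open>grad_class_eq\<close>).
\<close>

lemma weak_gradient_unique_mod_const:
  assumes "loc_int u" "loc_int v" "AE x in lborel. u x = v x + c"
    and g: "L2_weak_gradient u g" and h: "L2_weak_gradient v h"
  shows "AE x in lborel. g x = h x"
proof -
  have "AE x in lborel. g x $ i - h x $ i = 0" for i
  proof (rule fundamental_lemma[OF loc_int_diff[OF weak_gradient_loc_int[OF g] weak_gradient_loc_int[OF h]]])
    fix \<phi> assume t: "test_function \<phi>"
    note s = test_function_bdd_supp[OF t] test_function_bdd_supp[OF test_function_pderiv2[OF t]]
    have [measurable]: "u \<in> borel_measurable borel" "v \<in> borel_measurable borel"
       "pderiv2 i \<phi> \<in> borel_measurable borel"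
      using assms(1,2) s by (simp_all add: loc_int_def bdd_supp_def)
    have "(LINT x|lborel. u x * pderiv2 i \<phi> x) = (LINT x|lborel. v x * pderiv2 i \<phi> x + c * pderiv2 i \<phi> x)"
      using assms(3) by (intro integral_cong_AE) (auto simp: distrib_right)
    also have "\<dots> = (LINT x|lborel. v x * pderiv2 i \<phi> x)"
      using loc_int_mult_integrable[OF assms(2) s(2)] bdd_supp_integrable[OF s(2)]
      by (simp add: integral_pderiv2_test_function[OF t])
    finally have "(LINT x|lborel. g x $ i * \<phi> x) = (LINT x|lborel. h x $ i * \<phi> x)"
      using g h t by (simp add: L2_weak_gradient_def)
    then show "(LINT x|lborel. (g x $ i - h x $ i) * \<phi> x) = 0"
      using loc_int_mult_integrable[OF weak_gradient_loc_int[OF g] s(1)]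
        loc_int_mult_integrable[OF weak_gradient_loc_int[OF h] s(1)]
      by (simp add: left_diff_distrib)
  qed
  from this[of 1] this[of 2] show ?thesis
    by eventually_elim (simp add: vec_eq_iff forall_2)
qed

lemma grad_class_eq:
  assumes "\<eta> \<in> H_space" "v \<in> \<eta>" "L2_weak_gradient v h"
  shows "AE x in lborel. grad_class \<eta> x = h x"
    and "\<exists>u\<in>\<eta>. L2_weak_gradient u (grad_class \<eta>)"
proof -
  show ex: "\<exists>u\<in>\<eta>. L2_weak_gradient u (grad_class \<eta>)"
  proof -
    have "\<exists>g. \<exists>u\<in>\<eta>. L2_weak_gradient u g" using assms(2,3) by blast
    from someI_ex[OF this] show ?thesis unfolding grad_class_def .
  qed
  then obtain u where u: "u \<in> \<eta>" "L2_weak_gradient u (grad_class \<eta>)" by blast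
  obtain w where w: "\<eta> = mod_constants `` {w}" using assms(1) unfolding H_space_def by (rule quotientE)
  have "(w, u) \<in> mod_constants" "(w, v) \<in> mod_constants" using u(1) assms(2) w by auto
  then obtain c d where cd: "AE x in lborel. w x = u x + c" "AE x in lborel. w x = v x + d"
    and Hw: "u \<in> Hw" "v \<in> Hw"
    unfolding mod_constants_def by blast
  from cd have "AE x in lborel. u x = v x + (d - c)" by eventually_elim simp
  from weak_gradient_unique_mod_const[OF Hw_loc_int[OF Hw(1)] Hw_loc_int[OF Hw(2)] this u(2) assms(3)]
  show "AE x in lborel. grad_class \<eta> x = h x" .
qed

lemma class_in_H_space:
  assumes "v \<in> Hw" shows "mod_constants `` {v} \<in> H_space" "v \<in> mod_constants `` {v}"
proof -
  show "mod_constants `` {v} \<in> H_space" unfolding H_space_def by (rule quotientI[OF assms])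
  have "AE x in lborel. v x = v x + 0" by simp
  with assms show "v \<in> mod_constants `` {v}" unfolding mod_constants_def by blast
qed

lemma bdd_supp_mult: "bdd_supp f \<Longrightarrow> bdd_supp g \<Longrightarrow> bdd_supp (\<lambda>x. f x * g x)"
  unfolding bdd_supp_def
proof (elim conjE exE, intro conjI exI allI)
  fix B B' r r' x
  assume "\<forall>x. \<bar>f x\<bar> \<le> B \<and> (x \<notin> sq 0 r \<longrightarrow> f x = 0)" "\<forall>x. \<bar>g x\<bar> \<le> B' \<and> (x \<notin> sq 0 r' \<longrightarrow> g x = 0)"
  then have h: "\<bar>f x\<bar> \<le> B" "x \<notin> sq 0 r \<longrightarrow> f x = 0" "\<bar>g x\<bar> \<le> B'" by auto
  then show "\<bar>f x * g x\<bar> \<le> B * B'" by (simp add: abs_mult) (meson abs_ge_zero mult_mono order_trans)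
  show "x \<notin> sq 0 r \<longrightarrow> f x * g x = 0" using h by simp
qed auto

text \<open>
  These are the functions with which the equation is tested. Up to the additive constant \<open>a * c\<close>,
  \<open>v\<close> is \<open>(a + \<psi>) * (u - c)\<close>. Writing it as \<open>a * u + \<psi> * (u - c)\<close> allows a cutoff equal to 1 near
  infinity (\<open>a = 1\<close>) without adding a constant to an element of \<open>Hw\<close>.
\<close>

lemma cutoff_weak_gradient:
  fixes a c :: real
  assumes u: "u \<in> Hw" and g: "L2_weak_gradient u g" and \<psi>: "test_function \<psi>"
  defines "v \<equiv> \<lambda>x. a * u x + \<psi> x * (u x - c)"
    and "h \<equiv> \<lambda>x. (a + \<psi> x) *\<^sub>R g x + (u x - c) *\<^sub>R (\<chi> i. pderiv2 i \<psi> x)"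
  shows "v \<in> Hw" "L2_weak_gradient v h"
proof -
  note s = test_function_bdd_supp[OF \<psi>] test_function_bdd_supp[OF test_function_pderiv2[OF \<psi>]]
  note [measurable] = Hw_measurable[OF u] weak_gradient_measurable[OF g]
  have [measurable]: "\<psi> \<in> borel_measurable borel" "pderiv2 i \<psi> \<in> borel_measurable borel" for i
    using s by (simp_all add: bdd_supp_def)
  have gr [measurable]: "(\<lambda>x. \<chi> i. pderiv2 i \<psi> x) \<in> borel_measurable borel"
    by (subst borel_measurable_euclidean_space) (auto simp: Basis_vec_def inner_axis)
  have uc2: "loc_int (\<lambda>x. (u x - c)\<^sup>2)"
  proof -
    have "integrable lborel (\<lambda>x. indicator (sq 0 r) x * (u x)\<^sup>2 + (c\<^sup>2 * indicator (sq 0 r) x) - 2 * c * (indicator (sq 0 r) x * u x))" for r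
      using Hw_loc_int[OF u] Hw_local_square_integrable[OF u, of r] loc_int_const[of 1]
      by (intro Bochner_Integration.integrable_diff Bochner_Integration.integrable_add integrable_mult_right)
        (auto simp: loc_int_def)
    then show ?thesis by (simp add: loc_int_def power2_eq_square algebra_simps)
  qed
  obtain B where B: "\<And>x. \<bar>\<psi> x\<bar> \<le> B" using s(1) by (auto simp: bdd_supp_def)
  have h2: "integrable lborel (\<lambda>x. (norm (h x))\<^sup>2)"
  proof (rule Bochner_Integration.integrable_bound)
    let ?F = "\<lambda>x. 2 * ((\<bar>a\<bar> + B)\<^sup>2 * (norm (g x))\<^sup>2) +
       2 * ((u x - c)\<^sup>2 * (pderiv2 1 \<psi> x * pderiv2 1 \<psi> x) + (u x - c)\<^sup>2 * (pderiv2 2 \<psi> x * pderiv2 2 \<psi> x))"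
    show "integrable lborel ?F"
      using g loc_int_mult_integrable[OF uc2 bdd_supp_mult[OF s(2) s(2)]]
      by (intro Bochner_Integration.integrable_add integrable_mult_right) (auto simp: L2_weak_gradient_def)
    show "AE x in lborel. norm ((norm (h x))\<^sup>2) \<le> norm (?F x)"
    proof (rule AE_I2)
      fix x
      let ?p = "(a + \<psi> x) *\<^sub>R g x" and ?q = "(u x - c) *\<^sub>R (\<chi> i. pderiv2 i \<psi> x)"
      have 1: "(norm ?p)\<^sup>2 \<le> (\<bar>a\<bar> + B)\<^sup>2 * (norm (g x))\<^sup>2"
      proof -
        have "\<bar>a + \<psi> x\<bar> \<le> \<bar>a\<bar> + B" using B[of x] by linarith
        then have "\<bar>a + \<psi> x\<bar>\<^sup>2 \<le> (\<bar>a\<bar> + B)\<^sup>2" by (intro power_mono) auto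
        then show ?thesis by (simp add: power_mult_distrib mult_right_mono)
      qed
      have 2: "(norm ?q)\<^sup>2 = (u x - c)\<^sup>2 * (pderiv2 1 \<psi> x * pderiv2 1 \<psi> x) + (u x - c)\<^sup>2 * (pderiv2 2 \<psi> x * pderiv2 2 \<psi> x)"
        by (simp only: power2_norm_eq_inner) (simp add: inner_vec_def sum_2 power2_eq_square algebra_simps)
      have "(norm (?p + ?q))\<^sup>2 \<le> (norm ?p + norm ?q)\<^sup>2" by (intro power_mono norm_triangle_ineq) auto
      also have "\<dots> \<le> 2 * (norm ?p)\<^sup>2 + 2 * (norm ?q)\<^sup>2"
        using sum_squares_ge_zero[of "norm ?p - norm ?q" 0] by (simp add: power2_eq_square algebra_simps)
      also have "\<dots> \<le> ?F x" unfolding 2 by (intro add_mono mult_left_mono 1 order_refl) auto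
      finally show "norm ((norm (h x))\<^sup>2) \<le> norm (?F x)" unfolding h_def by simp
    qed
  qed (auto simp: h_def)
  have wg: "(LINT x|lborel. v x * pderiv2 i \<phi> x) = - (LINT x|lborel. h x $ i * \<phi> x)" if t: "test_function \<phi>" for \<phi> i
  proof -
    note p = test_function_bdd_supp[OF t] test_function_bdd_supp[OF test_function_pderiv2[OF t]]
    have t2: "test_function (\<lambda>x. \<psi> x * \<phi> x)" by (rule test_function_mult[OF \<psi> t])
    have pm: "pderiv2 i (\<lambda>x. \<psi> x * \<phi> x) x = \<psi> x * pderiv2 i \<phi> x + pderiv2 i \<psi> x * \<phi> x" for x
      by (rule pderiv2_mult[OF test_function_differentiable[OF \<psi>] test_function_differentiable[OF t]])
    note iu = loc_int_mult_integrable[OF Hw_loc_int[OF u]] 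
    note ig = loc_int_mult_integrable[OF weak_gradient_loc_int[OF g, of i]]
    have E1: "(LINT x|lborel. u x * pderiv2 i \<phi> x) = - (LINT x|lborel. g x $ i * \<phi> x)"
      and E2: "(LINT x|lborel. u x * (\<psi> x * pderiv2 i \<phi> x + pderiv2 i \<psi> x * \<phi> x)) = - (LINT x|lborel. g x $ i * (\<psi> x * \<phi> x))"
    proof -
      have wk: "(LINT x|lborel. u x * pderiv2 i f x) = - (LINT x|lborel. g x $ i * f x)" if "test_function f" for f
        using g that unfolding L2_weak_gradient_def by blast
      show "(LINT x|lborel. u x * pderiv2 i \<phi> x) = - (LINT x|lborel. g x $ i * \<phi> x)" by (rule wk[OF t])
      show "(LINT x|lborel. u x * (\<psi> x * pderiv2 i \<phi> x + pderiv2 i \<psi> x * \<phi> x)) = - (LINT x|lborel. g x $ i * (\<psi> x * \<phi> x))"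
        using wk[OF t2] by (simp only: pm)
    qed
    have E3: "(LINT x|lborel. \<psi> x * pderiv2 i \<phi> x + pderiv2 i \<psi> x * \<phi> x) = 0"
      using integral_pderiv2_test_function[OF t2, of i] pm by simp
    have i1: "integrable lborel (\<lambda>x. u x * (\<psi> x * pderiv2 i \<phi> x))" "integrable lborel (\<lambda>x. u x * (pderiv2 i \<psi> x * \<phi> x))"
      "integrable lborel (\<lambda>x. \<psi> x * pderiv2 i \<phi> x)" "integrable lborel (\<lambda>x. pderiv2 i \<psi> x * \<phi> x)"
      "integrable lborel (\<lambda>x. u x * pderiv2 i \<phi> x)" "integrable lborel (\<lambda>x. g x $ i * \<phi> x)"
      "integrable lborel (\<lambda>x. g x $ i * (\<psi> x * \<phi> x))"
      by (intro iu ig bdd_supp_integrable bdd_supp_mult s p)+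
    have "(LINT x|lborel. v x * pderiv2 i \<phi> x) =
      (LINT x|lborel. a * (u x * pderiv2 i \<phi> x) + u x * (\<psi> x * pderiv2 i \<phi> x) - c * (\<psi> x * pderiv2 i \<phi> x))"
      by (intro Bochner_Integration.integral_cong) (auto simp: v_def algebra_simps)
    also have "\<dots> = a * (LINT x|lborel. u x * pderiv2 i \<phi> x) + (LINT x|lborel. u x * (\<psi> x * pderiv2 i \<phi> x)) - c * (LINT x|lborel. \<psi> x * pderiv2 i \<phi> x)"
      using i1 by simp
    also have "\<dots> = - (a * (LINT x|lborel. g x $ i * \<phi> x) + (LINT x|lborel. g x $ i * (\<psi> x * \<phi> x))
        + (LINT x|lborel. u x * (pderiv2 i \<psi> x * \<phi> x)) - c * (LINT x|lborel. pderiv2 i \<psi> x * \<phi> x))"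
    proof -
      have "(LINT x|lborel. u x * (\<psi> x * pderiv2 i \<phi> x)) + (LINT x|lborel. u x * (pderiv2 i \<psi> x * \<phi> x))
          = - (LINT x|lborel. g x $ i * (\<psi> x * \<phi> x))"
        using E2 i1 by (simp add: distrib_left)
      moreover have "(LINT x|lborel. \<psi> x * pderiv2 i \<phi> x) = - (LINT x|lborel. pderiv2 i \<psi> x * \<phi> x)"
        using E3 i1 by simp
      ultimately show ?thesis using E1 by (simp only:)
    qed
    also have "\<dots> = - (LINT x|lborel. a * (g x $ i * \<phi> x) + g x $ i * (\<psi> x * \<phi> x)
        + u x * (pderiv2 i \<psi> x * \<phi> x) - c * (pderiv2 i \<psi> x * \<phi> x))"
      using i1 by simp
    also have "\<dots> = - (LINT x|lborel. h x $ i * \<phi> x)"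
      by (intro arg_cong[where f=uminus] Bochner_Integration.integral_cong) (auto simp: h_def algebra_simps)
    finally show ?thesis .
  qed
  show L: "L2_weak_gradient v h" unfolding L2_weak_gradient_def using h2 wg
    by (auto simp: h_def)
  have "integrable lborel (\<lambda>x. (weight x * v x)\<^sup>2)"
  proof (rule Bochner_Integration.integrable_bound)
    let ?F = "\<lambda>x. 2 * (a\<^sup>2 * (weight x * u x)\<^sup>2) + 2 * ((1 / ln 2)\<^sup>2 * ((u x - c)\<^sup>2 * (\<psi> x * \<psi> x)))"
    show "integrable lborel ?F" using u loc_int_mult_integrable[OF uc2 bdd_supp_mult[OF s(1) s(1)]]
      by (intro Bochner_Integration.integrable_add integrable_mult_right) (auto simp: Hw_def)
    show "AE x in lborel. norm ((weight x * v x)\<^sup>2) \<le> norm (?F x)"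
    proof (rule AE_I2)
      fix x
      let ?p = "a * (weight x * u x)" and ?q = "weight x * ((u x - c) * \<psi> x)"
      have "(weight x * v x)\<^sup>2 = (?p + ?q)\<^sup>2" by (simp add: v_def algebra_simps)
      also have "\<dots> \<le> 2 * ?p\<^sup>2 + 2 * ?q\<^sup>2"
        using sum_squares_ge_zero[of "?p - ?q" 0] by (simp add: power2_eq_square algebra_simps)
      also have "?q\<^sup>2 \<le> (1 / ln 2)\<^sup>2 * ((u x - c) * \<psi> x)\<^sup>2"
        using weight_le[of x] weight_pos[of x] by (subst power_mult_distrib) (intro mult_right_mono power_mono, auto)
      finally have "(weight x * v x)\<^sup>2 \<le> ?F x" by (simp add: power2_eq_square mult_ac)
      then show "norm ((weight x * v x)\<^sup>2) \<le> norm (?F x)"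
        unfolding real_norm_def abs_power2 by (rule order_trans[OF _ abs_ge_self])
    qed
  qed (auto simp: v_def)
  with L show "v \<in> Hw" by (auto simp: Hw_def v_def)
qed

section \<open>Energy and mollification\<close>

definition energy :: "(real^2 \<Rightarrow> real^2) \<Rightarrow> (real^2) set \<Rightarrow> real" where
  "energy g S = (LINT x|lborel. indicator S x * (norm (g x))\<^sup>2)"

locale sobolev =
  fixes u :: "real^2 \<Rightarrow> real" and g :: "real^2 \<Rightarrow> real^2"
  assumes u_Hw: "u \<in> Hw" and weak: "L2_weak_gradient u g"
begin

lemma u_measurable [measurable]: "u \<in> borel_measurable borel"
  and g_measurable [measurable]: "g \<in> borel_measurable borel" "(\<lambda>x. g x $ i) \<in> borel_measurable borel"
  and g_square_integrable: "integrable lborel (\<lambda>x. (norm (g x))\<^sup>2)"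
  using Hw_measurable[OF u_Hw] weak_gradient_measurable[OF weak] weak by (auto simp: L2_weak_gradient_def)

lemma energy_integrable:
  "S \<in> sets borel \<Longrightarrow> integrable lborel (\<lambda>x. indicator S x * (norm (g x))\<^sup>2)"
  using integrable_mult_indicator[of S lborel "\<lambda>x. (norm (g x))\<^sup>2"] g_square_integrable by simp

lemma energy_nonneg: "0 \<le> energy g S"
  unfolding energy_def by (intro Bochner_Integration.integral_nonneg) (auto simp: indicator_def)

lemma energy_mono:
  "A \<in> sets borel \<Longrightarrow> B \<in> sets borel \<Longrightarrow> A \<subseteq> B \<Longrightarrow> energy g A \<le> energy g B"
  unfolding energy_def by (intro integral_mono energy_integrable) (auto simp: indicator_def)

lemma energy_add_le:
  assumes "A \<in> sets borel" "B \<in> sets borel" "C \<in> sets borel" "A \<subseteq> C" "B \<subseteq> C" "A \<inter> B = {}"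
  shows "energy g A + energy g B \<le> energy g C"
proof -
  have "energy g A + energy g B =
      (LINT x|lborel. indicator A x * (norm (g x))\<^sup>2 + indicator B x * (norm (g x))\<^sup>2)"
    using energy_integrable assms(1,2) by (simp add: energy_def)
  also have "\<dots> \<le> energy g C"
    unfolding energy_def using assms(4,5,6)
    by (intro integral_mono Bochner_Integration.integrable_add energy_integrable assms)
      (auto simp: indicator_def)
  finally show ?thesis .
qed

lemma energy_nn: "S \<in> sets borel \<Longrightarrow>
    (\<integral>\<^sup>+x. indicator S x * ennreal ((norm (g x))\<^sup>2) \<partial>lborel) = ennreal (energy g S)"
  unfolding energy_def
  by (subst nn_integral_eq_integral[symmetric], erule energy_integrable)
    (auto intro!: nn_integral_cong simp: indicator_def)

lemma gradient_L1_bound: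
  assumes [measurable]: "S \<in> sets borel" and S: "S \<subseteq> sq z L" and L: "0 < L"
  shows "integrable lborel (\<lambda>x. indicator S x * norm (g x))"
    and "(LINT x|lborel. indicator S x * norm (g x))\<^sup>2 \<le> (2 * L)\<^sup>2 * energy g S"
proof -
  have fin: "emeasure lborel S < \<infinity>"
    using emeasure_mono[OF S, of lborel] emeasure_sq_finite[of z L] by (simp add: order.strict_trans1)
  then have i1: "integrable lborel (\<lambda>x. indicator S x :: real)" by (simp add: integrable_real_indicator)
  show i: "integrable lborel (\<lambda>x. indicator S x * norm (g x))"
  proof (rule Bochner_Integration.integrable_bound)
    show "integrable lborel (\<lambda>x. indicator S x + indicator S x * (norm (g x))\<^sup>2 :: real)"
      by (intro Bochner_Integration.integrable_add i1 energy_integrable assms)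
    have "a \<le> 1 + a\<^sup>2" for a :: real
      using sum_power2_ge_zero[of "a - 1/2" 0] by (simp add: power2_eq_square algebra_simps)
    then show "AE x in lborel. norm (indicator S x * norm (g x)) \<le>
        norm (indicator S x + indicator S x * (norm (g x))\<^sup>2 :: real)"
      by (intro AE_I2) (auto simp: indicator_def)
  qed measurable
  define I where "I = (LINT x|lborel. indicator S x * norm (g x))"
  have m: "measure lborel S \<le> (2 * L)\<^sup>2"
    using measure_mono_fmeasurable[OF S, of lborel] measure_sq[of L z] L emeasure_sq_finite[of z L]
    by (auto simp: fmeasurable_def)
  \<comment> \<open>Expanding the square of the deviation from \<open>t\<close>, an approximate mean value, yields the
    Cauchy-Schwarz inequality.\<close>
  define t where "t = I / (2 * L)\<^sup>2"
  have "0 \<le> (LINT x|lborel. indicator S x * (norm (g x) - t)\<^sup>2)"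
    by (intro Bochner_Integration.integral_nonneg) (auto simp: indicator_def)
  also have "\<dots> = (LINT x|lborel. indicator S x * (norm (g x))\<^sup>2 -
      2 * t * (indicator S x * norm (g x)) + t\<^sup>2 * indicator S x)"
    by (intro Bochner_Integration.integral_cong) (auto simp: power2_eq_square algebra_simps)
  also have "\<dots> = energy g S - 2 * t * I + t\<^sup>2 * measure lborel S"
    using i i1 energy_integrable[of S] by (simp add: energy_def I_def)
  also have "\<dots> \<le> energy g S - 2 * t * I + t\<^sup>2 * (2 * L)\<^sup>2"
    using m by (intro add_left_mono mult_left_mono) auto
  also have "\<dots> = energy g S - I\<^sup>2 / (2 * L)\<^sup>2"
    using L by (simp add: t_def field_simps power2_eq_square)
  finally show "(LINT x|lborel. indicator S x * norm (g x))\<^sup>2 \<le> (2 * L)\<^sup>2 * energy g S"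
    using L by (simp add: I_def[symmetric] field_simps)
qed

end

text \<open>
  The transition function at the point \<open>a\<close> and at scale \<open>\<epsilon>\<close>; its derivative \<open>kern a \<epsilon>\<close> is the
  one-dimensional averaging kernel, and \<open>moll u \<epsilon> z\<close> is the average of \<open>u\<close> against the product kernel
  centred at \<open>z\<close>.
\<close>

definition stp :: "real \<Rightarrow> real \<Rightarrow> real \<Rightarrow> real" where
  "stp a \<epsilon> t = step ((t - a) / \<epsilon>)"

definition kern :: "real \<Rightarrow> real \<Rightarrow> real \<Rightarrow> real" where
  "kern a \<epsilon> t = bump ((t - a) / \<epsilon>) / \<epsilon>"

definition ker :: "real \<Rightarrow> real^2 \<Rightarrow> real^2 \<Rightarrow> real" where
  "ker \<epsilon> z = tens (kern (z $ 1) \<epsilon>) (kern (z $ 2) \<epsilon>)"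

definition moll :: "(real^2 \<Rightarrow> real) \<Rightarrow> real \<Rightarrow> real^2 \<Rightarrow> real" where
  "moll u \<epsilon> z = (LINT y|lborel. u y * ker \<epsilon> z y)"

lemma smooth_stp: "smooth_line (stp a \<epsilon>)"
  using smooth_line_affine[OF smooth_step, of "1 / \<epsilon>" "- a / \<epsilon>"]
  by (simp add: stp_def[abs_def] diff_divide_distrib)

lemma smooth_kern: "smooth_line (kern a \<epsilon>)"
  using smooth_line_mult[OF smooth_line_affine[OF smooth_bump, of "1 / \<epsilon>" "- a / \<epsilon>"]
      smooth_line_const[of "1 / \<epsilon>"]]
  by (simp add: kern_def[abs_def] diff_divide_distrib)

lemma stp_has_derivative: "(stp a \<epsilon> has_real_derivative kern a \<epsilon> t) (at t)"
proof -
  have "((\<lambda>t. (t - a) / \<epsilon>) has_real_derivative 1 / \<epsilon>) (at t)"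
    by (cases "\<epsilon> = 0") (auto intro!: derivative_eq_intros)
  from DERIV_chain2[where f = step and g = "\<lambda>t. (t - a) / \<epsilon>" and x = t, OF step_has_derivative this]
  show ?thesis by (simp add: stp_def[abs_def] kern_def)
qed

lemma stp_eq_0: "0 < \<epsilon> \<Longrightarrow> t \<le> a - \<epsilon> \<Longrightarrow> stp a \<epsilon> t = 0"
  and stp_eq_1: "0 < \<epsilon> \<Longrightarrow> a + \<epsilon> \<le> t \<Longrightarrow> stp a \<epsilon> t = 1"
  unfolding stp_def by (auto intro!: step_eq_0 step_eq_1 simp: field_simps)

lemma stp_nonneg: "0 \<le> stp a \<epsilon> t" and stp_le_1: "stp a \<epsilon> t \<le> 1"
  by (simp_all add: stp_def step_nonneg step_le_1)

lemma kern_eq_0: "0 < \<epsilon> \<Longrightarrow> \<epsilon> \<le> \<bar>t - a\<bar> \<Longrightarrow> kern a \<epsilon> t = 0"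
  by (simp add: kern_def bump_eq_0 abs_divide)

lemma kern_nonneg: "0 < \<epsilon> \<Longrightarrow> 0 \<le> kern a \<epsilon> t"
  by (simp add: kern_def bump_nonneg)

lemma kern_le: "0 < \<rho> \<Longrightarrow> \<rho> \<le> \<epsilon> \<Longrightarrow> kern a \<epsilon> t \<le> bump_max / \<rho>"
  unfolding kern_def using bump_max bump_nonneg by (intro frac_le) auto

lemma nn_integral_kern:
  assumes "0 < \<epsilon>" shows "(\<integral>\<^sup>+t. ennreal (kern a \<epsilon> t) \<partial>lborel) = 1"
proof -
  have "(\<integral>\<^sup>+t. ennreal (kern a \<epsilon> t) * indicator {a - \<epsilon>..a + \<epsilon>} t \<partial>lborel)
      = stp a \<epsilon> (a + \<epsilon>) - stp a \<epsilon> (a - \<epsilon>)"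
    by (rule nn_integral_FTC_Icc)
      (use assms kern_nonneg stp_has_derivative smooth_line_measurable[OF smooth_kern]
        in \<open>auto simp: has_real_derivative_iff_has_vector_derivative[symmetric]
          intro: has_field_derivative_at_within\<close>)
  also have "(\<integral>\<^sup>+t. ennreal (kern a \<epsilon> t) * indicator {a - \<epsilon>..a + \<epsilon>} t \<partial>lborel)
      = (\<integral>\<^sup>+t. ennreal (kern a \<epsilon> t) \<partial>lborel)"
    by (intro nn_integral_cong) (use assms kern_eq_0[of \<epsilon> _ a] in \<open>auto simp: indicator_def abs_if\<close>)
  finally show ?thesis using assms by (simp add: stp_eq_0 stp_eq_1)
qed

lemma test_function_ker:
  assumes "0 < \<epsilon>" shows "test_function (ker \<epsilon> z)"
  unfolding ker_def
  by (rule test_function_tens[of _ _ "z $ 1 - \<epsilon>" "z $ 1 + \<epsilon>" "z $ 2 - \<epsilon>" "z $ 2 + \<epsilon>"])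
    (use assms in \<open>auto intro!: smooth_kern kern_eq_0\<close>)

lemma ker_nonneg: "0 < \<epsilon> \<Longrightarrow> 0 \<le> ker \<epsilon> z y"
  by (simp add: ker_def tens_def kern_nonneg)

lemma ker_eq_0: "0 < \<epsilon> \<Longrightarrow> y \<notin> sq z \<epsilon> \<Longrightarrow> ker \<epsilon> z y = 0"
  unfolding ker_def tens_def mem_sq by (auto intro!: kern_eq_0)

lemma ker_measurable_pair [measurable]:
  "(\<lambda>(z, y). ker \<epsilon> z y) \<in> borel_measurable (borel \<Otimes>\<^sub>M borel)"
proof -
  have [measurable]: "bump \<in> borel_measurable borel" by (rule smooth_line_measurable[OF smooth_bump])
  have "continuous_on UNIV (\<lambda>x::real^2. x $ i)" for i by (intro continuous_intros)
  then have [measurable]: "(\<lambda>x::real^2. x $ i) \<in> borel_measurable borel" for i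
    by (rule borel_measurable_continuous_onI)
  show ?thesis unfolding ker_def tens_def kern_def case_prod_beta by measurable
qed

lemma integral_ker:
  assumes "0 < \<epsilon>" shows "(LINT y|lborel. ker \<epsilon> z y) = 1"
proof -
  have inj: "inj_on (\<lambda>i::2. axis i (1::real)) UNIV" by (auto simp: inj_on_def axis_eq_axis)
  have B: "(Basis :: (real^2) set) = range (\<lambda>i. axis i 1)" by (auto simp: Basis_vec_def)
  have "(\<integral>\<^sup>+y. ennreal (ker \<epsilon> z y) \<partial>lborel) =
      (\<integral>\<^sup>+y. (\<Prod>b\<in>Basis. ennreal (kern (z \<bullet> b) \<epsilon> (y \<bullet> b))) \<partial>lborel)"
    unfolding B prod.reindex[OF inj]
    by (intro nn_integral_cong)
      (simp add: UNIV_2 ker_def tens_def inner_axis ennreal_mult kern_nonneg assms)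
  also have "\<dots> = (\<Prod>b\<in>Basis. (\<integral>\<^sup>+t. ennreal (kern (z \<bullet> b) \<epsilon> t) \<partial>lborel))"
    by (rule nn_integral_lborel_prod[of "\<lambda>b t. kern (z \<bullet> b) \<epsilon> t"])
      (auto simp: kern_nonneg assms intro!: smooth_line_measurable smooth_kern)
  also have "\<dots> = 1" by (simp add: nn_integral_kern assms)
  finally show ?thesis
    using integral_eq_nn_integral[of "ker \<epsilon> z" lborel] test_function_bdd_supp[OF test_function_ker[OF assms]]
    by (simp add: ker_nonneg assms bdd_supp_def)
qed

text \<open>
  The kernel is even, because \<open>step (- t) = 1 - step t\<close>. Averaging is therefore a symmetric operator, which is
  what \<open>moll_dual\<close> uses.
\<close>

lemma ker_commute: "ker \<epsilon> z y = ker \<epsilon> y z"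
proof -
  have "step (- t) = 1 - step t" for t
    using step_denominator_pos[of t] by (simp add: step_def field_simps)
  then have "bump (- t) = bump t" for t
  proof -
    have "((\<lambda>t. step (- t)) has_real_derivative bump (- t) * - 1) (at t)"
      by (rule DERIV_chain2[where f = step and g = uminus, OF step_has_derivative])
        (auto intro!: derivative_eq_intros)
    moreover have "((\<lambda>t. step (- t)) has_real_derivative 0 - bump t) (at t)"
      unfolding \<open>\<And>t. step (- t) = 1 - step t\<close>
      by (rule DERIV_diff[OF DERIV_const step_has_derivative])
    ultimately show ?thesis using DERIV_unique by fastforce
  qed
  then have "kern a \<epsilon> b = kern b \<epsilon> a" for a b
    unfolding kern_def by (metis minus_diff_eq minus_divide_left)
  then show ?thesis by (simp add: ker_def tens_def)
qed

context sobolev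
begin

text \<open>
  The key identity. With \<open>k = kern\<close> and \<open>K = stp\<close>, the difference of two product kernels is
  \<open>\<partial>\<^sub>1 [(K - K') \<otimes> k] + \<partial>\<^sub>2 [k' \<otimes> (K - K')]\<close>, where a prime refers to the centre \<open>x'\<close> and the scale \<open>\<delta>\<close>. Both
  functions in brackets are compactly supported since \<open>K\<close> and \<open>K'\<close> agree far away. The
  first is supported in a horizontal strip at height \<open>x $ 2\<close>, the second in a vertical strip at
  abscissa \<open>x' $ 1\<close>: the assumptions on \<open>S\<close> say that it contains the path that runs from \<open>x\<close> first
  horizontally, then vertically to \<open>x'\<close>, thickened by the scales of the kernels.
\<close>

lemma mollifier_difference:
  assumes \<rho>: "0 < \<rho>" "\<rho> \<le> \<epsilon>" "\<rho> \<le> \<delta>" and L: "0 < L"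
    and S [measurable]: "S \<in> sets borel" and SL: "S \<subseteq> sq z L"
    and hor: "\<And>y. \<bar>y $ 2 - x $ 2\<bar> \<le> \<epsilon> \<Longrightarrow> x $ 1 - \<epsilon> \<le> y $ 1 \<or> x' $ 1 - \<delta> \<le> y $ 1 \<Longrightarrow>
        y $ 1 \<le> x $ 1 + \<epsilon> \<or> y $ 1 \<le> x' $ 1 + \<delta> \<Longrightarrow> y \<in> S"
    and ver: "\<And>y. \<bar>y $ 1 - x' $ 1\<bar> \<le> \<delta> \<Longrightarrow> x $ 2 - \<epsilon> \<le> y $ 2 \<or> x' $ 2 - \<delta> \<le> y $ 2 \<Longrightarrow>
        y $ 2 \<le> x $ 2 + \<epsilon> \<or> y $ 2 \<le> x' $ 2 + \<delta> \<Longrightarrow> y \<in> S"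
  shows "(moll u \<epsilon> x - moll u \<delta> x')\<^sup>2 \<le> (4 * bump_max * L / \<rho>)\<^sup>2 * energy g S"
proof -
  have pos: "0 < \<epsilon>" "0 < \<delta>" using \<rho> by auto
  define d1 where "d1 t = stp (x $ 1) \<epsilon> t - stp (x' $ 1) \<delta> t" for t
  define d2 where "d2 t = stp (x $ 2) \<epsilon> t - stp (x' $ 2) \<delta> t" for t
  have sm: "smooth_line d1" "smooth_line d2"
    unfolding d1_def[abs_def] d2_def[abs_def] by (intro smooth_line_diff smooth_stp)+
  have dd: "deriv d1 = (\<lambda>t. kern (x $ 1) \<epsilon> t - kern (x' $ 1) \<delta> t)"
    "deriv d2 = (\<lambda>t. kern (x $ 2) \<epsilon> t - kern (x' $ 2) \<delta> t)"
    unfolding d1_def[abs_def] d2_def[abs_def]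
    using DERIV_imp_deriv[OF DERIV_diff[OF stp_has_derivative stp_has_derivative]] by blast+
  define \<phi>1 where "\<phi>1 = tens d1 (kern (x $ 2) \<epsilon>)"
  define \<phi>2 where "\<phi>2 = tens (kern (x' $ 1) \<delta>) d2"
  have d1_out: "d1 t = 0" if "t \<le> x $ 1 - \<epsilon> \<and> t \<le> x' $ 1 - \<delta> \<or> x $ 1 + \<epsilon> \<le> t \<and> x' $ 1 + \<delta> \<le> t" for t
    using that pos by (auto simp: d1_def stp_eq_0 stp_eq_1)
  have d2_out: "d2 t = 0" if "t \<le> x $ 2 - \<epsilon> \<and> t \<le> x' $ 2 - \<delta> \<or> x $ 2 + \<epsilon> \<le> t \<and> x' $ 2 + \<delta> \<le> t" for t
    using that pos by (auto simp: d2_def stp_eq_0 stp_eq_1)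
  have t1: "test_function \<phi>1" unfolding \<phi>1_def
    by (rule test_function_tens[of _ _ "min (x $ 1 - \<epsilon>) (x' $ 1 - \<delta>)" "max (x $ 1 + \<epsilon>) (x' $ 1 + \<delta>)"
          "x $ 2 - \<epsilon>" "x $ 2 + \<epsilon>"]) (use pos in \<open>auto intro!: sm smooth_kern d1_out kern_eq_0\<close>)
  have t2: "test_function \<phi>2" unfolding \<phi>2_def
    by (rule test_function_tens[of _ _ "x' $ 1 - \<delta>" "x' $ 1 + \<delta>"
          "min (x $ 2 - \<epsilon>) (x' $ 2 - \<delta>)" "max (x $ 2 + \<epsilon>) (x' $ 2 + \<delta>)"])
      (use pos in \<open>auto intro!: sm smooth_kern d2_out kern_eq_0\<close>)
  have div: "ker \<epsilon> x y - ker \<delta> x' y = pderiv2 1 \<phi>1 y + pderiv2 2 \<phi>2 y" for y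
    unfolding \<phi>1_def \<phi>2_def pderiv2_tens(1)[OF sm(1) smooth_kern] pderiv2_tens(2)[OF smooth_kern sm(2)] dd
    by (simp add: ker_def tens_def algebra_simps)
  note ints = loc_int_mult_integrable[OF Hw_loc_int[OF u_Hw] test_function_bdd_supp]
  note intg = loc_int_mult_integrable[OF weak_gradient_loc_int[OF weak] test_function_bdd_supp]
  have "moll u \<epsilon> x - moll u \<delta> x' = (LINT y|lborel. u y * ker \<epsilon> x y - u y * ker \<delta> x' y)"
    unfolding moll_def using ints[OF test_function_ker] pos by simp
  also have "\<dots> = (LINT y|lborel. u y * pderiv2 1 \<phi>1 y + u y * pderiv2 2 \<phi>2 y)"
    using div by (intro Bochner_Integration.integral_cong) (auto simp: right_diff_distrib[symmetric] distrib_left[symmetric])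
  also have "\<dots> = (LINT y|lborel. u y * pderiv2 1 \<phi>1 y) + (LINT y|lborel. u y * pderiv2 2 \<phi>2 y)"
    using ints[OF test_function_pderiv2] t1 t2 by simp
  also have "\<dots> = - (LINT y|lborel. g y $ 1 * \<phi>1 y) - (LINT y|lborel. g y $ 2 * \<phi>2 y)"
    using weak t1 t2 by (simp add: L2_weak_gradient_def)
  also have "\<dots> = - (LINT y|lborel. g y $ 1 * \<phi>1 y + g y $ 2 * \<phi>2 y)"
    using intg[OF t1] intg[OF t2] by simp
  finally have eq: "\<bar>moll u \<epsilon> x - moll u \<delta> x'\<bar> = \<bar>LINT y|lborel. g y $ 1 * \<phi>1 y + g y $ 2 * \<phi>2 y\<bar>"
    by simp
  let ?C = "bump_max / \<rho>"
  have C: "0 \<le> ?C" using bump_max \<rho> by simp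
  have ad: "\<bar>d1 t\<bar> \<le> 1" "\<bar>d2 t\<bar> \<le> 1" for t
    using stp_nonneg[of "x $ 1" \<epsilon> t] stp_le_1[of "x $ 1" \<epsilon> t] stp_nonneg[of "x' $ 1" \<delta> t] stp_le_1[of "x' $ 1" \<delta> t]
      stp_nonneg[of "x $ 2" \<epsilon> t] stp_le_1[of "x $ 2" \<epsilon> t] stp_nonneg[of "x' $ 2" \<delta> t] stp_le_1[of "x' $ 2" \<delta> t]
    by (auto simp: d1_def d2_def abs_le_iff)
  have ak: "\<bar>kern a \<epsilon> t\<bar> \<le> ?C" "\<bar>kern a \<delta> t\<bar> \<le> ?C" for a t
    using kern_le[OF \<rho>(1,2), of a t] kern_le[OF \<rho>(1,3), of a t] kern_nonneg[OF pos(1), of a t] kern_nonneg[OF pos(2), of a t]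
    by auto
  have b1: "\<bar>\<phi>1 y\<bar> \<le> ?C * indicator S y" for y
  proof (cases "\<phi>1 y = 0")
    case False
    then have "d1 (y $ 1) \<noteq> 0" "kern (x $ 2) \<epsilon> (y $ 2) \<noteq> 0" by (auto simp: \<phi>1_def tens_def)
    with d1_out[of "y $ 1"] kern_eq_0[OF pos(1), of "y $ 2" "x $ 2"] have "y \<in> S"
      by (intro hor) linarith+
    then show ?thesis
      using mult_mono[OF ad(1)[of "y $ 1"] ak(1)[of "x $ 2" "y $ 2"]] by (simp add: \<phi>1_def tens_def abs_mult)
  qed (use C in \<open>auto simp: indicator_def\<close>)
  have b2: "\<bar>\<phi>2 y\<bar> \<le> ?C * indicator S y" for y
  proof (cases "\<phi>2 y = 0")
    case False
    then have "d2 (y $ 2) \<noteq> 0" "kern (x' $ 1) \<delta> (y $ 1) \<noteq> 0" by (auto simp: \<phi>2_def tens_def)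
    with d2_out[of "y $ 2"] kern_eq_0[OF pos(2), of "y $ 1" "x' $ 1"] have "y \<in> S"
      by (intro ver) linarith+
    then show ?thesis
      using mult_mono[OF ak(2)[of "x' $ 1" "y $ 1"] ad(2)[of "y $ 2"]] C by (simp add: \<phi>2_def tens_def abs_mult)
  qed (use C in \<open>auto simp: indicator_def\<close>)
  have "\<bar>LINT y|lborel. g y $ 1 * \<phi>1 y + g y $ 2 * \<phi>2 y\<bar>
      \<le> (LINT y|lborel. 2 * ?C * (indicator S y * norm (g y)))"
  proof (rule order_trans[OF integral_abs_bound], rule integral_mono)
    show "integrable lborel (\<lambda>y. \<bar>g y $ 1 * \<phi>1 y + g y $ 2 * \<phi>2 y\<bar>)"
      using intg[OF t1, of 1] intg[OF t2, of 2] by simp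
    show "integrable lborel (\<lambda>y. 2 * ?C * (indicator S y * norm (g y)))"
      using gradient_L1_bound(1)[OF S SL L] by simp
    fix y
    have "\<bar>g y $ 1\<bar> * \<bar>\<phi>1 y\<bar> \<le> norm (g y) * (?C * indicator S y)"
      "\<bar>g y $ 2\<bar> * \<bar>\<phi>2 y\<bar> \<le> norm (g y) * (?C * indicator S y)"
      by (intro mult_mono component_le_norm_cart b1 b2; simp)+
    then have "\<bar>g y $ 1 * \<phi>1 y + g y $ 2 * \<phi>2 y\<bar> \<le>
        norm (g y) * (?C * indicator S y) + norm (g y) * (?C * indicator S y)"
      unfolding abs_mult[symmetric] by (intro order_trans[OF abs_triangle_ineq] add_mono)
    then show "\<bar>g y $ 1 * \<phi>1 y + g y $ 2 * \<phi>2 y\<bar> \<le> 2 * ?C * (indicator S y * norm (g y))"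
      by (simp add: mult_ac)
  qed
  then have "\<bar>moll u \<epsilon> x - moll u \<delta> x'\<bar> \<le> 2 * ?C * (LINT y|lborel. indicator S y * norm (g y))"
    unfolding eq using gradient_L1_bound(1)[OF S SL L] by simp
  then have "\<bar>moll u \<epsilon> x - moll u \<delta> x'\<bar>\<^sup>2 \<le> (2 * ?C * (LINT y|lborel. indicator S y * norm (g y)))\<^sup>2"
    by (intro power_mono) auto
  also have "\<dots> = (2 * ?C)\<^sup>2 * (LINT y|lborel. indicator S y * norm (g y))\<^sup>2" by (simp add: power_mult_distrib power_divide)
  also have "\<dots> \<le> (2 * ?C)\<^sup>2 * ((2 * L)\<^sup>2 * energy g S)"
    by (intro mult_left_mono gradient_L1_bound(2)[OF S SL L]) auto
  also have "\<dots> = (4 * bump_max * L / \<rho>)\<^sup>2 * energy g S"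
    by (simp add: power_mult_distrib power_divide)
  finally show ?thesis by simp
qed

lemma mollifier_rescale:
  assumes r: "0 < r"
  shows "(moll u (r / 8) x - moll u r x)\<^sup>2 \<le> (32 * bump_max)\<^sup>2 * energy g (sq x r)"
proof -
  have "(moll u r x - moll u (r / 8) x)\<^sup>2 \<le> (4 * bump_max * r / (r / 8))\<^sup>2 * energy g (sq x r)"
    by (rule mollifier_difference[of _ _ _ _ _ x]) (use r in \<open>simp_all add: mem_sq del: abs_le_iff, linarith+\<close>)
  with r show ?thesis by (simp add: power2_commute)
qed

end

section \<open>Convergence of mollifications and a Poincare inequality\<close>

lemma mem_sq_commute: "y \<in> sq x d \<longleftrightarrow> x \<in> sq y d"
  by (simp add: mem_sq abs_minus_commute)

lemma vec_nth_measurable [measurable]: "(\<lambda>x::real^2. x $ i) \<in> borel_measurable borel"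
  by (intro borel_measurable_continuous_onI continuous_intros)

lemma pred_mem_sq [measurable]:
  "Measurable.pred (borel \<Otimes>\<^sub>M borel) (\<lambda>p :: (real^2) \<times> (real^2). snd p \<in> sq (fst p) d)"
  unfolding mem_sq by measurable

lemma indicator_sq_measurable [measurable]:
  "(\<lambda>p :: (real^2) \<times> (real^2). indicator (sq (fst p) d) (snd p) :: ennreal) \<in>
    borel_measurable (borel \<Otimes>\<^sub>M borel)"
proof -
  have "(\<lambda>p :: (real^2) \<times> (real^2). indicator (sq (fst p) d) (snd p) :: ennreal) =
      indicator {p \<in> space (borel \<Otimes>\<^sub>M borel). snd p \<in> sq (fst p) d}"
    by (auto simp: fun_eq_iff indicator_def space_pair_measure)
  moreover have "{p \<in> space (borel \<Otimes>\<^sub>M borel). snd p \<in> sq (fst p :: real^2) d} \<in> sets (borel \<Otimes>\<^sub>M borel)"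
    by measurable
  ultimately show ?thesis by (simp only: borel_measurable_indicator)
qed

text \<open>
  Iterating \<open>(p + q)\<^sup>2 \<le> 2 p\<^sup>2 + 2 q\<^sup>2\<close>. The weights \<open>2 ^ k\<close> are harmless where it is applied, since the
  squared increments, integrated over a set, decrease like \<open>64 ^ (- k)\<close>.
\<close>

lemma telescope_square_le:
  fixes a :: "nat \<Rightarrow> real"
  shows "(a n - a 0)\<^sup>2 \<le> (\<Sum>k<n. 2 ^ Suc k * (a (Suc k) - a k)\<^sup>2)"
proof (induction n arbitrary: a)
  case (Suc n)
  have "(a (Suc n) - a 0)\<^sup>2 \<le> 2 * (a 1 - a 0)\<^sup>2 + 2 * (a (Suc n) - a (Suc 0))\<^sup>2"
    using sum_squares_ge_zero[of "(a 1 - a 0) - (a (Suc n) - a (Suc 0))" 0]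
    by (simp add: power2_eq_square algebra_simps)
  also have "\<dots> \<le> 2 * (a 1 - a 0)\<^sup>2 + 2 * (\<Sum>k<n. 2 ^ Suc k * (a (Suc (Suc k)) - a (Suc k))\<^sup>2)"
    using Suc.IH[of "\<lambda>k. a (Suc k)"] by simp
  also have "\<dots> = (\<Sum>k<Suc n. 2 ^ Suc k * (a (Suc k) - a k)\<^sup>2)"
    by (subst sum.lessThan_Suc_shift) (simp add: sum_distrib_left mult.assoc)
  finally show ?case .
qed simp

lemma abs_le_1_plus_power2: "\<bar>a :: real\<bar> \<le> 1 + a\<^sup>2"
proof -
  have "0 \<le> (\<bar>a\<bar> - 1)\<^sup>2" by simp
  then have "2 * \<bar>a\<bar> \<le> 1 + a\<^sup>2" by (simp add: power2_diff)
  then show ?thesis by linarith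
qed

lemma moll_eq_0:
  assumes "0 < \<epsilon>" "\<And>x. x \<notin> sq 0 r \<Longrightarrow> \<phi> x = 0" "y \<notin> sq 0 (r + \<epsilon>)"
  shows "moll \<phi> \<epsilon> y = 0"
proof -
  have "\<phi> x * ker \<epsilon> y x = 0" for x
  proof (cases "x \<in> sq 0 r")
    case True
    with assms(3) have "x \<notin> sq y \<epsilon>" unfolding mem_sq zero_index by linarith
    with ker_eq_0[OF assms(1)] show ?thesis by simp
  qed (simp add: assms(2))
  then show ?thesis unfolding moll_def by (simp only: Bochner_Integration.integral_zero)
qed

lemma moll_bounded:
  assumes e: "0 < \<epsilon>" and [measurable]: "\<phi> \<in> borel_measurable borel" and B: "\<And>x. \<bar>\<phi> x\<bar> \<le> B"
  shows "(LINT x|lborel. \<bar>\<phi> x\<bar> * ker \<epsilon> y x) \<le> B" "\<bar>moll \<phi> \<epsilon> y\<bar> \<le> B"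
proof -
  note k = test_function_bdd_supp[OF test_function_ker[OF e]]
  have ik: "integrable lborel (ker \<epsilon> y)" by (rule bdd_supp_integrable[OF k])
  then have [measurable]: "ker \<epsilon> y \<in> borel_measurable borel" by auto
  have le: "\<bar>\<phi> x\<bar> * ker \<epsilon> y x \<le> B * ker \<epsilon> y x" for x
    using B ker_nonneg[OF e] by (intro mult_right_mono) auto
  have i: "integrable lborel (\<lambda>x. \<bar>\<phi> x\<bar> * ker \<epsilon> y x)"
    by (rule Bochner_Integration.integrable_bound[OF integrable_mult_right[OF ik, of B]])
      (auto simp: abs_mult intro!: mult_mono order_trans[OF B] ker_nonneg e)
  have "(LINT x|lborel. \<bar>\<phi> x\<bar> * ker \<epsilon> y x) \<le> (LINT x|lborel. B * ker \<epsilon> y x)"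
    using i ik le by (intro integral_mono) auto
  then show 1: "(LINT x|lborel. \<bar>\<phi> x\<bar> * ker \<epsilon> y x) \<le> B" by (simp add: integral_ker[OF e])
  have "\<bar>moll \<phi> \<epsilon> y\<bar> \<le> (LINT x|lborel. \<bar>\<phi> x * ker \<epsilon> y x\<bar>)"
    unfolding moll_def by (rule integral_abs_bound)
  also have "\<dots> = (LINT x|lborel. \<bar>\<phi> x\<bar> * ker \<epsilon> y x)"
    by (simp add: abs_mult ker_nonneg[OF e])
  finally show "\<bar>moll \<phi> \<epsilon> y\<bar> \<le> B" using 1 by simp
qed

lemma moll_tendsto:
  assumes "test_function \<phi>" and d: "\<And>k. 0 < d k" "d \<longlonglongrightarrow> 0"
  shows "(\<lambda>k. moll \<phi> (d k) y) \<longlonglongrightarrow> \<phi> y"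
proof (rule LIMSEQ_I)
  fix e :: real assume e: "0 < e"
  have "isCont \<phi> y" using test_function_continuous[OF assms(1), of UNIV] by (simp add: continuous_on_eq_continuous_at)
  then obtain s where s: "0 < s" "\<And>x. norm (x - y) < s \<Longrightarrow> \<bar>\<phi> x - \<phi> y\<bar> < e / 2"
    using e unfolding continuous_at_eps_delta dist_norm by (metis half_gt_zero real_norm_def)
  have "\<forall>\<^sub>F k in sequentially. d k < s / 2" by (rule order_tendstoD(2)[OF d(2)]) (use s(1) in simp)
  then obtain N where N: "\<And>k. k \<ge> N \<Longrightarrow> d k < s / 2" by (auto simp: eventually_sequentially)
  have "norm (moll \<phi> (d k) y - \<phi> y) < e" if "k \<ge> N" for k
  proof -
    note t = test_function_bdd_supp[OF test_function_ker[OF d(1)]]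
    have ik: "integrable lborel (ker (d k) y)" by (rule bdd_supp_integrable[OF t])
    have ip: "integrable lborel (\<lambda>x. \<phi> x * ker (d k) y x)"
      by (rule bdd_supp_integrable[OF bdd_supp_mult[OF test_function_bdd_supp[OF assms(1)] t]])
    have "moll \<phi> (d k) y - \<phi> y = (LINT x|lborel. \<phi> x * ker (d k) y x) - (LINT x|lborel. \<phi> y * ker (d k) y x)"
      by (simp add: moll_def integral_ker[OF d(1)])
    also have "\<dots> = (LINT x|lborel. (\<phi> x - \<phi> y) * ker (d k) y x)"
      using ik ip by (simp add: left_diff_distrib)
    finally have "\<bar>moll \<phi> (d k) y - \<phi> y\<bar> \<le> (LINT x|lborel. \<bar>(\<phi> x - \<phi> y) * ker (d k) y x\<bar>)"
      using integral_abs_bound by metis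
    also have "\<dots> \<le> (LINT x|lborel. e / 2 * ker (d k) y x)"
    proof (rule integral_mono)
      show "integrable lborel (\<lambda>x. \<bar>(\<phi> x - \<phi> y) * ker (d k) y x\<bar>)"
        using ik ip by (simp add: left_diff_distrib)
      show "integrable lborel (\<lambda>x. e / 2 * ker (d k) y x)" using ik by simp
      fix x
      show "\<bar>(\<phi> x - \<phi> y) * ker (d k) y x\<bar> \<le> e / 2 * ker (d k) y x"
      proof (cases "x \<in> sq y (d k)")
        case True
        then have "x - y \<in> sq 0 (d k)" by (simp add: mem_sq)
        then have "norm (x - y) < s" using norm_le_two_sq[of "x - y" "d k"] N[OF that] by simp
        from s(2)[OF this] have "\<bar>\<phi> x - \<phi> y\<bar> \<le> e / 2" by simp
        from mult_right_mono[OF this ker_nonneg[OF d(1)]] show ?thesis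
          by (simp add: abs_mult ker_nonneg[OF d(1)])
      qed (simp add: ker_eq_0[OF d(1)])
    qed
    also have "\<dots> = e / 2" by (simp add: integral_ker[OF d(1)])
    finally show ?thesis using e by simp
  qed
  then show "\<exists>N. \<forall>k\<ge>N. norm (moll \<phi> (d k) y - \<phi> y) < e" by blast
qed

lemma moll_measurable:
  assumes [measurable]: "u \<in> borel_measurable borel"
  shows "moll u \<epsilon> \<in> borel_measurable borel"
  unfolding moll_def[abs_def] by measurable

lemma moll_dual:
  assumes e: "0 < \<epsilon>" and u: "loc_int u" and \<phi>: "bdd_supp \<phi>"
  shows "integrable lborel (\<lambda>x. moll u \<epsilon> x * \<phi> x)"
    and "(LINT x|lborel. moll u \<epsilon> x * \<phi> x) = (LINT y|lborel. u y * moll \<phi> \<epsilon> y)"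
proof -
  have [measurable]: "u \<in> borel_measurable borel" "\<phi> \<in> borel_measurable borel"
    using u \<phi> by (auto simp: loc_int_def bdd_supp_def)
  obtain B r where B: "\<And>x. \<bar>\<phi> x\<bar> \<le> B" "\<And>x. x \<notin> sq 0 r \<Longrightarrow> \<phi> x = 0" using \<phi> by (auto simp: bdd_supp_def)
  have B0: "0 \<le> B" using B(1)[of 0] by linarith
  note k = test_function_bdd_supp[OF test_function_ker[OF e]]
  let ?F = "\<lambda>y x. u y * (\<phi> x * ker \<epsilon> y x)"
  have Fm [measurable]: "(\<lambda>(y, x). ?F y x) \<in> borel_measurable (lborel \<Otimes>\<^sub>M lborel)"
    unfolding case_prod_beta by measurable
  have absmoll: "(LINT x|lborel. norm (?F y x)) = \<bar>u y\<bar> * moll (\<lambda>x. \<bar>\<phi> x\<bar>) \<epsilon> y" for y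
    unfolding moll_def by (simp add: abs_mult ker_nonneg[OF e])
  have bsm: "bdd_supp (moll (\<lambda>x. \<bar>\<phi> x\<bar>) \<epsilon>)" "bdd_supp (moll \<phi> \<epsilon>)"
    unfolding bdd_supp_def
    using moll_bounded(2)[OF e, of "\<lambda>x. \<bar>\<phi> x\<bar>" B] moll_bounded(2)[OF e, of \<phi> B] B
      moll_eq_0[OF e, of r "\<lambda>x. \<bar>\<phi> x\<bar>"] moll_eq_0[OF e, of r \<phi>]
    by (intro conjI moll_measurable exI[of _ B] exI[of _ "r + \<epsilon>"]; simp)+
  have int: "integrable (lborel \<Otimes>\<^sub>M lborel) (\<lambda>(y, x). ?F y x)"
  proof (rule lborel_pair.Fubini_integrable)
    show "integrable lborel (\<lambda>y. LINT x|lborel. norm (case (y, x) of (y, x) \<Rightarrow> ?F y x))"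
      using loc_int_mult_integrable[OF u bsm(1)] integrable_abs[OF loc_int_mult_integrable[OF u bsm(1)]]
        moll_bounded(2)[OF e, of "\<lambda>x. \<bar>\<phi> x\<bar>" B] 
      unfolding prod.case absmoll
      by (rule_tac Bochner_Integration.integrable_bound[OF loc_int_mult_integrable[OF u bsm(1)]])
        (auto simp: abs_mult intro!: borel_measurable_times borel_measurable_abs moll_measurable)
    show "AE y in lborel. integrable lborel (\<lambda>x. case (y, x) of (y, x) \<Rightarrow> ?F y x)"
      using bdd_supp_integrable[OF bdd_supp_mult[OF \<phi> k]] by simp
  qed (rule Fm)
  have c: "(LINT y|lborel. ?F y x) = moll u \<epsilon> x * \<phi> x" for x
  proof -
    have "(LINT y|lborel. ?F y x) = (LINT y|lborel. (u y * ker \<epsilon> x y) * \<phi> x)"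
      by (intro Bochner_Integration.integral_cong) (simp_all add: ker_commute[of \<epsilon> x] mult_ac)
    also have "\<dots> = moll u \<epsilon> x * \<phi> x"
      unfolding moll_def by (rule integral_mult_left_zero)
    finally show ?thesis .
  qed
  show "integrable lborel (\<lambda>x. moll u \<epsilon> x * \<phi> x)"
    using lborel_pair.integrable_snd[OF int] by (simp add: c)
  show "(LINT x|lborel. moll u \<epsilon> x * \<phi> x) = (LINT y|lborel. u y * moll \<phi> \<epsilon> y)"
    using lborel_pair.Fubini_integral[OF int] by (simp add: c moll_def)
qed

definition ann :: "real^2 \<Rightarrow> real \<Rightarrow> real \<Rightarrow> (real^2) set" where
  "ann z a b = {y \<in> sq z b. a \<le> \<bar>y $ 1 - z $ 1\<bar> \<or> a \<le> \<bar>y $ 2 - z $ 2\<bar>}"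

lemma ann_borel [measurable, simp]: "ann z a b \<in> sets borel"
  unfolding ann_def by measurable

text \<open>
  A reference point of the annulus of inner half-width \<open>R\<close>: it is joined to every other point of the annulus
  by a path with one turn that avoids the inner square.
\<close>

definition corner :: "real^2 \<Rightarrow> real \<Rightarrow> real^2" where
  "corner z R = (\<chi> i. z $ i + R)"

context sobolev
begin

lemma energy_sq_measurable [measurable]:
  "(\<lambda>x. ennreal (energy g (sq x d))) \<in> borel_measurable borel"
proof -
  have "(\<lambda>x. \<integral>\<^sup>+y. indicator (sq (fst (x, y)) d) (snd (x, y)) * ennreal ((norm (g y))\<^sup>2) \<partial>lborel) \<in> borel_measurable borel"
    by measurable
  then show ?thesis by (simp add: energy_nn)
qed

text \<open>
  By Fubini's theorem, each \<open>y\<close> is counted at most as often as the area of the set of centres \<open>x\<close> whose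
  square contains it.
\<close>

lemma energy_average_le:
  assumes [measurable]: "A \<in> sets borel" "A' \<in> sets borel"
    and sub: "\<And>x. x \<in> A \<Longrightarrow> sq x d \<subseteq> A'" and d: "0 \<le> d"
  shows "(\<integral>\<^sup>+x. indicator A x * ennreal (energy g (sq x d)) \<partial>lborel) \<le> ennreal ((2 * d)\<^sup>2 * energy g A')"
proof -
  let ?e = "\<lambda>y. ennreal ((norm (g y))\<^sup>2)"
  have "(\<integral>\<^sup>+x. indicator A x * ennreal (energy g (sq x d)) \<partial>lborel) =
      (\<integral>\<^sup>+x. (\<integral>\<^sup>+y. indicator A x * (indicator (sq (fst (x, y)) d) (snd (x, y)) * ?e y) \<partial>lborel) \<partial>lborel)"
    by (intro nn_integral_cong, subst nn_integral_cmult) (auto simp: energy_nn)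
  also have "\<dots> = (\<integral>\<^sup>+y. (\<integral>\<^sup>+x. indicator A x * (indicator (sq (fst (x, y)) d) (snd (x, y)) * ?e y) \<partial>lborel) \<partial>lborel)"
    by (rule lborel_pair.Fubini'[symmetric]) (unfold case_prod_beta prod.collapse fst_conv snd_conv, measurable)
  also have "\<dots> \<le> (\<integral>\<^sup>+y. (\<integral>\<^sup>+x. (indicator A' y * ?e y) * indicator (sq y d) x \<partial>lborel) \<partial>lborel)"
  proof (intro nn_integral_mono)
    fix x y
    show "indicator A x * (indicator (sq (fst (x, y)) d) (snd (x, y)) * ?e y) \<le> indicator A' y * ?e y * indicator (sq y d) x"
      using sub[of x] mem_sq_commute[of y x d] by (auto simp: indicator_def)
  qed
  also have "\<dots> = (\<integral>\<^sup>+y. (indicator A' y * ?e y) * ennreal ((2 * d)\<^sup>2) \<partial>lborel)"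
    by (intro nn_integral_cong, subst nn_integral_cmult) (auto simp: emeasure_sq d)
  also have "\<dots> = ennreal (energy g A') * ennreal ((2 * d)\<^sup>2)"
    by (subst nn_integral_multc) (auto simp: energy_nn)
  also have "\<dots> = ennreal ((2 * d)\<^sup>2 * energy g A')"
    by (simp add: ennreal_mult energy_nonneg mult.commute)
  finally show ?thesis .
qed

text \<open>
  A weighted sum of the local energies over all scales \<open>r / 8 ^ k\<close>. It dominates the square of the
  distance between averages at scale \<open>r\<close> and at all smaller scales, and it is integrable over \<open>x\<close>.
\<close>

definition dini :: "real \<Rightarrow> real^2 \<Rightarrow> ennreal" where
  "dini r x = (\<Sum>k. ennreal (2 ^ Suc k * (32 * bump_max)\<^sup>2 * energy g (sq x (r / 8 ^ k))))"

lemma dini_measurable [measurable]: "dini r \<in> borel_measurable borel"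
proof -
  have "dini r = (\<lambda>x. \<Sum>k. ennreal (2 ^ Suc k * (32 * bump_max)\<^sup>2) * ennreal (energy g (sq x (r / 8 ^ k))))"
    by (auto simp: dini_def fun_eq_iff ennreal_mult'[symmetric] energy_nonneg intro!: suminf_cong)
  then show ?thesis by simp
qed

lemma dini_integral_le:
  assumes [measurable]: "A \<in> sets borel" "A' \<in> sets borel"
    and sub: "\<And>x. x \<in> A \<Longrightarrow> sq x r \<subseteq> A'" and r: "0 < r"
  shows "(\<integral>\<^sup>+x. indicator A x * dini r x \<partial>lborel) \<le> ennreal (9 * (32 * bump_max)\<^sup>2 * r\<^sup>2 * energy g A')"
proof -
  let ?C = "(32 * bump_max)\<^sup>2" and ?E = "energy g A'"
  have le: "(\<integral>\<^sup>+x. indicator A x * ennreal (2 ^ Suc k * ?C * energy g (sq x (r / 8 ^ k))) \<partial>lborel)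
      \<le> ennreal (8 * ?C * r\<^sup>2 * ?E * (1 / 32) ^ k)" for k
  proof -
    have "sq x (r / 8 ^ k) \<subseteq> sq x r" for x
    proof -
      have "r / 8 ^ k \<le> r" using r by (simp add: field_simps)
      then show ?thesis by (auto simp: mem_sq)
    qed
    with sub have sub': "sq x (r / 8 ^ k) \<subseteq> A'" if "x \<in> A" for x using that by blast
    have "(\<integral>\<^sup>+x. indicator A x * ennreal (2 ^ Suc k * ?C * energy g (sq x (r / 8 ^ k))) \<partial>lborel)
      = (\<integral>\<^sup>+x. ennreal (2 ^ Suc k * ?C) * (indicator A x * ennreal (energy g (sq x (r / 8 ^ k)))) \<partial>lborel)"
      by (intro nn_integral_cong) (simp add: ennreal_mult'[symmetric] energy_nonneg indicator_def)
    also have "\<dots> = ennreal (2 ^ Suc k * ?C) * (\<integral>\<^sup>+x. indicator A x * ennreal (energy g (sq x (r / 8 ^ k))) \<partial>lborel)"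
      by (rule nn_integral_cmult) measurable
    also have "\<dots> \<le> ennreal (2 ^ Suc k * ?C) * ennreal ((2 * (r / 8 ^ k))\<^sup>2 * ?E)"
      by (intro mult_left_mono energy_average_le sub') (use r in auto)
    also have "\<dots> = ennreal (2 ^ Suc k * ?C * ((2 * (r / 8 ^ k))\<^sup>2 * ?E))"
      by (simp add: ennreal_mult'[symmetric] energy_nonneg)
    also have "2 ^ Suc k * ?C * ((2 * (r / 8 ^ k))\<^sup>2 * ?E) = 8 * ?C * r\<^sup>2 * ?E * (1 / 32) ^ k"
    proof -
      have "((8::real) ^ k)\<^sup>2 = 2 ^ k * 32 ^ k"
        by (simp add: power2_eq_square power_mult_distrib[symmetric])
      then show ?thesis by (simp add: power_mult_distrib power_divide field_simps)
    qed
    finally show ?thesis .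
  qed
  have "(\<integral>\<^sup>+x. indicator A x * dini r x \<partial>lborel)
      = (\<integral>\<^sup>+x. (\<Sum>k. indicator A x * ennreal (2 ^ Suc k * ?C * energy g (sq x (r / 8 ^ k)))) \<partial>lborel)"
    unfolding dini_def by simp
  also have "\<dots> = (\<Sum>k. \<integral>\<^sup>+x. indicator A x * ennreal (2 ^ Suc k * ?C * energy g (sq x (r / 8 ^ k))) \<partial>lborel)"
  proof (rule nn_integral_suminf)
    fix k
    have "(\<lambda>x. ennreal (2 ^ Suc k * ?C * energy g (sq x (r / 8 ^ k)))) =
       (\<lambda>x. ennreal (2 ^ Suc k * ?C) * ennreal (energy g (sq x (r / 8 ^ k))))"
      by (simp add: fun_eq_iff ennreal_mult'[symmetric] energy_nonneg)
    then have [measurable]: "(\<lambda>x. ennreal (2 ^ Suc k * ?C * energy g (sq x (r / 8 ^ k)))) \<in> borel_measurable borel" by simp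
    show "(\<lambda>x. indicator A x * ennreal (2 ^ Suc k * ?C * energy g (sq x (r / 8 ^ k)))) \<in> borel_measurable lborel"
      by measurable
  qed
  also have "\<dots> \<le> (\<Sum>k. ennreal (8 * ?C * r\<^sup>2 * ?E * (1 / 32) ^ k))"
    by (intro suminf_le le) auto
  also have "\<dots> = ennreal (\<Sum>k. 8 * ?C * r\<^sup>2 * ?E * (1 / 32) ^ k)"
    by (rule suminf_ennreal2) (auto intro!: mult_nonneg_nonneg energy_nonneg summable_mult summable_geometric)
  also have "(\<Sum>k. 8 * ?C * r\<^sup>2 * ?E * (1 / 32) ^ k) = 8 * ?C * r\<^sup>2 * ?E * (32 / 31)"
    by (subst suminf_mult) (auto simp: suminf_geometric summable_geometric)
  also have "ennreal (8 * ?C * r\<^sup>2 * ?E * (32 / 31)) \<le> ennreal (9 * ?C * r\<^sup>2 * ?E)"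
  proof (rule ennreal_leI)
    have "0 \<le> ?C * r\<^sup>2 * ?E" by (intro mult_nonneg_nonneg energy_nonneg) auto
    then show "8 * ?C * r\<^sup>2 * ?E * (32 / 31) \<le> 9 * ?C * r\<^sup>2 * ?E" by (simp add: algebra_simps)
  qed
  finally show ?thesis .
qed

lemma moll_step_le:
  assumes "0 < r"
  shows "(moll u (r / 8 ^ Suc k) x - moll u (r / 8 ^ k) x)\<^sup>2 \<le> (32 * bump_max)\<^sup>2 * energy g (sq x (r / 8 ^ k))"
  using mollifier_rescale[of "r / 8 ^ k" x] assms by (simp add: mult.commute)

lemma moll_dini:
  assumes r: "0 < r"
  shows "ennreal ((moll u (r / 8 ^ n) x - moll u r x)\<^sup>2) \<le> dini r x"
proof -
  let ?C = "(32 * bump_max)\<^sup>2"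
  let ?t = "\<lambda>k. 2 ^ Suc k * ?C * energy g (sq x (r / 8 ^ k))"
  have "(moll u (r / 8 ^ n) x - moll u r x)\<^sup>2
      \<le> (\<Sum>k<n. 2 ^ Suc k * (moll u (r / 8 ^ Suc k) x - moll u (r / 8 ^ k) x)\<^sup>2)"
    using telescope_square_le[of "\<lambda>k. moll u (r / 8 ^ k) x" n] by simp
  also have "\<dots> \<le> (\<Sum>k<n. ?t k)"
    unfolding mult.assoc by (intro sum_mono mult_left_mono moll_step_le r) auto
  finally have "ennreal ((moll u (r / 8 ^ n) x - moll u r x)\<^sup>2) \<le> ennreal (\<Sum>k<n. ?t k)"
    by (rule ennreal_leI)
  also have "\<dots> = (\<Sum>k<n. ennreal (?t k))"
    by (intro sum_ennreal[symmetric] mult_nonneg_nonneg energy_nonneg) auto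
  also have "\<dots> \<le> dini r x" unfolding dini_def by (rule sum_le_suminf) auto
  finally show ?thesis .
qed

lemma moll_convergent:
  assumes r: "0 < r" and fin: "dini r x < \<infinity>"
  shows "convergent (\<lambda>k. moll u (r / 8 ^ k) x)"
proof -
  let ?C = "(32 * bump_max)\<^sup>2" and ?a = "\<lambda>k. moll u (r / 8 ^ k) x"
  let ?t = "\<lambda>k. 2 ^ Suc k * ?C * energy g (sq x (r / 8 ^ k))"
  have t0: "0 \<le> ?t k" for k by (intro mult_nonneg_nonneg energy_nonneg) auto
  have "summable ?t"
    by (rule summable_suminf_not_top) (use t0 fin in \<open>auto simp: dini_def\<close>)
  then have sm: "summable (\<lambda>k. (1 / 2) ^ k + ?t k)"
    by (intro summable_add summable_geometric) auto
  have "\<bar>?a (Suc k) - ?a k\<bar> \<le> (1 / 2) ^ k + ?t k" for k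
  proof -
    \<comment> \<open>The inequality \<open>2 * s \<le> s\<^sup>2 + 1\<close> trades the increment for its square, at the price of a
      convergent geometric series.\<close>
    let ?d = "\<bar>?a (Suc k) - ?a k\<bar>"
    have "0 \<le> (2 ^ Suc k * ?d - 1)\<^sup>2 + 1 + 0" by simp
    then have "2 * 2 ^ Suc k * ?d \<le> (2 ^ Suc k * ?d)\<^sup>2 + 2" by (simp add: power2_diff algebra_simps)
    then have "?d \<le> (1 / 2) ^ k + 2 ^ k * ?d\<^sup>2"
      by (simp add: power2_eq_square power_one_over field_simps)
    also have "2 ^ k * ?d\<^sup>2 \<le> 2 ^ Suc k * (?C * energy g (sq x (r / 8 ^ k)))"
      using moll_step_le[OF r, of k x] by (intro mult_mono) auto
    finally show ?thesis by (simp add: mult.assoc)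
  qed
  then have "summable (\<lambda>k. ?a (Suc k) - ?a k)"
    by (intro summable_comparison_test[OF _ sm]) auto
  then have "convergent (\<lambda>n. \<Sum>k<n. ?a (Suc k) - ?a k)" by (simp add: summable_iff_convergent)
  then have "convergent (\<lambda>n. ?a n - ?a 0)" unfolding sum_lessThan_telescope[of ?a] .
  then have "convergent (\<lambda>n. (?a n - ?a 0) + ?a 0)" by (intro convergent_add convergent_const)
  then show ?thesis by simp
qed

text \<open>
  Where the sum over the scales is finite the averages converge, and dominated convergence
  identifies the limit \<open>v\<close> with \<open>u\<close> in the sense of distributions, by moving the averaging onto the
  test function.
\<close>

lemma moll_converges_AE:
  assumes r: "0 < r"
  shows "AE x in lborel. (\<lambda>k. moll u (r / 8 ^ k) x) \<longlonglongrightarrow> u x"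
proof -
  let ?a = "\<lambda>k. moll u (r / 8 ^ k)"
  define d where "d k = r / 8 ^ k" for k :: nat
  have d: "0 < d k" "d k \<le> r" for k using r by (auto simp: d_def field_simps)
  have d0: "d \<longlonglongrightarrow> 0"
    using tendsto_mult[OF tendsto_const[of r] LIMSEQ_power_zero[of "1/8::real"]] by (simp add: d_def[abs_def] power_one_over)
  note ul = Hw_loc_int[OF u_Hw]
  have [measurable]: "moll u e \<in> borel_measurable borel" for e by (rule moll_measurable) simp
  have nfin: "(\<integral>\<^sup>+x. dini r x \<partial>lborel) < \<infinity>"
    using dini_integral_le[of UNIV UNIV r] r by (simp add: order.strict_trans1)
  then have fin: "AE x in lborel. dini r x < \<infinity>"
    using nn_integral_noteq_infinite[of "dini r" lborel] by (auto simp: less_top)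
  define D where "D x = enn2real (dini r x)" for x
  have [measurable]: "D \<in> borel_measurable borel" unfolding D_def[abs_def] by measurable
  have D: "integrable lborel D"
  proof (rule integrableI_bounded)
    have "(\<integral>\<^sup>+x. ennreal (norm (D x)) \<partial>lborel) = (\<integral>\<^sup>+x. dini r x \<partial>lborel)"
      using fin by (intro nn_integral_cong_AE) (auto simp: D_def)
    with nfin show "(\<integral>\<^sup>+x. ennreal (norm (D x)) \<partial>lborel) < \<infinity>" by simp
  qed measurable
  have dom: "\<bar>?a n x\<bar> \<le> \<bar>?a 0 x\<bar> + 1 + D x" if "dini r x < \<infinity>" for n x
  proof -
    have "(?a n x - ?a 0 x)\<^sup>2 \<le> D x"
      using moll_dini[OF r, of n x] that
      by (simp add: D_def ennreal_le_iff[symmetric] del: ennreal_le_iff)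
    moreover have "\<bar>?a n x - ?a 0 x\<bar> \<le> 1 + (?a n x - ?a 0 x)\<^sup>2"
      by (rule abs_le_1_plus_power2)
    ultimately show ?thesis by linarith
  qed
  define v where "v x = lim (\<lambda>k. ?a k x)" for x
  have [measurable]: "v \<in> borel_measurable borel"
    unfolding v_def[abs_def] by (intro borel_measurable_lim_metric) simp
  have lim: "(\<lambda>k. ?a k x) \<longlonglongrightarrow> v x" if "dini r x < \<infinity>" for x
    using moll_convergent[OF r that] by (simp add: v_def convergent_LIMSEQ_iff)
  have vdom: "\<bar>v x\<bar> \<le> \<bar>?a 0 x\<bar> + 1 + D x" if "dini r x < \<infinity>" for x
    by (rule LIMSEQ_le_const2[OF tendsto_rabs[OF lim[OF that]]]) (use dom[OF that] in auto)
  have wint: "integrable lborel (\<lambda>x. (\<bar>?a 0 x\<bar> + 1 + D x) * \<bar>\<phi> x\<bar>)" if \<phi>: "bdd_supp \<phi>" for \<phi>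
  proof -
    obtain B where B: "\<And>x. \<bar>\<phi> x\<bar> \<le> B" using \<phi> by (auto simp: bdd_supp_def)
    have [measurable]: "\<phi> \<in> borel_measurable borel" using \<phi> by (simp add: bdd_supp_def)
    have 1: "integrable lborel (\<lambda>x. \<bar>?a 0 x * \<phi> x\<bar>)"
      using moll_dual(1)[OF _ ul \<phi>, of r] r by simp
    have 2: "integrable lborel (\<lambda>x. D x * \<bar>\<phi> x\<bar>)"
      by (rule Bochner_Integration.integrable_bound[OF integrable_mult_right[OF D, of B]])
        (use B order_trans[OF abs_ge_zero B] in
          \<open>auto simp: abs_mult mult.commute[of B] intro!: AE_I2 mult_left_mono\<close>)
    have 3: "integrable lborel (\<lambda>x. \<bar>\<phi> x\<bar>)" using bdd_supp_integrable[OF \<phi>] by simp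
    from Bochner_Integration.integrable_add[OF Bochner_Integration.integrable_add[OF 1 3] 2]
    show ?thesis by (simp add: abs_mult algebra_simps)
  qed
  have vl: "loc_int v"
    unfolding loc_int_def
  proof (intro conjI allI)
    fix s
    have bs: "bdd_supp (indicator (sq 0 s))" unfolding bdd_supp_def
      by (intro conjI exI[of _ 1] exI[of _ s]) (auto simp: indicator_def)
    show "integrable lborel (\<lambda>x. indicator (sq 0 s) x * v x)"
      by (rule Bochner_Integration.integrable_bound[OF wint[OF bs]])
        (use fin vdom in \<open>auto simp: indicator_def elim!: eventually_mono intro: order_trans[OF _ abs_ge_self]\<close>)
  qed simp
  have "AE x in lborel. v x - u x = 0"
  proof (rule fundamental_lemma[OF loc_int_diff[OF vl ul]])
    fix \<phi> assume t: "test_function \<phi>"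
    note bs = test_function_bdd_supp[OF t]
    then have [measurable]: "\<phi> \<in> borel_measurable borel" by (simp add: bdd_supp_def)
    obtain B s where B: "\<And>x. \<bar>\<phi> x\<bar> \<le> B" "\<And>x. x \<notin> sq 0 s \<Longrightarrow> \<phi> x = 0" using bs by (auto simp: bdd_supp_def)
    have "(\<lambda>k. LINT x|lborel. ?a k x * \<phi> x) \<longlonglongrightarrow> (LINT x|lborel. v x * \<phi> x)"
    proof (rule integral_dominated_convergence[OF _ _ wint[OF bs]])
      show "AE x in lborel. (\<lambda>k. ?a k x * \<phi> x) \<longlonglongrightarrow> v x * \<phi> x"
        using fin by eventually_elim (intro tendsto_intros lim)
      show "AE x in lborel. norm (?a k x * \<phi> x) \<le> (\<bar>?a 0 x\<bar> + 1 + D x) * \<bar>\<phi> x\<bar>" for k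
        using fin by eventually_elim (use dom in \<open>auto simp: abs_mult intro!: mult_right_mono\<close>)
    qed measurable
    moreover have "(\<lambda>k. LINT x|lborel. u x * moll \<phi> (d k) x) \<longlonglongrightarrow> (LINT x|lborel. u x * \<phi> x)"
    proof (rule integral_dominated_convergence[where w = "\<lambda>x. B * \<bar>indicator (sq 0 (s + r)) x * u x\<bar>"])
      show "integrable lborel (\<lambda>x. B * \<bar>indicator (sq 0 (s + r)) x * u x\<bar>)"
        using ul by (auto simp: loc_int_def)
      show "AE x in lborel. (\<lambda>k. u x * moll \<phi> (d k) x) \<longlonglongrightarrow> u x * \<phi> x"
        by (intro AE_I2 tendsto_intros moll_tendsto t d d0)
      show "AE x in lborel. norm (u x * moll \<phi> (d k) x) \<le> B * \<bar>indicator (sq 0 (s + r)) x * u x\<bar>" for k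
      proof (rule AE_I2)
        fix x
        show "norm (u x * moll \<phi> (d k) x) \<le> B * \<bar>indicator (sq 0 (s + r)) x * u x\<bar>"
        proof (cases "x \<in> sq 0 (s + r)")
          case True
          then show ?thesis
            using mult_right_mono[OF moll_bounded(2)[where \<phi> = \<phi> and y = x, OF d(1)[of k] _ B(1)], of "\<bar>u x\<bar>"]
            by (simp add: abs_mult mult.commute)
        next
          case False
          then have "x \<notin> sq 0 (s + d k)" using d(2)[of k] by (auto simp: mem_sq)
          from moll_eq_0[OF d(1) B(2) this] False show ?thesis by simp
        qed
      qed
      show "(\<lambda>x. u x * moll \<phi> (d k) x) \<in> borel_measurable lborel" for k
        using moll_measurable[of \<phi> "d k"] by simp
    qed measurable
    then have "(\<lambda>k. LINT x|lborel. ?a k x * \<phi> x) \<longlonglongrightarrow> (LINT x|lborel. u x * \<phi> x)"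
      using moll_dual(2)[OF d(1) ul bs] by (simp add: d_def)
    ultimately have "(LINT x|lborel. v x * \<phi> x) = (LINT x|lborel. u x * \<phi> x)"
      by (rule LIMSEQ_unique)
    then show "(LINT x|lborel. (v x - u x) * \<phi> x) = 0"
      using loc_int_mult_integrable[OF vl bs] loc_int_mult_integrable[OF ul bs]
      by (simp add: left_diff_distrib)
  qed
  with fin show ?thesis
  proof eventually_elim
    case (elim x)
    from lim[OF elim(1)] elim(2) show ?case by simp
  qed
qed

lemma moll_error_AE:
  assumes r: "0 < r"
  shows "AE x in lborel. ennreal ((u x - moll u r x)\<^sup>2) \<le> dini r x"
  using moll_converges_AE[OF r]
proof eventually_elim
  case (elim x)
  have "(\<lambda>k. ennreal ((moll u (r / 8 ^ k) x - moll u r x)\<^sup>2)) \<longlonglongrightarrow> ennreal ((u x - moll u r x)\<^sup>2)"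
    by (intro tendsto_intros elim)
  then show ?case by (rule LIMSEQ_le_const2) (use moll_dini[OF r] in auto)
qed

text \<open>
  If \<open>x\<close> is at horizontal distance at least \<open>R\<close> from the centre, the path goes vertically from \<open>x\<close> to the
  height of the corner and then horizontally; otherwise it goes horizontally first. In both cases it
  stays outside the inner square, so kernels of scale \<open>R / 2\<close> see only the annulus.
\<close>

lemma moll_oscillation_annulus:
  assumes R: "0 < R" and x: "x \<in> ann z R N" and N: "N \<le> 8 * R"
  shows "(moll u (R / 2) x - moll u (R / 2) (corner z R))\<^sup>2 \<le>
    (72 * bump_max)\<^sup>2 * energy g (ann z (R / 2) (N + R / 2))"
proof -
  let ?S = "ann z (R / 2) (N + R / 2)"
  have S: "?S \<subseteq> sq z (9 * R)" using N R by (auto simp: ann_def mem_sq)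
  have c: "corner z R $ i = z $ i + R" for i by (simp add: corner_def)
  have eq: "(4 * bump_max * (9 * R) / (R / 2))\<^sup>2 = (72 * bump_max)\<^sup>2" using R by simp
  have x1: "\<bar>x $ 1 - z $ 1\<bar> \<le> N" "\<bar>x $ 2 - z $ 2\<bar> \<le> N" using x by (auto simp: ann_def mem_sq)
  have "R \<le> \<bar>x $ 1 - z $ 1\<bar> \<or> R \<le> \<bar>x $ 2 - z $ 2\<bar>" using x by (simp add: ann_def)
  then show ?thesis
  proof
    assume a: "R \<le> \<bar>x $ 1 - z $ 1\<bar>"
    have "(moll u (R / 2) (corner z R) - moll u (R / 2) x)\<^sup>2 \<le> (4 * bump_max * (9 * R) / (R / 2))\<^sup>2 * energy g ?S"
    proof (rule mollifier_difference[OF _ _ _ _ _ S])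
      fix y :: "real^2"
      assume "\<bar>y $ 2 - corner z R $ 2\<bar> \<le> R / 2" "corner z R $ 1 - R / 2 \<le> y $ 1 \<or> x $ 1 - R / 2 \<le> y $ 1"
        "y $ 1 \<le> corner z R $ 1 + R / 2 \<or> y $ 1 \<le> x $ 1 + R / 2"
      then show "y \<in> ?S" unfolding ann_def mem_sq mem_Collect_eq c using x1 a R by linarith
    next
      fix y :: "real^2"
      assume "\<bar>y $ 1 - x $ 1\<bar> \<le> R / 2" "corner z R $ 2 - R / 2 \<le> y $ 2 \<or> x $ 2 - R / 2 \<le> y $ 2"
        "y $ 2 \<le> corner z R $ 2 + R / 2 \<or> y $ 2 \<le> x $ 2 + R / 2"
      then show "y \<in> ?S" unfolding ann_def mem_sq mem_Collect_eq c using x1 a R by linarith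
    qed (use R in auto)
    then show ?thesis unfolding eq by (simp add: power2_commute)
  next
    assume a: "R \<le> \<bar>x $ 2 - z $ 2\<bar>"
    have "(moll u (R / 2) x - moll u (R / 2) (corner z R))\<^sup>2 \<le> (4 * bump_max * (9 * R) / (R / 2))\<^sup>2 * energy g ?S"
    proof (rule mollifier_difference[OF _ _ _ _ _ S])
      fix y :: "real^2"
      assume "\<bar>y $ 2 - x $ 2\<bar> \<le> R / 2" "x $ 1 - R / 2 \<le> y $ 1 \<or> corner z R $ 1 - R / 2 \<le> y $ 1"
        "y $ 1 \<le> x $ 1 + R / 2 \<or> y $ 1 \<le> corner z R $ 1 + R / 2"
      then show "y \<in> ?S" unfolding ann_def mem_sq mem_Collect_eq c using x1 a R by linarith
    next
      fix y :: "real^2"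
      assume "\<bar>y $ 1 - corner z R $ 1\<bar> \<le> R / 2" "x $ 2 - R / 2 \<le> y $ 2 \<or> corner z R $ 2 - R / 2 \<le> y $ 2"
        "y $ 2 \<le> x $ 2 + R / 2 \<or> y $ 2 \<le> corner z R $ 2 + R / 2"
      then show "y \<in> ?S" unfolding ann_def mem_sq mem_Collect_eq c using x1 a R by linarith
    qed (use R in auto)
    then show ?thesis unfolding eq .
  qed
qed

text \<open>
  The distance of \<open>u\<close> from its average at scale \<open>R / 2\<close> is controlled by \<open>dini_integral_le\<close>, the
  oscillation of that average over the annulus by \<open>moll_oscillation_annulus\<close>.
\<close>

lemma poincare_annulus:
  fixes z :: "real^2"
  assumes R: "0 < R"
  defines "c \<equiv> moll u (R / 2) (corner z R)"
  shows "integrable lborel (\<lambda>x. indicator (ann z R (2 * R)) x * (u x - c)\<^sup>2)"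
    and "(LINT x|lborel. indicator (ann z R (2 * R)) x * (u x - c)\<^sup>2) \<le>
      (400 * bump_max)\<^sup>2 * 4 * R\<^sup>2 * energy g (ann z (R / 2) (5 / 2 * R))"
proof -
  let ?A = "ann z R (2 * R)" and ?A' = "ann z (R / 2) (5 / 2 * R)"
  let ?E = "energy g ?A'"
  have sub: "sq x (R / 2) \<subseteq> ?A'" if "x \<in> ?A" for x
  proof
    fix y assume "y \<in> sq x (R / 2)"
    with that R show "y \<in> ?A'" unfolding ann_def mem_sq mem_Collect_eq by linarith
  qed
  have sm: "ann z (R / 2) (2 * R + R / 2) \<subseteq> ?A'" using R by (auto simp: ann_def mem_sq)
  have pt: "AE x in lborel. indicator ?A x * ennreal ((u x - c)\<^sup>2) \<le>
      2 * (indicator ?A x * dini (R / 2) x) + ennreal (2 * (72 * bump_max)\<^sup>2 * ?E) * indicator (sq z (2 * R)) x"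
    using moll_error_AE[OF half_gt_zero[OF R]]
  proof eventually_elim
    case (elim x)
    show ?case
    proof (cases "x \<in> ?A")
      case True
      have "(moll u (R / 2) x - c)\<^sup>2 \<le> (72 * bump_max)\<^sup>2 * energy g (ann z (R / 2) (2 * R + R / 2))"
        unfolding c_def by (rule moll_oscillation_annulus[OF R True]) (use R in simp)
      also have "\<dots> \<le> (72 * bump_max)\<^sup>2 * ?E" by (intro mult_left_mono energy_mono sm) auto
      finally have o: "(moll u (R / 2) x - c)\<^sup>2 \<le> (72 * bump_max)\<^sup>2 * ?E" .
      have "(u x - c)\<^sup>2 \<le> 2 * (u x - moll u (R / 2) x)\<^sup>2 + 2 * (moll u (R / 2) x - c)\<^sup>2"
        using sum_squares_ge_zero[of "(u x - moll u (R / 2) x) - (moll u (R / 2) x - c)" 0]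
        by (simp add: power2_eq_square algebra_simps)
      also have "\<dots> \<le> 2 * (u x - moll u (R / 2) x)\<^sup>2 + 2 * (72 * bump_max)\<^sup>2 * ?E" using o by simp
      finally have "ennreal ((u x - c)\<^sup>2) \<le> ennreal (2 * (u x - moll u (R / 2) x)\<^sup>2 + 2 * (72 * bump_max)\<^sup>2 * ?E)"
        by (rule ennreal_leI)
      also have "\<dots> = 2 * ennreal ((u x - moll u (R / 2) x)\<^sup>2) + ennreal (2 * (72 * bump_max)\<^sup>2 * ?E)"
        by (subst ennreal_plus) (auto simp: ennreal_mult' energy_nonneg)
      also have "\<dots> \<le> 2 * dini (R / 2) x + ennreal (2 * (72 * bump_max)\<^sup>2 * ?E)"
        by (intro add_right_mono mult_left_mono elim) auto
      finally show ?thesis using True by (simp add: ann_def)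
    qed simp
  qed
  have "(\<integral>\<^sup>+x. indicator ?A x * ennreal ((u x - c)\<^sup>2) \<partial>lborel) \<le>
      (\<integral>\<^sup>+x. 2 * (indicator ?A x * dini (R / 2) x) + ennreal (2 * (72 * bump_max)\<^sup>2 * ?E) * indicator (sq z (2 * R)) x \<partial>lborel)"
    by (rule nn_integral_mono_AE[OF pt])
  also have "\<dots> = 2 * (\<integral>\<^sup>+x. indicator ?A x * dini (R / 2) x \<partial>lborel) +
      ennreal (2 * (72 * bump_max)\<^sup>2 * ?E) * ennreal ((2 * (2 * R))\<^sup>2)"
    using R by (subst nn_integral_add; (subst nn_integral_cmult)?; simp add: nn_integral_cmult emeasure_sq)
  also have "\<dots> \<le> 2 * ennreal (9 * (32 * bump_max)\<^sup>2 * (R / 2)\<^sup>2 * ?E) +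
      ennreal (2 * (72 * bump_max)\<^sup>2 * ?E) * ennreal ((2 * (2 * R))\<^sup>2)"
    by (intro add_right_mono mult_left_mono dini_integral_le sub) (use R in auto)
  also have "\<dots> = ennreal (2 * (9 * (32 * bump_max)\<^sup>2 * (R / 2)\<^sup>2 * ?E) + 2 * (72 * bump_max)\<^sup>2 * ?E * (2 * (2 * R))\<^sup>2)"
  proof -
    have e: "2 * ennreal a + ennreal b * ennreal c = ennreal (2 * a + b * c)"
      if "0 \<le> a" "0 \<le> b" "0 \<le> c" for a b c :: real
      using that by (subst ennreal_plus) (auto simp: ennreal_mult)
    show ?thesis by (rule e) (auto intro!: mult_nonneg_nonneg energy_nonneg)
  qed
  also have "\<dots> \<le> ennreal ((400 * bump_max)\<^sup>2 * 4 * R\<^sup>2 * ?E)"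
  proof (rule ennreal_leI)
    have "0 \<le> bump_max\<^sup>2 * (R\<^sup>2 * ?E)" by (intro mult_nonneg_nonneg energy_nonneg) auto
    moreover have "2 * (9 * (32 * bump_max)\<^sup>2 * (R / 2)\<^sup>2 * ?E) + 2 * (72 * bump_max)\<^sup>2 * ?E * (2 * (2 * R))\<^sup>2
       = 170496 * (bump_max\<^sup>2 * (R\<^sup>2 * ?E))" by (simp add: power_mult_distrib power_divide)
    moreover have "(400 * bump_max)\<^sup>2 * 4 * R\<^sup>2 * ?E = 640000 * (bump_max\<^sup>2 * (R\<^sup>2 * ?E))" by (simp add: power_mult_distrib)
    ultimately show "2 * (9 * (32 * bump_max)\<^sup>2 * (R / 2)\<^sup>2 * ?E) + 2 * (72 * bump_max)\<^sup>2 * ?E * (2 * (2 * R))\<^sup>2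
       \<le> (400 * bump_max)\<^sup>2 * 4 * R\<^sup>2 * ?E" by linarith
  qed
  also have "(\<integral>\<^sup>+x. indicator ?A x * ennreal ((u x - c)\<^sup>2) \<partial>lborel) =
      (\<integral>\<^sup>+x. ennreal (indicator ?A x * (u x - c)\<^sup>2) \<partial>lborel)"
    by (intro nn_integral_cong) (auto simp: indicator_def)
  finally have nn: "(\<integral>\<^sup>+x. ennreal (indicator ?A x * (u x - c)\<^sup>2) \<partial>lborel) \<le> ennreal ((400 * bump_max)\<^sup>2 * 4 * R\<^sup>2 * ?E)" .
  have p: "0 \<le> indicator ?A x * (u x - c)\<^sup>2" for x by (simp add: indicator_def)
  have n: "norm (indicator ?A x * (u x - c)\<^sup>2) = indicator ?A x * (u x - c)\<^sup>2" for x
    by (simp add: indicator_def)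
  show i: "integrable lborel (\<lambda>x. indicator ?A x * (u x - c)\<^sup>2)"
  proof (rule integrableI_bounded)
    show "(\<integral>\<^sup>+x. ennreal (norm (indicator ?A x * (u x - c)\<^sup>2)) \<partial>lborel) < \<infinity>"
      unfolding n using order.strict_trans1[OF nn] by simp
  qed measurable
  have "ennreal (LINT x|lborel. indicator ?A x * (u x - c)\<^sup>2) \<le> ennreal ((400 * bump_max)\<^sup>2 * 4 * R\<^sup>2 * ?E)"
    using nn nn_integral_eq_integral[OF i] p by simp
  then show "(LINT x|lborel. indicator ?A x * (u x - c)\<^sup>2) \<le> (400 * bump_max)\<^sup>2 * 4 * R\<^sup>2 * ?E"
    by (subst (asm) ennreal_le_iff) (auto intro!: mult_nonneg_nonneg energy_nonneg)
qed

end

section \<open>The monotone flux, energy estimates and hole filling\<close>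

text \<open>
  The mean value theorem for \<open>s \<mapsto> \<nu> s * s\<close>, with one-sided derivatives at \<open>0\<close>.
\<close>

lemma N1_increment:
  assumes N: "N1 \<nu>\<^sub>0 \<nu>\<^sub>l \<nu>" and ts: "0 \<le> t" "t \<le> s"
  shows "\<nu>\<^sub>l * (s - t) \<le> \<nu> s * s - \<nu> t * t" "\<nu> s * s - \<nu> t * t \<le> \<nu>\<^sub>0 * (s - t)"
proof -
  let ?f = "\<lambda>s. \<nu> s * s"
  have d: "(?f has_derivative (\<lambda>h. h * hderiv ?f x)) (at x within {t..s})" if "t \<le> x" "x \<le> s" for x
  proof -
    have "\<nu> differentiable (at x within {0..})"
      using N ts that by (auto simp: N1_def differentiable_on_def)
    then have "?f differentiable (at x within {0..})" by (intro differentiable_mult) auto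
    then have "(?f has_vector_derivative hderiv ?f x) (at x within {0..})"
      unfolding hderiv_def by (simp add: vector_derivative_works)
    then have "(?f has_vector_derivative hderiv ?f x) (at x within {t..s})"
      by (rule has_vector_derivative_within_subset) (use ts in auto)
    then show ?thesis by (simp add: has_vector_derivative_def)
  qed
  have b: "\<nu>\<^sub>l \<le> hderiv ?f x" "hderiv ?f x \<le> \<nu>\<^sub>0" if "0 \<le> x" for x
    using N that by (auto simp: N1_def)
  have "\<nu>\<^sub>l * (s - t) \<le> ?f s - ?f t \<and> ?f s - ?f t \<le> \<nu>\<^sub>0 * (s - t)"
  proof (cases "t = s")
    case False
    with ts have "t < s" by simp
    from mvt_simple[OF this d] obtain x where x: "x \<in> {t<..<s}" "?f s - ?f t = (s - t) * hderiv ?f x" by auto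
    with b[of x] ts show ?thesis by (auto simp: mult.commute intro!: mult_left_mono)
  qed simp
  then show "\<nu>\<^sub>l * (s - t) \<le> \<nu> s * s - \<nu> t * t" "\<nu> s * s - \<nu> t * t \<le> \<nu>\<^sub>0 * (s - t)" by auto
qed

lemma N1_bounds: "N1 \<nu>\<^sub>0 \<nu>\<^sub>l \<nu> \<Longrightarrow> 0 \<le> s \<Longrightarrow> 0 < \<nu>\<^sub>l \<and> \<nu>\<^sub>l \<le> \<nu> s \<and> \<nu> s \<le> \<nu>\<^sub>0"
  by (simp add: N1_def)

lemma N1_constants: assumes "N1 \<nu>\<^sub>0 \<nu>\<^sub>l \<nu>" shows "0 < \<nu>\<^sub>l" "\<nu>\<^sub>l \<le> \<nu>\<^sub>0"
  using N1_bounds[OF assms, of 0] by auto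

text \<open>
  With \<open>s = norm a\<close> and \<open>t = norm b\<close>, the product splits into
  \<open>(\<nu> s * s - \<nu> t * t) (s - t)\<close> and \<open>(\<nu> s + \<nu> t) (s t - a \<bullet> b)\<close>, and \<open>(norm (a - b))\<^sup>2\<close> into the radial
  part \<open>(s - t)\<^sup>2\<close> and the angular part \<open>2 (s t - a \<bullet> b)\<close>; the bound on the derivative of \<open>\<nu> s * s\<close> handles the radial part,
  the bound on \<open>\<nu>\<close> the angular part.
\<close>

lemma T_monotone:
  assumes N: "N1 \<nu>\<^sub>0 \<nu>\<^sub>l \<nu>"
  shows "\<nu>\<^sub>l * (norm (a - b))\<^sup>2 \<le> (T \<nu> a - T \<nu> b) \<bullet> (a - b)"
proof -
  let ?s = "norm a" and ?t = "norm b"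
  have l: "\<nu>\<^sub>l \<le> \<nu> ?s" "\<nu>\<^sub>l \<le> \<nu> ?t" using N by (auto simp: N1_def)
  have 1: "\<nu>\<^sub>l * (?s - ?t)\<^sup>2 \<le> (\<nu> ?s * ?s - \<nu> ?t * ?t) * (?s - ?t)"
  proof (cases "?t \<le> ?s")
    case True
    then show ?thesis
      using mult_right_mono[OF N1_increment(1)[OF N norm_ge_zero True], of "?s - ?t"]
      by (simp add: power2_eq_square mult.assoc)
  next
    case False
    then have le: "?s \<le> ?t" by simp
    from mult_right_mono[OF N1_increment(1)[OF N norm_ge_zero le], of "?t - ?s"] le
    show ?thesis by (simp add: power2_eq_square algebra_simps)
  qed
  have 2: "2 * \<nu>\<^sub>l * (?s * ?t - a \<bullet> b) \<le> (\<nu> ?s + \<nu> ?t) * (?s * ?t - a \<bullet> b)"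
    using l norm_cauchy_schwarz[of a b] by (intro mult_right_mono) auto
  have 3: "(norm (a - b))\<^sup>2 = (?s - ?t)\<^sup>2 + 2 * (?s * ?t - a \<bullet> b)"
    by (simp only: power2_norm_eq_inner power2_diff) (simp add: inner_diff inner_commute)
  have 4: "(T \<nu> a - T \<nu> b) \<bullet> (a - b) = (\<nu> ?s * ?s - \<nu> ?t * ?t) * (?s - ?t) + (\<nu> ?s + \<nu> ?t) * (?s * ?t - a \<bullet> b)"
  proof -
    have "(T \<nu> a - T \<nu> b) \<bullet> (a - b) = \<nu> ?s * (?s * ?s) + \<nu> ?t * (?t * ?t) - (\<nu> ?s + \<nu> ?t) * (a \<bullet> b)"
      by (simp add: T_def inner_diff inner_commute[of b a] algebra_simps flip: power2_norm_eq_inner power2_eq_square)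
    then show ?thesis by (simp add: algebra_simps)
  qed
  have "\<nu>\<^sub>l * ((?s - ?t)\<^sup>2 + 2 * (?s * ?t - a \<bullet> b)) = \<nu>\<^sub>l * (?s - ?t)\<^sup>2 + 2 * \<nu>\<^sub>l * (?s * ?t - a \<bullet> b)"
    by (simp add: algebra_simps)
  with 1 2 show ?thesis unfolding 3 4 by linarith
qed

lemma T_Lipschitz:
  assumes N: "N1 \<nu>\<^sub>0 \<nu>\<^sub>l \<nu>"
  shows "norm (T \<nu> a - T \<nu> b) \<le> 3 * \<nu>\<^sub>0 * norm (a - b)"
proof -
  let ?s = "norm a" and ?t = "norm b"
  have b: "0 \<le> \<nu> ?s" "\<nu> ?s \<le> \<nu>\<^sub>0" using N1_bounds[OF N, of ?s] by auto
  have z: "\<nu>\<^sub>0 \<ge> 0" using b by linarith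
  have f: "\<bar>\<nu> ?s * ?s - \<nu> ?t * ?t\<bar> \<le> \<nu>\<^sub>0 * \<bar>?s - ?t\<bar>"
  proof (cases "?t \<le> ?s")
    case True
    have "0 \<le> \<nu>\<^sub>l * (?s - ?t)" using True N by (simp add: N1_def)
    with N1_increment[OF N norm_ge_zero True] True show ?thesis by (simp add: abs_le_iff)
  next
    case False
    then have le: "?s \<le> ?t" by simp
    have "0 \<le> \<nu>\<^sub>l * (?t - ?s)" using le N by (simp add: N1_def)
    with N1_increment[OF N norm_ge_zero le] le show ?thesis by (simp add: abs_le_iff abs_of_nonpos)
  qed
  have n: "\<bar>?s - ?t\<bar> \<le> norm (a - b)" by (rule norm_triangle_ineq3)
  have "T \<nu> a - T \<nu> b = \<nu> ?s *\<^sub>R (a - b) + (\<nu> ?s - \<nu> ?t) *\<^sub>R b" by (simp add: T_def algebra_simps)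
  then have "norm (T \<nu> a - T \<nu> b) \<le> \<bar>\<nu> ?s\<bar> * norm (a - b) + \<bar>\<nu> ?s - \<nu> ?t\<bar> * ?t"
    by (metis norm_scaleR norm_triangle_ineq)
  also have "\<bar>\<nu> ?s - \<nu> ?t\<bar> * ?t = \<bar>(\<nu> ?s * ?s - \<nu> ?t * ?t) - \<nu> ?s * (?s - ?t)\<bar>"
  proof -
    have "(\<nu> ?s * ?s - \<nu> ?t * ?t) - \<nu> ?s * (?s - ?t) = (\<nu> ?s - \<nu> ?t) * ?t" by (simp add: algebra_simps)
    then show ?thesis by (simp add: abs_mult)
  qed
  also have "\<dots> \<le> \<nu>\<^sub>0 * \<bar>?s - ?t\<bar> + \<nu>\<^sub>0 * \<bar>?s - ?t\<bar>"
  proof (rule order_trans[OF abs_triangle_ineq4 add_mono[OF f]])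
    show "\<bar>\<nu> ?s * (?s - ?t)\<bar> \<le> \<nu>\<^sub>0 * \<bar>?s - ?t\<bar>"
      unfolding abs_mult using b by (intro mult_right_mono) auto
  qed
  also have "\<dots> \<le> \<nu>\<^sub>0 * norm (a - b) + \<nu>\<^sub>0 * norm (a - b)"
    using n z by (intro add_mono mult_left_mono)
  also have "\<bar>\<nu> ?s\<bar> * norm (a - b) \<le> \<nu>\<^sub>0 * norm (a - b)" using b by (intro mult_right_mono) auto
  finally show ?thesis by simp
qed

lemma T_measurable:
  assumes N: "N1 \<nu>\<^sub>0 \<nu>\<^sub>l \<nu>" shows "T \<nu> \<in> borel_measurable borel"
proof (rule borel_measurable_continuous_onI)
  have n: "\<nu>\<^sub>0 > 0" using N1_constants[OF N] by simp
  show "continuous_on UNIV (T \<nu>)"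
  proof (rule continuous_onI)
    fix x :: "real^2" and e :: real assume "0 < e"
    then show "\<exists>d>0. \<forall>x'\<in>UNIV. dist x' x < d \<longrightarrow> dist (T \<nu> x') (T \<nu> x) \<le> e"
      using T_Lipschitz[OF N] n
      by (intro exI[of _ "e / (3 * \<nu>\<^sub>0)"])
        (auto simp: dist_norm field_simps intro: order_trans[OF T_Lipschitz[OF N]])
  qed
qed

text \<open>
  A cutoff equal to 1 at distance at most \<open>R\<close> from \<open>a\<close> and to 0 at distance at least \<open>2 * R\<close>, written with
  affine arguments so that smoothness is inherited directly; \<open>plateau_alt\<close> is the readable form.
\<close>

definition plateau :: "real \<Rightarrow> real \<Rightarrow> real \<Rightarrow> real" where
  "plateau a R t = step (2 / R * t + (3 - 2 * a / R)) * step (- 2 / R * t + (3 + 2 * a / R))"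

lemma plateau_alt: "plateau a R t = step (3 + 2 * ((t - a) / R)) * step (3 - 2 * ((t - a) / R))"
  by (simp add: plateau_def diff_divide_distrib algebra_simps)

lemma smooth_plateau: "smooth_line (plateau a R)"
  unfolding plateau_def[abs_def] by (intro smooth_line_mult smooth_line_affine smooth_step)

lemma plateau_nonneg: "0 \<le> plateau a R t" and plateau_le_1: "plateau a R t \<le> 1"
  by (auto simp: plateau_def step_nonneg step_le_1 mult_le_one)

lemma plateau_eq_1: "0 < R \<Longrightarrow> \<bar>t - a\<bar> \<le> R \<Longrightarrow> plateau a R t = 1"
proof -
  assume "0 < R" "\<bar>t - a\<bar> \<le> R"
  then have "\<bar>(t - a) / R\<bar> \<le> 1" by simp
  then have "1 \<le> 3 + 2 * ((t - a) / R)" "1 \<le> 3 - 2 * ((t - a) / R)" by linarith+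
  then show ?thesis by (simp only: plateau_alt step_eq_1 mult_1)
qed

lemma plateau_eq_0: "0 < R \<Longrightarrow> 2 * R \<le> \<bar>t - a\<bar> \<Longrightarrow> plateau a R t = 0"
proof -
  assume "0 < R" "2 * R \<le> \<bar>t - a\<bar>"
  then have "2 \<le> \<bar>(t - a) / R\<bar>" by (simp add: field_simps)
  then have "3 + 2 * ((t - a) / R) \<le> - 1 \<or> 3 - 2 * ((t - a) / R) \<le> -1" by linarith
  then show ?thesis unfolding plateau_alt using step_eq_0 by auto
qed

lemma deriv_plateau:
  assumes R: "0 < R"
  shows "\<bar>deriv (plateau a R) t\<bar> \<le> 4 * bump_max / R"
    and "\<bar>t - a\<bar> \<le> R \<or> 2 * R \<le> \<bar>t - a\<bar> \<Longrightarrow> deriv (plateau a R) t = 0"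
proof -
  let ?p = "3 + 2 * ((t - a) / R)" and ?m = "3 - 2 * ((t - a) / R)"
  have p: "((\<lambda>t. 3 + 2 * ((t - a) / R)) has_real_derivative 2 / R) (at t)"
    and m: "((\<lambda>t. 3 - 2 * ((t - a) / R)) has_real_derivative - (2 / R)) (at t)"
    using R by (auto intro!: derivative_eq_intros)
  have "((\<lambda>t. step (3 + 2 * ((t - a) / R)) * step (3 - 2 * ((t - a) / R))) has_real_derivative
      bump ?p * (2 / R) * step ?m + bump ?m * (- (2 / R)) * step ?p) (at t)"
    by (rule DERIV_mult[OF DERIV_chain2[where f = step, OF step_has_derivative p]
          DERIV_chain2[where f = step, OF step_has_derivative m]])
  then have "(plateau a R has_real_derivative
      bump ?p * (2 / R) * step ?m + bump ?m * (- (2 / R)) * step ?p) (at t)"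
    by (simp add: plateau_alt[abs_def])
  then have D: "deriv (plateau a R) t = 2 / R * (bump ?p * step ?m - bump ?m * step ?p)"
    by (simp add: DERIV_imp_deriv algebra_simps)
  have b: "0 \<le> bump s * step s'" "bump s * step s' \<le> bump_max" for s s'
    using mult_mono[OF bump_max(2)[of s] step_le_1[of s']] bump_nonneg[of s] step_nonneg[of s'] bump_max(1) by auto
  then have "\<bar>bump ?p * step ?m - bump ?m * step ?p\<bar> \<le> 2 * bump_max"
    using b[of ?p ?m] b[of ?m ?p] by linarith
  from mult_left_mono[OF this, of "2 / R"] R show "\<bar>deriv (plateau a R) t\<bar> \<le> 4 * bump_max / R"
    unfolding D abs_mult by simp
  assume "\<bar>t - a\<bar> \<le> R \<or> 2 * R \<le> \<bar>t - a\<bar>"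
  then show "deriv (plateau a R) t = 0"
  proof
    assume "\<bar>t - a\<bar> \<le> R"
    then have "\<bar>(t - a) / R\<bar> \<le> 1" using R by simp
    then have "1 \<le> \<bar>?p\<bar>" "1 \<le> \<bar>?m\<bar>" by linarith+
    then show ?thesis by (simp only: D bump_eq_0 mult_zero_left mult_zero_right diff_self)
  next
    assume "2 * R \<le> \<bar>t - a\<bar>"
    then have "2 \<le> \<bar>(t - a) / R\<bar>" using R by (simp add: field_simps)
    then have "(?p \<le> - 1 \<and> 1 \<le> ?m) \<or> (?m \<le> - 1 \<and> 1 \<le> ?p)" by linarith
    then show ?thesis unfolding D using bump_eq_0[of ?p] bump_eq_0[of ?m] step_eq_0[of ?p] step_eq_0[of ?m] by auto
  qed
qed

definition flux :: "real \<Rightarrow> (real \<Rightarrow> real) \<Rightarrow> real^2 \<Rightarrow> (real^2 \<Rightarrow> real^2) \<Rightarrow> real^2 \<Rightarrow> real^2" where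
  "flux \<nu>\<^sub>0 \<nu> U\<^sub>0 g x = T_tilde (ball 0 1) \<nu>\<^sub>0 \<nu> x (U\<^sub>0 + g x) - T_tilde (ball 0 1) \<nu>\<^sub>0 \<nu> x U\<^sub>0"

lemma flux_measurable:
  assumes N: "N1 \<nu>\<^sub>0 \<nu>\<^sub>l \<nu>" and [measurable]: "g \<in> borel_measurable borel"
  shows "flux \<nu>\<^sub>0 \<nu> U\<^sub>0 g \<in> borel_measurable borel"
proof -
  have [measurable]: "ball (0 :: real^2) 1 \<in> sets borel" "- ball (0 :: real^2) 1 \<in> sets borel" by auto
  have [measurable]: "(\<lambda>x. T \<nu> (U\<^sub>0 + g x)) \<in> borel_measurable borel"
    by (rule measurable_compose[OF _ T_measurable[OF N]]) measurable
  show ?thesis unfolding flux_def[abs_def] T_tilde_def by measurable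
qed

lemma flux_coercive:
  assumes N: "N1 \<nu>\<^sub>0 \<nu>\<^sub>l \<nu>"
  shows "\<nu>\<^sub>l * (norm (g x))\<^sup>2 \<le> flux \<nu>\<^sub>0 \<nu> U\<^sub>0 g x \<bullet> g x"
proof (cases "x \<in> ball 0 1")
  case True
  have "\<nu>\<^sub>l \<le> \<nu>\<^sub>0" using N1_constants[OF N] by simp
  then have "\<nu>\<^sub>l * (norm (g x))\<^sup>2 \<le> \<nu>\<^sub>0 * (norm (g x))\<^sup>2" by (intro mult_right_mono) auto
  with True show ?thesis by (simp add: flux_def T_tilde_def power2_norm_eq_inner flip: scaleR_diff_right)
next
  case False
  with T_monotone[OF N, of "U\<^sub>0 + g x" U\<^sub>0] show ?thesis by (simp add: flux_def T_tilde_def)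
qed

lemma flux_bound:
  assumes N: "N1 \<nu>\<^sub>0 \<nu>\<^sub>l \<nu>"
  shows "norm (flux \<nu>\<^sub>0 \<nu> U\<^sub>0 g x) \<le> 3 * \<nu>\<^sub>0 * norm (g x)"
proof (cases "x \<in> ball 0 1")
  case True
  have "0 \<le> \<nu>\<^sub>0" using N1_constants[OF N] by simp
  with True show ?thesis by (simp add: flux_def T_tilde_def mult_right_mono flip: scaleR_diff_right)
next
  case False
  with T_Lipschitz[OF N, of "U\<^sub>0 + g x" U\<^sub>0] show ?thesis by (simp add: flux_def T_tilde_def)
qed

definition outer :: "real \<Rightarrow> (real^2) set" where
  "outer s = {y. s \<le> \<bar>y $ 1\<bar> \<or> s \<le> \<bar>y $ 2\<bar>}"

lemma outer_borel [measurable, simp]: "outer s \<in> sets borel"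
  unfolding outer_def by measurable

text \<open>
  A function whose gradient solves the equation, tested only with functions whose gradient vanishes on the unit disc.
  For these the source term of \<open>Q\<close> disappears.
\<close>

locale solution = sobolev u g for u g +
  fixes \<nu>\<^sub>0 \<nu>\<^sub>l :: real and \<nu> :: "real \<Rightarrow> real" and U\<^sub>0 :: "real^2"
  assumes N: "N1 \<nu>\<^sub>0 \<nu>\<^sub>l \<nu>"
    and equation: "\<And>v h. v \<in> Hw \<Longrightarrow> L2_weak_gradient v h \<Longrightarrow> (\<forall>x\<in>ball 0 1. h x = 0) \<Longrightarrow>
      (LINT x|lborel. flux \<nu>\<^sub>0 \<nu> U\<^sub>0 g x \<bullet> h x) = 0"
begin

lemma constants_pos: "0 < \<nu>\<^sub>l" "0 < \<nu>\<^sub>0"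
  using N1_constants[OF N] by auto

text \<open>
  The constant of the energy estimate \<open>caccioppoli\<close>: the factor \<open>(400 * bump_max)\<^sup>2 * 4\<close> is the
  Poincare constant, and \<open>12 * \<nu>\<^sub>0 * bump_max\<close> combines the Lipschitz constant \<open>3 * \<nu>\<^sub>0\<close> of the flux with the bound
  \<open>8 * bump_max / R\<close> for the gradient of the cutoff and the factor \<open>1 / 2\<close> from Young's inequality.
\<close>

definition kappa :: real where
  "kappa = 12 * \<nu>\<^sub>0 * bump_max * (1 + (400 * bump_max)\<^sup>2 * 4)"

definition theta :: real where "theta = kappa / (\<nu>\<^sub>l + kappa)"

lemma kappa_pos: "0 < kappa"
  unfolding kappa_def using constants_pos bump_max(1) by (intro mult_pos_pos add_pos_nonneg) auto

lemma theta_bounds: "0 < theta" "theta < 1"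
  unfolding theta_def using kappa_pos constants_pos by (auto simp: field_simps)

text \<open>
  Hole filling: the energy \<open>X\<close> of the hole and the energy \<open>Y\<close> of the surrounding annulus add up to at most \<open>Z\<close>.
\<close>

lemma theta_absorb:
  assumes "\<nu>\<^sub>l * X \<le> kappa * Y" "X + Y \<le> Z" shows "X \<le> theta * Z"
proof -
  have "kappa * (X + Y) \<le> kappa * Z" using assms(2) kappa_pos by (intro mult_left_mono) auto
  with assms(1) have "(\<nu>\<^sub>l + kappa) * X \<le> kappa * Z" by (simp add: algebra_simps)
  then show ?thesis using kappa_pos constants_pos by (simp add: theta_def field_simps)
qed

text \<open>
  The two admissible choices of \<open>a\<close> and \<open>b\<close> give the cutoffs \<open>\<theta> = a + \<psi>\<close> that are 1 on an
  inner square or 1 outside an outer one. Testing with \<open>\<theta> (u - c)\<close> gives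
  \<open>\<integral> \<theta> F \<bullet> g = - \<integral> (u - c) F \<bullet> \<nabla>\<theta>\<close> for the flux \<open>F\<close>. The left side is coercive, and the right side
  lives on the annulus, where Young's and Poincare's inequalities apply.
\<close>

lemma caccioppoli:
  fixes a b :: real and z :: "real^2"
  assumes R: "0 < R" and ab: "a = 0 \<and> b = 1 \<or> a = 1 \<and> b = - 1"
  defines "\<psi> \<equiv> tens (\<lambda>t. b * plateau (z $ 1) R t) (plateau (z $ 2) R)"
  assumes van: "\<And>x. x \<in> ball 0 1 \<Longrightarrow> a + \<psi> x = 0" "\<And>x. x \<in> ball 0 1 \<Longrightarrow> x \<notin> ann z R (2 * R)"
    and B [measurable]: "B \<in> sets borel" and B1: "\<And>x. x \<in> B \<Longrightarrow> a + \<psi> x = 1"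
  shows "\<nu>\<^sub>l * energy g B \<le> kappa * energy g (ann z (R / 2) (5 / 2 * R))"
proof -
  let ?A = "ann z R (2 * R)" and ?A' = "ann z (R / 2) (5 / 2 * R)"
  define c where "c = moll u (R / 2) (corner z R)"
  note P = poincare_annulus[OF R, of z, folded c_def]
  have sb: "smooth_line (\<lambda>t. b * plateau (z $ 1) R t)"
    by (intro smooth_line_mult smooth_line_const smooth_plateau)
  have db: "deriv (\<lambda>t. b * plateau (z $ 1) R t) = (\<lambda>t. b * deriv (plateau (z $ 1) R) t)"
    by (intro ext DERIV_imp_deriv DERIV_cmult smooth_line_has_derivative smooth_plateau)
  have t: "test_function \<psi>" unfolding \<psi>_def
    by (rule test_function_tens[OF sb smooth_plateau, of "z $ 1 - 2 * R" "z $ 1 + 2 * R" "z $ 2 - 2 * R" "z $ 2 + 2 * R"])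
      (auto intro!: plateau_eq_0 R)
  have p: "pderiv2 1 \<psi> x = b * deriv (plateau (z $ 1) R) (x $ 1) * plateau (z $ 2) R (x $ 2)"
    "pderiv2 2 \<psi> x = b * plateau (z $ 1) R (x $ 1) * deriv (plateau (z $ 2) R) (x $ 2)" for x
    unfolding \<psi>_def pderiv2_tens[OF sb smooth_plateau] db by (simp_all add: tens_def)
  have b1: "\<bar>b\<bar> = 1" using ab by auto
  have M: "0 \<le> 4 * bump_max / R" using bump_max(1) R by simp
  have pb: "\<bar>pderiv2 i \<psi> x\<bar> \<le> 4 * bump_max / R" for i x
  proof -
    have "\<bar>deriv (plateau (z $ 1) R) (x $ 1)\<bar> * \<bar>plateau (z $ 2) R (x $ 2)\<bar> \<le> 4 * bump_max / R * 1"
      "\<bar>plateau (z $ 1) R (x $ 1)\<bar> * \<bar>deriv (plateau (z $ 2) R) (x $ 2)\<bar> \<le> 1 * (4 * bump_max / R)"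
      using M plateau_nonneg plateau_le_1
      by (intro mult_mono deriv_plateau(1) R; simp)+
    then have "\<bar>pderiv2 1 \<psi> x\<bar> \<le> 4 * bump_max / R" "\<bar>pderiv2 2 \<psi> x\<bar> \<le> 4 * bump_max / R"
      unfolding p abs_mult b1 mult_1 mult_1_right .
    then show ?thesis using exhaust_2[of i] by auto
  qed
  have p0: "pderiv2 i \<psi> x = 0" if "x \<notin> ?A" for i x
  proof -
    from that have "2 * R \<le> \<bar>x $ 1 - z $ 1\<bar> \<or> 2 * R \<le> \<bar>x $ 2 - z $ 2\<bar> \<or>
        \<bar>x $ 1 - z $ 1\<bar> \<le> R \<and> \<bar>x $ 2 - z $ 2\<bar> \<le> R"
      unfolding ann_def mem_sq mem_Collect_eq by linarith
    then have "pderiv2 1 \<psi> x = 0" "pderiv2 2 \<psi> x = 0"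
      unfolding p using deriv_plateau(2)[OF R] plateau_eq_0[OF R] by auto
    then show ?thesis using exhaust_2[of i] by auto
  qed
  have pr: "0 \<le> a + \<psi> x" for x
  proof -
    have "0 \<le> plateau (z $ 1) R (x $ 1) * plateau (z $ 2) R (x $ 2)" "plateau (z $ 1) R (x $ 1) * plateau (z $ 2) R (x $ 2) \<le> 1"
      by (auto intro!: mult_nonneg_nonneg mult_le_one plateau_nonneg plateau_le_1)
    with ab show ?thesis by (auto simp: \<psi>_def tens_def)
  qed
  define v where "v x = a * u x + \<psi> x * (u x - c)" for x
  define G where "G x = (\<chi> i. pderiv2 i \<psi> x)" for x
  define h where "h x = (a + \<psi> x) *\<^sub>R g x + (u x - c) *\<^sub>R G x" for x
  have v: "v \<in> Hw" "L2_weak_gradient v h"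
    using cutoff_weak_gradient[OF u_Hw weak t, of a c] by (simp_all add: v_def[abs_def] h_def[abs_def] G_def)
  have G0: "G x = 0" if "x \<notin> ?A" for x using p0[OF that] by (simp add: G_def vec_eq_iff)
  have Gb: "norm (G x) \<le> 8 * bump_max / R" for x
    using norm_le_l1_cart[of "G x"] pb[of 1 x] pb[of 2 x] by (simp add: sum_2 G_def)
  let ?F = "flux \<nu>\<^sub>0 \<nu> U\<^sub>0 g"
  have eq: "(LINT x|lborel. ?F x \<bullet> h x) = 0"
    by (rule equation[OF v]) (use van G0 in \<open>auto simp: h_def\<close>)
  have [measurable]: "?F \<in> borel_measurable borel" by (rule flux_measurable[OF N]) simp
  have [measurable]: "h \<in> borel_measurable borel" using v(2) by (simp add: L2_weak_gradient_def)
  have Fh: "integrable lborel (\<lambda>x. ?F x \<bullet> h x)"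
  proof (rule Bochner_Integration.integrable_bound)
    show "integrable lborel (\<lambda>x. 3 * \<nu>\<^sub>0 * ((norm (g x))\<^sup>2 + (norm (h x))\<^sup>2))"
      using g_square_integrable v(2) by (intro integrable_mult_right Bochner_Integration.integrable_add) (auto simp: L2_weak_gradient_def)
    show "AE x in lborel. norm (?F x \<bullet> h x) \<le> norm (3 * \<nu>\<^sub>0 * ((norm (g x))\<^sup>2 + (norm (h x))\<^sup>2))"
    proof (rule AE_I2)
      fix x
      have "\<bar>?F x \<bullet> h x\<bar> \<le> norm (?F x) * norm (h x)" by (rule Cauchy_Schwarz_ineq2)
      also have "\<dots> \<le> 3 * \<nu>\<^sub>0 * norm (g x) * norm (h x)" by (intro mult_right_mono flux_bound[OF N]) auto
      also have "\<dots> \<le> 3 * \<nu>\<^sub>0 * ((norm (g x))\<^sup>2 + (norm (h x))\<^sup>2)"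
      proof -
        have "2 * (norm (g x) * norm (h x)) \<le> (norm (g x))\<^sup>2 + (norm (h x))\<^sup>2"
          using sum_squares_bound[of "norm (g x)" "norm (h x)"] by simp
        moreover have "0 \<le> norm (g x) * norm (h x)" by simp
        ultimately have "norm (g x) * norm (h x) \<le> (norm (g x))\<^sup>2 + (norm (h x))\<^sup>2" by linarith
        from mult_left_mono[OF this, of "3 * \<nu>\<^sub>0"] constants_pos show ?thesis by (simp add: mult.assoc)
      qed
      finally show "norm (?F x \<bullet> h x) \<le> norm (3 * \<nu>\<^sub>0 * ((norm (g x))\<^sup>2 + (norm (h x))\<^sup>2))"
        unfolding real_norm_def by (rule order_trans[OF _ abs_ge_self])
    qed
  qed measurable
  let ?K = "12 * \<nu>\<^sub>0 * bump_max"
  have K: "0 \<le> ?K" using constants_pos bump_max(1) by simp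
  let ?L = "\<lambda>x. \<nu>\<^sub>l * (indicator B x * (norm (g x))\<^sup>2) -
      ?K * (indicator ?A x * (norm (g x))\<^sup>2 + indicator ?A x * (u x - c)\<^sup>2 / R\<^sup>2)"
  have iL: "integrable lborel ?L"
    using P(1) by (intro Bochner_Integration.integrable_diff integrable_mult_right Bochner_Integration.integrable_add energy_integrable integrable_divide_zero)
      auto
  have "(LINT x|lborel. ?L x) \<le> (LINT x|lborel. ?F x \<bullet> h x)"
  proof (rule integral_mono[OF iL Fh])
    fix x
    have 1: "\<nu>\<^sub>l * (indicator B x * (norm (g x))\<^sup>2) \<le> (a + \<psi> x) * (?F x \<bullet> g x)"
    proof -
      have 0: "0 \<le> \<nu>\<^sub>l * (norm (g x))\<^sup>2" using constants_pos by simp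
      have "(a + \<psi> x) * (\<nu>\<^sub>l * (norm (g x))\<^sup>2) \<le> (a + \<psi> x) * (?F x \<bullet> g x)"
        by (intro mult_left_mono flux_coercive[OF N] pr)
      moreover have "\<nu>\<^sub>l * (indicator B x * (norm (g x))\<^sup>2) \<le> (a + \<psi> x) * (\<nu>\<^sub>l * (norm (g x))\<^sup>2)"
        using B1[of x] mult_nonneg_nonneg[OF pr[of x] 0] by (cases "x \<in> B") auto
      ultimately show ?thesis by linarith
    qed
    have 2: "- ((u x - c) * (?F x \<bullet> G x)) \<le> ?K * (indicator ?A x * (norm (g x))\<^sup>2 + indicator ?A x * (u x - c)\<^sup>2 / R\<^sup>2)"
    proof (cases "x \<in> ?A")
      case True
      have "- ((u x - c) * (?F x \<bullet> G x)) \<le> \<bar>u x - c\<bar> * \<bar>?F x \<bullet> G x\<bar>"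
        by (metis abs_ge_minus_self abs_mult)
      also have "\<dots> \<le> \<bar>u x - c\<bar> * (norm (?F x) * norm (G x))"
        by (intro mult_left_mono Cauchy_Schwarz_ineq2) auto
      also have "\<dots> \<le> \<bar>u x - c\<bar> * (3 * \<nu>\<^sub>0 * norm (g x) * (8 * bump_max / R))"
        using constants_pos by (intro mult_left_mono mult_mono flux_bound[OF N] Gb) auto
      also have "\<dots> = ?K * (2 * norm (g x) * (\<bar>u x - c\<bar> / R))" by simp
      also have "\<dots> \<le> ?K * ((norm (g x))\<^sup>2 + (\<bar>u x - c\<bar> / R)\<^sup>2)"
        by (intro mult_left_mono K sum_squares_bound)
      finally show ?thesis using True by (simp add: power_divide)
    qed (simp add: G0)
    have "?F x \<bullet> h x = (a + \<psi> x) * (?F x \<bullet> g x) + (u x - c) * (?F x \<bullet> G x)"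
      by (simp add: h_def inner_add_right)
    with 1 2 show "?L x \<le> ?F x \<bullet> h x" by linarith
  qed
  moreover have "(LINT x|lborel. ?L x) = \<nu>\<^sub>l * energy g B -
      ?K * (energy g ?A + (LINT x|lborel. indicator ?A x * (u x - c)\<^sup>2) / R\<^sup>2)"
    using P(1) energy_integrable[of B] energy_integrable[of ?A] by (simp add: energy_def)
  ultimately have "\<nu>\<^sub>l * energy g B \<le> ?K * (energy g ?A + (LINT x|lborel. indicator ?A x * (u x - c)\<^sup>2) / R\<^sup>2)"
    using eq by simp
  also have "\<dots> \<le> ?K * (energy g ?A' + (400 * bump_max)\<^sup>2 * 4 * energy g ?A')"
  proof (intro mult_left_mono add_mono K)
    show "energy g ?A \<le> energy g ?A'" by (rule energy_mono) (use R in \<open>auto simp: ann_def mem_sq\<close>)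
    show "(LINT x|lborel. indicator ?A x * (u x - c)\<^sup>2) / R\<^sup>2 \<le> (400 * bump_max)\<^sup>2 * 4 * energy g ?A'"
      using divide_right_mono[OF P(2), of "R\<^sup>2"] R by simp
  qed
  also have "\<dots> = kappa * energy g ?A'" by (simp add: kappa_def algebra_simps)
  finally show ?thesis .
qed

text \<open>
  The cutoff radius \<open>R = 2 / 5 * s\<close> is chosen so that the enlarged annulus has outer half-width \<open>5 / 2 * R = s\<close>, while
  its inner half-width \<open>R / 2 = s / 5\<close> stays above that of the hole, \<open>s / 8\<close>.
\<close>

lemma interior_decay:
  assumes s: "0 < s" and off: "sq z s \<inter> ball 0 1 = {}"
  shows "energy g (sq z (s / 8)) \<le> theta * energy g (sq z s)"
proof -
  define R where "R = 2 / 5 * s"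
  have R: "0 < R" "s = 5 / 2 * R" using s by (auto simp: R_def)
  have "\<nu>\<^sub>l * energy g (sq z (s / 8)) \<le> kappa * energy g (ann z (R / 2) (5 / 2 * R))"
  proof (rule caccioppoli[where a = 0 and b = 1, OF R(1)])
    fix x :: "real^2" assume "x \<in> ball 0 1"
    with off have x: "x \<notin> sq z s" by blast
    then have "2 * R \<le> \<bar>x $ 1 - z $ 1\<bar> \<or> 2 * R \<le> \<bar>x $ 2 - z $ 2\<bar>"
      using R unfolding mem_sq by linarith
    then show "0 + tens (\<lambda>t. 1 * plateau (z $ 1) R t) (plateau (z $ 2) R) x = 0"
      using plateau_eq_0[OF R(1)] by (auto simp: tens_def)
    show "x \<notin> ann z R (2 * R)" using x R unfolding ann_def mem_sq mem_Collect_eq by linarith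
  next
    fix x assume "x \<in> sq z (s / 8)"
    then have "\<bar>x $ 1 - z $ 1\<bar> \<le> R" "\<bar>x $ 2 - z $ 2\<bar> \<le> R" using R unfolding mem_sq by linarith+
    then show "0 + tens (\<lambda>t. 1 * plateau (z $ 1) R t) (plateau (z $ 2) R) x = 1"
      using plateau_eq_1[OF R(1)] by (simp add: tens_def)
  qed auto
  moreover have "energy g (sq z (s / 8)) + energy g (ann z (R / 2) (5 / 2 * R)) \<le> energy g (sq z s)"
  proof (rule energy_add_le)
    show "sq z (s / 8) \<subseteq> sq z s" "ann z (R / 2) (5 / 2 * R) \<subseteq> sq z s"
      using R by (auto simp: mem_sq ann_def)
    show "sq z (s / 8) \<inter> ann z (R / 2) (5 / 2 * R) = {}"
    proof (intro equals0I, elim IntE)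
      fix y assume "y \<in> sq z (s / 8)" "y \<in> ann z (R / 2) (5 / 2 * R)"
      then show False using R unfolding mem_sq ann_def mem_Collect_eq by linarith
    qed
  qed auto
  ultimately show ?thesis by (rule theta_absorb)
qed

text \<open>
  Here the hole is the neighbourhood \<open>outer (8 * s)\<close> of infinity, and the cutoff vanishes on the
  square of half-width \<open>R = 2 * s \<ge> 1\<close>, which contains the unit disc.
\<close>

lemma exterior_decay:
  assumes s: "1 / 2 \<le> s"
  shows "energy g (outer (8 * s)) \<le> theta * energy g (outer s)"
proof -
  define R where "R = 2 * s"
  have R: "1 \<le> R" "0 < R" "s = R / 2" using s by (auto simp: R_def)
  have "\<nu>\<^sub>l * energy g (outer (8 * s)) \<le> kappa * energy g (ann 0 (R / 2) (5 / 2 * R))"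
  proof (rule caccioppoli[where a = 1 and b = "-1", OF R(2)])
    fix x :: "real^2" assume "x \<in> ball 0 1"
    then have x: "\<bar>x $ 1\<bar> < 1" "\<bar>x $ 2\<bar> < 1"
      using component_le_norm_cart[of x 1] component_le_norm_cart[of x 2] by auto
    then show "1 + tens (\<lambda>t. - 1 * plateau ((0 :: real^2) $ 1) R t) (plateau ((0 :: real^2) $ 2) R) x = 0"
      using plateau_eq_1[OF R(2)] R by (simp add: tens_def)
    show "x \<notin> ann 0 R (2 * R)" using x R by (auto simp: ann_def)
  next
    fix x assume "x \<in> outer (8 * s)"
    then have "2 * R \<le> \<bar>x $ 1\<bar> \<or> 2 * R \<le> \<bar>x $ 2\<bar>" using R by (auto simp: outer_def)
    then show "1 + tens (\<lambda>t. - 1 * plateau ((0 :: real^2) $ 1) R t) (plateau ((0 :: real^2) $ 2) R) x = 1"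
      using plateau_eq_0[OF R(2)] by (auto simp: tens_def)
  qed auto
  moreover have "energy g (outer (8 * s)) + energy g (ann 0 (R / 2) (5 / 2 * R)) \<le> energy g (outer s)"
    by (rule energy_add_le) (use R in \<open>auto simp: outer_def ann_def mem_sq\<close>)
  ultimately show ?thesis by (rule theta_absorb)
qed

end

section \<open>Square integrability of the weight and decay at infinity\<close>

lemma dyadic_annulus:
  assumes "x \<in> outer 1"
  obtains j where "x \<in> ann 0 (8 ^ j) (8 * 8 ^ j)"
proof -
  define m where "m = max \<bar>x $ 1\<bar> \<bar>x $ 2\<bar>"
  obtain n where "m < 8 ^ n" using real_arch_pow[of 8 m] by auto
  then have L: "m < 8 ^ (LEAST n. m < 8 ^ n)" by (rule LeastI)
  have "1 \<le> m" using assms by (auto simp: outer_def m_def)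
  with L obtain j where j: "(LEAST n. m < 8 ^ n) = Suc j"
    by (cases "LEAST n. m < 8 ^ n") auto
  then have "\<not> m < 8 ^ j" using not_less_Least[of j "\<lambda>n. m < 8 ^ n"] by simp
  with L j have "x \<in> ann 0 (8 ^ j) (8 * 8 ^ j)"
    by (auto simp: ann_def mem_sq m_def)
  with that show thesis .
qed

lemma weight_le_dyadic:
  assumes "x \<in> outer (8 ^ j)"
  shows "(weight x)\<^sup>2 \<le> 1 / (64 ^ j * (real (Suc j))\<^sup>2 * (ln 2)\<^sup>2)"
proof -
  have "8 ^ j \<le> norm x"
    using assms component_le_norm_cart[of x 1] component_le_norm_cart[of x 2] by (auto simp: outer_def)
  note n = this
  have "8 ^ j = sqrt ((8 ^ j)\<^sup>2)" by simp
  also have "\<dots> \<le> sqrt (1 + (norm x)\<^sup>2)"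
  proof (rule real_sqrt_le_mono)
    have "(8 ^ j)\<^sup>2 \<le> (norm x)\<^sup>2" by (rule power_mono[OF n]) simp
    then show "(8 ^ j)\<^sup>2 \<le> 1 + (norm x)\<^sup>2" by linarith
  qed
  finally have s: "8 ^ j \<le> sqrt (1 + (norm x)\<^sup>2)" .
  have "real (Suc j) * ln 2 = ln (2 ^ Suc j)" by (subst ln_realpow) auto
  also have "\<dots> \<le> ln (2 + norm x)"
  proof (rule ln_mono)
    have "(2::real) ^ j \<le> 8 ^ j" "(1::real) \<le> 2 ^ j" by (auto intro: power_mono)
    moreover have "(2::real) ^ Suc j \<le> 2 + 8 ^ j"
    proof (cases j)
      case (Suc i)
      have "(2::real) ^ i \<le> 8 ^ i" "(1::real) \<le> 2 ^ i" by (auto intro: power_mono)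
      then show ?thesis unfolding Suc power_Suc by linarith
    qed simp
    ultimately show "(2::real) ^ Suc j \<le> 2 + norm x" using n by linarith
  qed (auto simp: add_pos_nonneg)
  finally have l: "real (Suc j) * ln 2 \<le> ln (2 + norm x)" .
  have pos: "0 < 8 ^ j * (real (Suc j) * ln 2)" by simp
  have le: "8 ^ j * (real (Suc j) * ln 2) \<le> sqrt (1 + (norm x)\<^sup>2) * ln (2 + norm x)"
    using s l by (intro mult_mono) auto
  have "weight x \<le> 1 / (8 ^ j * (real (Suc j) * ln 2))"
    unfolding weight_def
    by (rule divide_left_mono[OF le zero_le_one mult_pos_pos[OF less_le_trans[OF pos le] pos]])
  then have "(weight x)\<^sup>2 \<le> (1 / (8 ^ j * (real (Suc j) * ln 2)))\<^sup>2"
    using weight_pos[of x] by (intro power_mono) auto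
  also have "\<dots> = 1 / (64 ^ j * (real (Suc j))\<^sup>2 * (ln 2)\<^sup>2)"
  proof -
    have "((8::real) ^ j)\<^sup>2 = 64 ^ j" by (simp add: power2_eq_square flip: power_mult_distrib)
    then show ?thesis by (simp add: power_divide power_mult_distrib mult.assoc del: of_nat_Suc)
  qed
  finally show ?thesis .
qed

text \<open>
  On the annulus of index \<open>j\<close> the squared weight is of order \<open>1 / (64 ^ j * (j + 1)\<^sup>2)\<close> and the area of order \<open>64 ^ j\<close>:
  the logarithm in the weight makes the sum converge.
\<close>

lemma weight_square_integrable: "integrable lborel (\<lambda>x. (weight x)\<^sup>2)"
proof (rule integrableI_bounded)
  define b where "b j = 1 / (64 ^ j * (real (Suc j))\<^sup>2 * (ln 2)\<^sup>2)" for j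
  have b0: "0 \<le> b j" for j by (simp add: b_def)
  have pt: "ennreal ((weight x)\<^sup>2) \<le> (\<Sum>j. ennreal (b j) * indicator (sq 0 (8 * 8 ^ j)) x)" for x
  proof -
    have "\<exists>j. x \<in> sq 0 (8 * 8 ^ j) \<and> (weight x)\<^sup>2 \<le> b j"
    proof (cases "x \<in> outer 1")
      case True
      then obtain j where j: "x \<in> ann 0 (8 ^ j) (8 * 8 ^ j)" by (rule dyadic_annulus)
      then have "x \<in> outer (8 ^ j)" by (auto simp: ann_def outer_def)
      from weight_le_dyadic[OF this] j show ?thesis by (auto simp: b_def ann_def)
    next
      case False
      then have "x \<in> sq 0 8" by (auto simp: outer_def mem_sq)
      moreover have "(weight x)\<^sup>2 \<le> (1 / ln 2)\<^sup>2"
        using weight_pos[of x] weight_le[of x] by (intro power_mono) auto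
      ultimately show ?thesis by (intro exI[of _ 0]) (simp add: b_def power_divide)
    qed
    then obtain j where j: "x \<in> sq 0 (8 * 8 ^ j)" "(weight x)\<^sup>2 \<le> b j" by blast
    have "ennreal ((weight x)\<^sup>2) \<le> (\<Sum>i\<in>{j}. ennreal (b i) * indicator (sq 0 (8 * 8 ^ i)) x)"
      using j by (simp add: ennreal_leI)
    also have "\<dots> \<le> (\<Sum>i. ennreal (b i) * indicator (sq 0 (8 * 8 ^ i)) x)"
      by (rule sum_le_suminf) auto
    finally show ?thesis .
  qed
  have sm: "summable (\<lambda>j. 256 / (ln 2)\<^sup>2 * (1 / (real (Suc j))\<^sup>2))"
  proof (rule summable_mult)
    have "summable (\<lambda>j. 1 / (real j)\<^sup>2)"
      using inverse_power_summable[of 2, where 'a = real] by (simp add: inverse_eq_divide)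
    then show "summable (\<lambda>j. 1 / (real (Suc j))\<^sup>2)" by (rule summable_Suc_iff[THEN iffD2])
  qed
  have "(\<integral>\<^sup>+x. ennreal (norm ((weight x)\<^sup>2)) \<partial>lborel) \<le>
      (\<integral>\<^sup>+x. (\<Sum>j. ennreal (b j) * indicator (sq 0 (8 * 8 ^ j)) x) \<partial>lborel)"
    using pt by (intro nn_integral_mono) simp
  also have "\<dots> = (\<Sum>j. \<integral>\<^sup>+x. ennreal (b j) * indicator (sq 0 (8 * 8 ^ j)) x \<partial>lborel)"
    by (rule nn_integral_suminf) simp
  also have "\<dots> = (\<Sum>j. ennreal (256 / (ln 2)\<^sup>2 * (1 / (real (Suc j))\<^sup>2)))"
  proof (rule suminf_cong)
    fix j
    have "(\<integral>\<^sup>+x. ennreal (b j) * indicator (sq 0 (8 * 8 ^ j)) x \<partial>lborel) = ennreal (b j) * ennreal ((2 * (8 * 8 ^ j))\<^sup>2)"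
      by (subst nn_integral_cmult) (auto simp: emeasure_sq)
    also have "\<dots> = ennreal (b j * (2 * (8 * 8 ^ j))\<^sup>2)" by (simp add: ennreal_mult b0)
    also have "b j * (2 * (8 * 8 ^ j))\<^sup>2 = 256 / (ln 2)\<^sup>2 * (1 / (real (Suc j))\<^sup>2)"
    proof -
      have "((8::real) ^ j)\<^sup>2 = 64 ^ j" by (simp add: power2_eq_square flip: power_mult_distrib)
      then show ?thesis by (simp add: b_def power_mult_distrib del: of_nat_Suc)
    qed
    finally show "(\<integral>\<^sup>+x. ennreal (b j) * indicator (sq 0 (8 * 8 ^ j)) x \<partial>lborel) = ennreal (256 / (ln 2)\<^sup>2 * (1 / (real (Suc j))\<^sup>2))" .
  qed
  also have "\<dots> = ennreal (\<Sum>j. 256 / (ln 2)\<^sup>2 * (1 / (real (Suc j))\<^sup>2))"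
    by (rule suminf_ennreal2[OF _ sm]) simp
  also have "\<dots> < \<infinity>" by simp
  finally show "(\<integral>\<^sup>+x. ennreal (norm ((weight x)\<^sup>2)) \<partial>lborel) < \<infinity>" .
qed measurable

text \<open>
  Subtracting a constant, and changing the function on a null set, stays within \<open>Hw\<close>; the square
  integrability of the weight is what puts constants into the space.
\<close>

lemma Hw_diff_const:
  assumes u: "u \<in> Hw" and [measurable]: "v \<in> borel_measurable borel"
    and v: "AE x in lborel. v x = u x - c"
  shows "v \<in> Hw"
proof -
  note [measurable] = Hw_measurable[OF u]
  obtain g where g: "L2_weak_gradient u g" using u by (auto simp: Hw_def)
  have "integrable lborel (\<lambda>x. (weight x * v x)\<^sup>2)"
  proof (rule Bochner_Integration.integrable_bound)
    show "integrable lborel (\<lambda>x. 2 * (weight x * u x)\<^sup>2 + 2 * c\<^sup>2 * (weight x)\<^sup>2)"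
      using u weight_square_integrable
      by (intro Bochner_Integration.integrable_add integrable_mult_right) (auto simp: Hw_def)
    show "AE x in lborel. norm ((weight x * v x)\<^sup>2) \<le> norm (2 * (weight x * u x)\<^sup>2 + 2 * c\<^sup>2 * (weight x)\<^sup>2)"
      using v
    proof eventually_elim
      case (elim x)
      have "(weight x * v x)\<^sup>2 \<le> 2 * (weight x * u x)\<^sup>2 + 2 * (weight x * c)\<^sup>2"
        unfolding elim using sum_squares_ge_zero[of "weight x * u x + weight x * c" 0]
        by (simp add: power2_eq_square algebra_simps)
      also have "\<dots> = 2 * (weight x * u x)\<^sup>2 + 2 * c\<^sup>2 * (weight x)\<^sup>2" by (simp add: power_mult_distrib)
      finally show ?case unfolding real_norm_def abs_power2 by (rule order_trans[OF _ abs_ge_self])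
    qed
  qed measurable
  moreover have "L2_weak_gradient v g"
    unfolding L2_weak_gradient_def
  proof (intro conjI allI impI)
    fix \<phi> i assume t: "test_function \<phi>"
    note s = test_function_bdd_supp[OF test_function_pderiv2[OF t]]
    have [measurable]: "pderiv2 i \<phi> \<in> borel_measurable borel" using s by (simp add: bdd_supp_def)
    have "(LINT x|lborel. v x * pderiv2 i \<phi> x) = (LINT x|lborel. u x * pderiv2 i \<phi> x - c * pderiv2 i \<phi> x)"
      using v by (intro integral_cong_AE) (auto simp: left_diff_distrib)
    also have "\<dots> = (LINT x|lborel. u x * pderiv2 i \<phi> x)"
      using loc_int_mult_integrable[OF Hw_loc_int[OF u] s] bdd_supp_integrable[OF s]
      by (simp add: integral_pderiv2_test_function[OF t])
    finally show "(LINT x|lborel. v x * pderiv2 i \<phi> x) = - (LINT x|lborel. g x $ i * \<phi> x)"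
      using g t by (simp add: L2_weak_gradient_def)
  qed (use g in \<open>auto simp: L2_weak_gradient_def\<close>)
  ultimately show ?thesis by (auto simp: Hw_def)
qed

lemma geometric_tail:
  fixes a :: "nat \<Rightarrow> real"
  assumes step: "\<And>k. \<bar>a (Suc k) - a k\<bar> \<le> B * q ^ k" and q: "0 \<le> q" "q < 1"
  shows "\<exists>l. a \<longlonglongrightarrow> l \<and> (\<forall>n. \<bar>a n - l\<bar> \<le> B / (1 - q) * q ^ n)"
proof -
  have sm: "summable (\<lambda>k. B * q ^ k)" using q by (intro summable_mult summable_geometric) simp
  have sd: "summable (\<lambda>k. a (Suc k) - a k)"
    by (rule summable_comparison_test[OF _ sm]) (use step in auto)
  then have "(\<lambda>n. \<Sum>k<n. a (Suc k) - a k) \<longlonglongrightarrow> (\<Sum>k. a (Suc k) - a k)" by (rule summable_LIMSEQ)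
  then have "(\<lambda>n. (a n - a 0) + a 0) \<longlonglongrightarrow> (\<Sum>k. a (Suc k) - a k) + a 0"
    unfolding sum_lessThan_telescope by (intro tendsto_intros)
  then obtain l where l: "a \<longlonglongrightarrow> l" by auto
  have B: "0 \<le> B" using step[of 0] by simp
  have le: "\<bar>a (n + m) - a n\<bar> \<le> B / (1 - q) * q ^ n * (1 - q ^ m)" for n m
  proof (induction m)
    case (Suc m)
    have "\<bar>a (n + Suc m) - a n\<bar> \<le> \<bar>a (n + m) - a n\<bar> + \<bar>a (Suc (n + m)) - a (n + m)\<bar>" by simp
    also have "\<dots> \<le> B / (1 - q) * q ^ n * (1 - q ^ m) + B * q ^ (n + m)" by (intro add_mono Suc step)
    also have "\<dots> = B / (1 - q) * q ^ n * (1 - q ^ Suc m)"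
      using q by (simp add: field_simps power_add)
    finally show ?case .
  qed simp
  have "\<bar>a n - l\<bar> \<le> B / (1 - q) * q ^ n" for n
  proof -
    have "(\<lambda>m. \<bar>a (m + n) - a n\<bar>) \<longlonglongrightarrow> \<bar>l - a n\<bar>"
      by (intro tendsto_intros LIMSEQ_ignore_initial_segment l)
    moreover have "\<bar>a (m + n) - a n\<bar> \<le> B / (1 - q) * q ^ n" for m
    proof -
      have "B / (1 - q) * q ^ n * (1 - q ^ m) \<le> B / (1 - q) * q ^ n * 1"
        using B q by (intro mult_left_mono) auto
      with le[of n m] show ?thesis by (simp add: add.commute)
    qed
    ultimately have "\<bar>l - a n\<bar> \<le> B / (1 - q) * q ^ n" by (intro LIMSEQ_le_const2[of _ "\<bar>l - a n\<bar>"]) auto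
    then show ?thesis by (simp add: abs_minus_commute)
  qed
  with l show ?thesis by blast
qed

lemma abs_le_from_square:
  fixes d :: real
  assumes "d\<^sup>2 \<le> C\<^sup>2 * (t * X)" "0 \<le> C" "0 \<le> t" "0 \<le> X"
  shows "\<bar>d\<bar> \<le> C * sqrt X * sqrt t"
proof -
  have "\<bar>d\<bar> = sqrt (d\<^sup>2)" by simp
  also have "\<dots> \<le> sqrt (C\<^sup>2 * (t * X))" using assms(1) by (rule real_sqrt_le_mono)
  also have "\<dots> = C * sqrt X * sqrt t" using assms by (simp add: real_sqrt_mult)
  finally show ?thesis .
qed

context solution
begin

lemma outer_energy: "energy g (outer (8 ^ j / 2)) \<le> theta ^ j * energy g UNIV"
proof (induction j)
  case 0
  show ?case by (simp add: energy_mono)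
next
  case (Suc j)
  have "(1::real) \<le> 8 ^ j" by simp
  then have "energy g (outer (8 * (8 ^ j / 2))) \<le> theta * energy g (outer (8 ^ j / 2))"
    by (intro exterior_decay) simp
  also have "\<dots> \<le> theta * (theta ^ j * energy g UNIV)"
    using Suc theta_bounds by (intro mult_left_mono) auto
  finally show ?case by simp
qed

lemma square_in_outer:
  assumes "x \<in> outer (8 ^ j)" shows "sq x (8 ^ j / 2) \<subseteq> outer (8 ^ j / 2)"
proof
  fix y assume "y \<in> sq x (8 ^ j / 2)"
  with assms show "y \<in> outer (8 ^ j / 2)" unfolding mem_sq outer_def mem_Collect_eq by linarith
qed

text \<open>
  The factor \<open>theta ^ Suc j\<close> comes from the distance of \<open>x\<close> to the disc, the factor \<open>theta ^ k\<close> from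
  the shrinking of the square. The index starts at \<open>Suc j\<close> because the largest square, of half-width \<open>8 ^ Suc j / 2\<close>, has to avoid the
  unit disc.
\<close>

lemma interior_energy:
  assumes x: "x \<in> outer (8 ^ Suc j)"
  shows "energy g (sq x (8 ^ Suc j / 2 / 8 ^ k)) \<le> theta ^ k * (theta ^ Suc j * energy g UNIV)"
proof (induction k)
  case 0
  have "energy g (sq x (8 ^ Suc j / 2)) \<le> energy g (outer (8 ^ Suc j / 2))"
    by (intro energy_mono square_in_outer x) auto
  also have "\<dots> \<le> theta ^ Suc j * energy g UNIV" by (rule outer_energy)
  finally show ?case by simp
next
  case (Suc k)
  let ?s = "8 ^ Suc j / 2 / 8 ^ k :: real"
  have off: "sq x ?s \<inter> ball 0 1 = {}"
  proof (intro equals0I, elim IntE)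
    fix y assume y: "y \<in> sq x ?s" "y \<in> ball 0 1"
    have "?s \<le> 8 ^ Suc j / 2" by (simp add: field_simps)
    with y(1) have "y \<in> sq x (8 ^ Suc j / 2)" unfolding mem_sq by linarith
    with square_in_outer[OF x] have "y \<in> outer (8 ^ Suc j / 2)" by blast
    moreover have "(1::real) \<le> 8 ^ j" by simp
    ultimately have "1 \<le> \<bar>y $ 1\<bar> \<or> 1 \<le> \<bar>y $ 2\<bar>"
      unfolding outer_def mem_Collect_eq power_Suc by linarith
    with y(2) component_le_norm_cart[of y 1] component_le_norm_cart[of y 2] show False by auto
  qed
  have "energy g (sq x (?s / 8)) \<le> theta * energy g (sq x ?s)"
    by (rule interior_decay[OF _ off]) simp
  also have "\<dots> \<le> theta * (theta ^ k * (theta ^ Suc j * energy g UNIV))"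
    using Suc theta_bounds by (intro mult_left_mono) auto
  finally show ?case by (simp add: mult.commute mult.left_commute)
qed

text \<open>
  Three comparisons, each with error \<open>sqrt theta ^ Suc j\<close> up to a constant: \<open>u x\<close> with its average at
  scale \<open>8 ^ Suc j / 2\<close> (\<open>int\<close>), this average with the one at the corner of the annulus (\<open>osc\<close>), and the
  averages at consecutive corners (\<open>step\<close>).
\<close>

lemma decay_AE:
  obtains c C where "AE x in lborel. \<forall>j. x \<in> ann 0 (8 ^ Suc j) (8 * 8 ^ Suc j) \<longrightarrow> \<bar>u x - c\<bar> \<le> C * sqrt theta ^ Suc j"
proof -
  define q where "q = sqrt theta"
  have q: "0 < q" "q < 1" using theta_bounds by (auto simp: q_def)
  define S where "S = sqrt (energy g UNIV)"
  have E: "0 \<le> energy g UNIV" by (rule energy_nonneg)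
  have S: "0 \<le> S" using E by (simp add: S_def)
  have bm: "0 \<le> bump_max" using bump_max(1) by simp
  have sqt: "sqrt (theta ^ n) = q ^ n" for n by (simp add: q_def real_sqrt_power)
  have th: "0 \<le> theta ^ n" for n using theta_bounds by simp
  define m where "m j = moll u (8 ^ Suc j / 2) (corner 0 (8 ^ Suc j))" for j
  have int: "\<bar>u x - moll u (8 ^ Suc j / 2) x\<bar> \<le> 32 * bump_max * S * q ^ Suc j / (1 - q)"
    if x: "x \<in> outer (8 ^ Suc j)" and conv: "(\<lambda>k. moll u (8 ^ Suc j / 2 / 8 ^ k) x) \<longlonglongrightarrow> u x" for x j
  proof -
    let ?a = "\<lambda>k. moll u (8 ^ Suc j / 2 / 8 ^ k) x"
    have "\<bar>?a (Suc k) - ?a k\<bar> \<le> (32 * bump_max * S * q ^ Suc j) * q ^ k" for k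
    proof -
      have "(?a (Suc k) - ?a k)\<^sup>2 \<le> (32 * bump_max)\<^sup>2 * energy g (sq x (8 ^ Suc j / 2 / 8 ^ k))"
        by (rule moll_step_le) simp
      also have "\<dots> \<le> (32 * bump_max)\<^sup>2 * (theta ^ k * (theta ^ Suc j * energy g UNIV))"
        by (intro mult_left_mono interior_energy x) simp
      finally have "(?a (Suc k) - ?a k)\<^sup>2 \<le> (32 * bump_max)\<^sup>2 * (theta ^ (k + Suc j) * energy g UNIV)"
        by (simp only: power_add mult.assoc)
      from abs_le_from_square[OF this _ th E] bm
      have "\<bar>?a (Suc k) - ?a k\<bar> \<le> 32 * bump_max * sqrt (energy g UNIV) * sqrt (theta ^ (k + Suc j))" by simp
      also have "\<dots> = (32 * bump_max * S * q ^ Suc j) * q ^ k"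
        unfolding sqt S_def[symmetric] by (simp only: power_add mult_ac)
      finally show ?thesis .
    qed
    from geometric_tail[of ?a, OF this] q obtain l where
      l: "?a \<longlonglongrightarrow> l" "\<bar>?a 0 - l\<bar> \<le> 32 * bump_max * S * q ^ Suc j / (1 - q) * q ^ 0" by fastforce
    then have "l = u x" using conv LIMSEQ_unique by blast
    with l(2) show ?thesis by (simp add: abs_minus_commute)
  qed
  have osc: "\<bar>moll u (8 ^ Suc j / 2) x - m j\<bar> \<le> 72 * bump_max * S * q ^ Suc j"
    if x: "x \<in> ann 0 (8 ^ Suc j) (8 * 8 ^ Suc j)" for x j
  proof -
    let ?A = "ann 0 (8 ^ Suc j / 2) (8 * 8 ^ Suc j + 8 ^ Suc j / 2)"
    have "(moll u (8 ^ Suc j / 2) x - m j)\<^sup>2 \<le> (72 * bump_max)\<^sup>2 * energy g ?A"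
      unfolding m_def by (rule moll_oscillation_annulus[OF _ x]) auto
    also have "\<dots> \<le> (72 * bump_max)\<^sup>2 * (theta ^ Suc j * energy g UNIV)"
    proof (intro mult_left_mono order_trans[OF _ outer_energy])
      show "energy g ?A \<le> energy g (outer (8 ^ Suc j / 2))"
        by (rule energy_mono) (auto simp: ann_def outer_def)
    qed simp
    finally have "(moll u (8 ^ Suc j / 2) x - m j)\<^sup>2 \<le> (72 * bump_max)\<^sup>2 * (theta ^ Suc j * energy g UNIV)" .
    from abs_le_from_square[OF this _ th E] bm
    show ?thesis unfolding sqt S_def[symmetric] by simp
  qed
  \<comment> \<open>The next corner lies on the outer boundary of the annulus of index \<open>Suc j\<close>, so the centre is moved first, at the
    smaller scale, and then the scale is changed.\<close>
  have step: "\<bar>m (Suc j) - m j\<bar> \<le> (104 * bump_max * S * q) * q ^ j" for j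
  proof -
    let ?c = "corner 0 (8 ^ Suc (Suc j))"
    have c: "?c $ i = 8 ^ Suc (Suc j)" for i by (simp add: corner_def)
    have 1: "\<bar>moll u (8 ^ Suc j / 2) ?c - m j\<bar> \<le> 72 * bump_max * S * q ^ Suc j"
      by (rule osc) (unfold ann_def mem_Collect_eq mem_sq c zero_index, simp)
    have "(moll u (8 ^ Suc (Suc j) / 2 / 8) ?c - moll u (8 ^ Suc (Suc j) / 2) ?c)\<^sup>2 \<le>
        (32 * bump_max)\<^sup>2 * energy g (sq ?c (8 ^ Suc (Suc j) / 2))"
      by (rule mollifier_rescale) simp
    also have "\<dots> \<le> (32 * bump_max)\<^sup>2 * (theta ^ Suc (Suc j) * energy g UNIV)"
    proof (intro mult_left_mono)
      have "?c \<in> outer (8 ^ Suc (Suc j))" unfolding outer_def mem_Collect_eq c by simp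
      from interior_energy[OF this, of 0]
      show "energy g (sq ?c (8 ^ Suc (Suc j) / 2)) \<le> theta ^ Suc (Suc j) * energy g UNIV" by simp
    qed simp
    finally have "(moll u (8 ^ Suc (Suc j) / 2 / 8) ?c - moll u (8 ^ Suc (Suc j) / 2) ?c)\<^sup>2 \<le>
        (32 * bump_max)\<^sup>2 * (theta ^ Suc (Suc j) * energy g UNIV)" .
    from abs_le_from_square[OF this _ th E] bm
    have 2: "\<bar>moll u (8 ^ Suc (Suc j) / 2 / 8) ?c - m (Suc j)\<bar> \<le> 32 * bump_max * S * q ^ Suc (Suc j)"
      unfolding sqt S_def[symmetric] m_def by simp
    have e: "8 ^ Suc (Suc j) / 2 / 8 = (8 ^ Suc j / 2 :: real)" by simp
    have "q ^ Suc (Suc j) \<le> q ^ Suc j" using q by (intro power_decreasing) auto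
    then have "32 * bump_max * S * q ^ Suc (Suc j) \<le> 32 * bump_max * S * q ^ Suc j"
      using bm S by (intro mult_left_mono) auto
    with 1 2[unfolded e] have "\<bar>m (Suc j) - m j\<bar> \<le> 72 * bump_max * S * q ^ Suc j + 32 * bump_max * S * q ^ Suc j"
      by linarith
    then show ?thesis by (simp add: algebra_simps)
  qed
  from geometric_tail[of m, OF step] q obtain c where
    c: "\<And>j. \<bar>m j - c\<bar> \<le> 104 * bump_max * S * q / (1 - q) * q ^ j" by fastforce
  define C where "C = 32 * bump_max * S / (1 - q) + 72 * bump_max * S + 104 * bump_max * S / (1 - q)"
  have "AE x in lborel. \<forall>j. (\<lambda>k. moll u (8 ^ Suc j / 2 / 8 ^ k) x) \<longlonglongrightarrow> u x"
    unfolding AE_all_countable by (intro allI moll_converges_AE) simp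
  then have "AE x in lborel. \<forall>j. x \<in> ann 0 (8 ^ Suc j) (8 * 8 ^ Suc j) \<longrightarrow> \<bar>u x - c\<bar> \<le> C * sqrt theta ^ Suc j"
  proof eventually_elim
    case (elim x)
    show ?case
    proof (intro allI impI)
      fix j assume x: "x \<in> ann 0 (8 ^ Suc j) (8 * 8 ^ Suc j)"
      then have o: "x \<in> outer (8 ^ Suc j)" by (auto simp: ann_def outer_def)
      have "\<bar>u x - c\<bar> \<le> 32 * bump_max * S * q ^ Suc j / (1 - q) + 72 * bump_max * S * q ^ Suc j +
          104 * bump_max * S * q / (1 - q) * q ^ j"
        using int[OF o elim[rule_format]] osc[OF x] c[of j] by linarith
      also have "\<dots> = C * q ^ Suc j" by (simp add: C_def distrib_right)
      finally show "\<bar>u x - c\<bar> \<le> C * sqrt theta ^ Suc j" by (simp add: q_def)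
    qed
  qed
  with that show thesis .
qed

lemma power_decay_AE:
  obtains c C \<tau> where "0 < \<tau>" "AE x in lborel. x \<in> outer 8 \<longrightarrow> \<bar>u x - c\<bar> \<le> C * norm x powr - \<tau>"
proof -
  obtain c C where AE: "AE x in lborel. \<forall>j. x \<in> ann 0 (8 ^ Suc j) (8 * 8 ^ Suc j) \<longrightarrow> \<bar>u x - c\<bar> \<le> C * sqrt theta ^ Suc j"
    by (rule decay_AE)
  define q where "q = sqrt theta"
  have q: "0 < q" "q < 1" using theta_bounds by (auto simp: q_def)
  define \<tau> where "\<tau> = - ln q / ln 8"
  have t: "0 < \<tau>" unfolding \<tau>_def using q by (intro divide_pos_pos) auto
  have q8: "q ^ j = (8 ^ j) powr - \<tau>" for j
  proof -
    have "8 powr - \<tau> = q" using q by (simp add: powr_def \<tau>_def)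
    then show ?thesis by (metis powr_powr powr_realpow mult.commute q(1) zero_less_numeral)
  qed
  have "AE x in lborel. x \<in> outer 8 \<longrightarrow> \<bar>u x - c\<bar> \<le> (\<bar>C\<bar> * 16 powr \<tau>) * norm x powr - \<tau>"
    using AE
  proof eventually_elim
    case (elim x)
    show ?case
    proof
      assume x8: "x \<in> outer 8"
      then have "x \<in> outer 1" by (auto simp: outer_def)
      then obtain i where i: "x \<in> ann 0 (8 ^ i) (8 * 8 ^ i)" by (rule dyadic_annulus)
      have "\<exists>j. x \<in> ann 0 (8 ^ Suc j) (8 * 8 ^ Suc j)"
      proof (cases i)
        case 0
        then have "x \<in> ann 0 (8 ^ Suc 0) (8 * 8 ^ Suc 0)" using i x8 by (auto simp: ann_def mem_sq outer_def)
        then show ?thesis by blast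
      qed (use i in auto)
      then obtain j where j: "x \<in> ann 0 (8 ^ Suc j) (8 * 8 ^ Suc j)" by blast
      let ?R = "8 ^ Suc j :: real"
      have n: "norm x \<le> 16 * ?R" using norm_le_two_sq[of x "8 * ?R"] j by (simp add: ann_def)
      have n0: "0 < norm x"
      proof -
        have "(0::real) < 8 ^ Suc j" by simp
        then have "0 < \<bar>x $ 1\<bar> \<or> 0 < \<bar>x $ 2\<bar>"
          using j unfolding ann_def mem_Collect_eq zero_index by linarith
        then show ?thesis by auto
      qed
      have "\<bar>u x - c\<bar> \<le> C * q ^ Suc j" using elim j by (simp only: q_def)
      also have "\<dots> \<le> \<bar>C\<bar> * q ^ Suc j" using q by (intro mult_right_mono) auto
      also have "q ^ Suc j \<le> (norm x / 16) powr - \<tau>"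
        unfolding q8 using n n0 t by (intro powr_mono2') auto
      also have "(norm x / 16) powr - \<tau> = 16 powr \<tau> * norm x powr - \<tau>"
        by (simp add: powr_divide powr_minus field_simps)
      finally show "\<bar>u x - c\<bar> \<le> (\<bar>C\<bar> * 16 powr \<tau>) * norm x powr - \<tau>"
        by (simp add: mult_left_mono mult.assoc)
    qed
  qed
  with t that show thesis by blast
qed

end

text \<open>
  Gradients of classes and of representatives agree almost everywhere, so the abstract equation can
  be tested with any element of \<open>Hw\<close> and any version of its gradient.
\<close>

lemma solution_of_Q:
  assumes N: "N1 \<nu>\<^sub>0 \<nu>\<^sub>l \<nu>" and H: "H \<in> H_space"
    and Q: "\<forall>\<eta>\<in>H_space. Q (ball 0 1) \<nu>\<^sub>0 \<nu> U\<^sub>0 H \<eta> = 0"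
  shows "\<exists>u\<in>H. solution u (grad_class H) \<nu>\<^sub>0 \<nu>\<^sub>l \<nu> U\<^sub>0"
proof -
  obtain w where w: "w \<in> Hw" "H = mod_constants `` {w}" using H unfolding H_space_def by (rule quotientE)
  then have wH: "w \<in> H" using class_in_H_space by blast
  obtain gw where "L2_weak_gradient w gw" using w(1) by (auto simp: Hw_def)
  from grad_class_eq(2)[OF H wH this] obtain u where u: "u \<in> H" "L2_weak_gradient u (grad_class H)" by blast
  have uHw: "u \<in> Hw" using u(1) w(2) by (auto simp: mod_constants_def)
  have "solution u (grad_class H) \<nu>\<^sub>0 \<nu>\<^sub>l \<nu> U\<^sub>0"
  proof unfold_locales
    show "u \<in> Hw" "L2_weak_gradient u (grad_class H)" by fact+
    show "N1 \<nu>\<^sub>0 \<nu>\<^sub>l \<nu>" by fact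
    fix v h assume v: "v \<in> Hw" "L2_weak_gradient v h" and h0: "\<forall>x\<in>ball 0 1. h x = 0"
    define \<eta> where "\<eta> = mod_constants `` {v}"
    have \<eta>: "\<eta> \<in> H_space" "v \<in> \<eta>" unfolding \<eta>_def by (rule class_in_H_space[OF v(1)])+
    note ge = grad_class_eq[OF \<eta> v(2)]
    let ?F = "flux \<nu>\<^sub>0 \<nu> U\<^sub>0 (grad_class H)"
    have [measurable]: "h \<in> borel_measurable borel" by (rule weak_gradient_measurable(1)[OF v(2)])
    have [measurable]: "grad_class \<eta> \<in> borel_measurable borel"
      using ge(2) weak_gradient_measurable(1) by blast
    have [measurable]: "?F \<in> borel_measurable borel"
      by (rule flux_measurable[OF N weak_gradient_measurable(1)[OF u(2)]])
    have b [measurable]: "ball (0 :: real^2) 1 \<in> sets borel" by simp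
    have source: "(LINT x:ball 0 1|lborel. ((\<nu>\<^sub>0 - \<nu> (norm U\<^sub>0)) *\<^sub>R U\<^sub>0) \<bullet> grad_class \<eta> x) = (LINT x|(lborel :: (real^2) measure). 0)"
      unfolding set_lebesgue_integral_def
    proof (rule integral_cong_AE)
      show "AE x in lborel. indicator (ball 0 1) x *\<^sub>R (((\<nu>\<^sub>0 - \<nu> (norm U\<^sub>0)) *\<^sub>R U\<^sub>0) \<bullet> grad_class \<eta> x) = (0::real)"
        using ge(1)
      proof eventually_elim
        case (elim x)
        then show ?case using h0 by (cases "x \<in> ball 0 1") auto
      qed
    qed measurable
    have grad: "(LINT x|lborel. ?F x \<bullet> grad_class \<eta> x) = (LINT x|lborel. ?F x \<bullet> h x)"
      by (rule integral_cong_AE) (use ge(1) in auto)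
    have "Q (ball 0 1) \<nu>\<^sub>0 \<nu> U\<^sub>0 H \<eta> = 0" using Q \<eta> by blast
    then show "(LINT x|lborel. ?F x \<bullet> h x) = 0"
      unfolding Q_def source flux_def[symmetric] grad Bochner_Integration.integral_zero add_0_right .
  qed
  with u(1) show ?thesis by blast
qed

theorem theorem1:
  fixes \<nu>\<^sub>0 \<nu>\<^sub>l :: real and \<nu> :: "real \<Rightarrow> real" and U\<^sub>0 :: "real^2"
    and H :: "(real^2 \<Rightarrow> real) set"
  assumes "\<nu>\<^sub>0 > 0"
    and "\<forall>s\<ge>0. \<nu> s \<ge> 0"
    and "N1 \<nu>\<^sub>0 \<nu>\<^sub>l \<nu>"
    and "N2 \<nu>"
    and "N3 \<nu>\<^sub>0 \<nu>\<^sub>l \<nu>"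
    and "U\<^sub>0 \<noteq> 0"
    and "H \<in> H_space"
    and "\<forall>\<eta>\<in>H_space. Q (ball 0 1) \<nu>\<^sub>0 \<nu> U\<^sub>0 H \<eta> = 0"
  shows "\<exists>h\<in>H. \<exists>\<tau>>0. h \<in> O[at_infinity](\<lambda>y. norm y powr (- \<tau>))"
proof -
  obtain u where uH: "u \<in> H" and sol: "solution u (grad_class H) \<nu>\<^sub>0 \<nu>\<^sub>l \<nu> U\<^sub>0"
    using solution_of_Q[OF assms(3,7,8)] by blast
  interpret solution u "grad_class H" \<nu>\<^sub>0 \<nu>\<^sub>l \<nu> U\<^sub>0 by (rule sol)
  obtain c C \<tau> where \<tau>: "0 < \<tau>" and AE: "AE x in lborel. x \<in> outer 8 \<longrightarrow> \<bar>u x - c\<bar> \<le> C * norm x powr - \<tau>"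
    by (rule power_decay_AE)
  \<comment> \<open>The value 0 on the exceptional null set turns the almost everywhere bound into a pointwise one.\<close>
  define h where "h x = (if x \<in> outer 8 \<longrightarrow> \<bar>u x - c\<bar> \<le> C * norm x powr - \<tau> then u x - c else 0)" for x
  have hm: "h \<in> borel_measurable borel" unfolding h_def[abs_def] by measurable
  have hAE: "AE x in lborel. h x = u x - c" using AE by eventually_elim (simp add: h_def)
  have hHw: "h \<in> Hw" by (rule Hw_diff_const[OF u_Hw hm hAE])
  obtain w where w: "w \<in> Hw" "H = mod_constants `` {w}" using assms(7) unfolding H_space_def by (rule quotientE)
  then obtain d where d: "AE x in lborel. w x = u x + d" using uH by (auto simp: mod_constants_def)
  have "AE x in lborel. w x = h x + (c + d)" using d hAE by eventually_elim simp
  then have hH: "h \<in> H" unfolding w(2) mod_constants_def using w(1) hHw by blast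
  have "h \<in> O[at_infinity](\<lambda>y. norm y powr (- \<tau>))"
  proof (rule bigoI[where c = "\<bar>C\<bar>"])
    have "eventually (\<lambda>x::real^2. norm x \<ge> 16) at_infinity" by (auto simp: eventually_at_infinity)
    then show "eventually (\<lambda>x. norm (h x) \<le> \<bar>C\<bar> * norm (norm x powr - \<tau>)) at_infinity"
    proof eventually_elim
      case (elim x)
      have "x \<in> outer 8" using norm_le_l1_cart[of x] elim by (simp add: outer_def sum_2) linarith
      then have "\<bar>h x\<bar> \<le> max 0 (C * norm x powr - \<tau>)" by (simp add: h_def)
      also have "\<dots> \<le> \<bar>C\<bar> * norm x powr - \<tau>" by (auto intro!: mult_right_mono)
      finally show ?case by simp
    qed
  qed
  with hH \<tau> show ?thesis by blast
qed

end
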